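(* Let $0<q<1$, $0<t<1$, and let $a_1,a_2,a_3,a_4\in\mathbb{C}$ with $|a_j|\le1$, $a_1\ne0$, $a_ia_j\ne1$ for $i\neq j$, and with non-real $a_j$ occurring in complex conjugate pairs. Put $A:=q^{-1}a_1a_2a_3a_4$. Let $m_1\ge m_2\ge0$ be integers. Then the two-variable Koornwinder polynomial $P_{m_1,m_2}$ is given explicitly by $$\frac{P_{m_1,m_2}(x_1,x_2;q,t;a_1,a_2,a_3,a_4)}{P_{m_1,m_2}(ta_1,a_1;q,t;a_1,a_2,a_3,a_4)}=\sum_{k_2=0}^{m_2}\sum_{k_1=k_2}^{m_1}Q_{k_1,k_2}\,\frac{N_{k_1,k_2}(x_1,x_2)}{E_{k_1,k_2}},$$ where $$Q_{k_1,k_2}=\frac{(q^{m_1}tA,\,q^{-m_1}t^{-1},\,q^{m_2}A,\,q^{-m_2};q)_{k_2}}{(q^{k_1}tA,\,q^{-k_1}t^{-1},\,q^{k_2}A,\,q^{-k_2};q)_{k_2}}\;\frac{(q^{m_1+k_2}t^2A,\,q^{k_2-m_1};q)_{k_1-k_2}}{(q^{k_1+k_2}t^2A,\,q^{k_2-k_1};q)_{k_1-k_2}}\;{}_4\phi_3\!\left({q^{-k_1+k_2},\,t,\,q^{m_2+k_2}A,\,q^{k_2-m_2}\atop q^{1-k_1+k_2}t^{-1},\,q^{m_1+k_2}t^2A,\,q^{k_2-m_1}};q,q\right),$$ $$N_{k_1,k_2}(x_1,x_2)=\frac{q^{-\frac12k_1(k_1-1)-\frac12k_2(k_2-1)}}{(-t)^{k_1-k_2}a_1^{k_1+k_2}}\,(a_1x_1,a_1x_1^{-1},a_1x_2,a_1x_2^{-1};q)_{k_2}\,(q^{k_2}ta_1x_1,q^{k_2}ta_1x_1^{-1};q)_{k_1-k_2}\;{}_4\phi_3\!\left({q^{-k_1+k_2},\,t,\,q^{k_2}a_1x_2,\,q^{k_2}a_1x_2^{-1}\atop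 q^{1-k_1+k_2}t^{-1},\,q^{k_2}ta_1x_1,\,q^{k_2}ta_1x_1^{-1}};q,q\right),$$ and $$E_{k_1,k_2}=P_{k_1,k_2}(ta_1,a_1;q,t;a_1,a_2,a_3,a_4)=t^{-k_1}a_1^{-k_1-k_2}\,\frac{(tA;q)_{k_1}(A;q)_{k_2}}{(t^2A;q)_{2k_1}(A;q)_{2k_2}}\,(ta_1a_2,ta_1a_3,ta_1a_4;q)_{k_1}\,(a_1a_2,a_1a_3,a_1a_4;q)_{k_2}\,\frac{(t^2A;q)_{k_1+k_2}}{(tA;q)_{k_1+k_2}}\,\frac{(t^2;q)_{k_1-k_2}}{(t;q)_{k_1-k_2}}.$$ This is an identity of Laurent polynomials in $x_1,x_2$: the denominators in the ${}_4\phi_3$ of $N_{k_1,k_2}$ cancel against its prefactor, and common factors in the quotients of $E_{k_1,k_2}$ are to be cancelled.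
   Context: Notation: $(a;q)_k=\prod_{i=0}^{k-1}(1-aq^i)$, $(a;q)_0=1$, $(a;q)_\infty=\prod_{i\ge0}(1-aq^i)$, $(b_1,\ldots,b_r;q)_k=\prod_i(b_i;q)_k$ (also for $k=\infty$). For a nonnegative integer $m$ the terminating series is $${}_4\phi_3\!\left({q^{-m},b_2,b_3,b_4\atop c_1,c_2,c_3};q,q\right)=\sum_{k=0}^m\frac{(q^{-m},b_2,b_3,b_4;q)_k}{(q,c_1,c_2,c_3;q)_k}\,q^k.$$ Koornwinder polynomials for $n=2$: partitions are $\lambda=(\lambda_1,\lambda_2)$ with integers $\lambda_1\ge\lambda_2\ge0$. Write $\mu\le\lambda$ iff $\mu_1\le\lambda_1$ and $\mu_1+\mu_2\le\lambda_1+\lambda_2$, and $\mu<\lambda$ iff $\mu\le\lambda$ and $\mu\ne\lambda$. Let $W_2=S_2\ltimes(\mathbb{Z}_2)^2$ act on $\mathbb{Z}^2$ by permutations and sign changes and put $\widetilde m_\lambda(x)=\sum_{\mu\in W_2\lambda}x_1^{\mu_1}x_2^{\mu_2}$ (orbit sum). $P_\lambda(x)=P_{\lambda_1,\lambda_2}(x_1,x_2;q,t;a_1,a_2,a_3,a_4)$ is the unique Laurent polynomial of the form $\widetilde m_\lambda(x)+\sum_{\mu<\lambda}u_{\lambda,\mu}\widetilde m_\mu(x)$ such that $\int_{\mathbb{T}^2}P_\lambda(x)\,\widetilde m_\mu(x)\,\Delta(x)\,\frac{dx_1}{x_1}\frac{dx_2}{x_2}=0$ for all $\mu<\lambda$,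 where $\mathbb{T}^2=\{|x_1|=|x_2|=1\}$, $\Delta(x)=\Delta_+(x)\Delta_+(x^{-1})$, $x^{-1}=(x_1^{-1},x_2^{-1})$, and $$\Delta_+(x)=\prod_{j=1}^2\frac{(x_j^2;q)_\infty}{(a_1x_j,a_2x_j,a_3x_j,a_4x_j;q)_\infty}\;\frac{(x_1x_2,x_1x_2^{-1};q)_\infty}{(tx_1x_2,tx_1x_2^{-1};q)_\infty}.$$ *)

theory Defs
  imports "HOL-Complex_Analysis.Complex_Analysis" "HOL-Library.Multiset"
begin

section \<open>q-shifted factorials and the terminating series\<close>

definition qpoch :: "complex \<Rightarrow> complex \<Rightarrow> nat \<Rightarrow> complex" where
  "qpoch a q k = (\<Prod>i<k. 1 - a * q ^ i)"

definition qpoch_inf :: "complex \<Rightarrow> complex \<Rightarrow> complex" where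
  "qpoch_inf a q = (\<Prod>i. 1 - a * q ^ i)"

definition qpochs :: "complex list \<Rightarrow> complex \<Rightarrow> nat \<Rightarrow> complex" where
  "qpochs bs q k = (\<Prod>b\<leftarrow>bs. qpoch b q k)"

definition qpochs_inf :: "complex list \<Rightarrow> complex \<Rightarrow> complex" where
  "qpochs_inf bs q = (\<Prod>b\<leftarrow>bs. qpoch_inf b q)"

text \<open>The first upper parameter is \<open>q\<^sup>-\<^sup>m\<close>; the argument of the series is \<open>q\<close>.\<close>

definition phi43 ::
  "complex \<Rightarrow> nat \<Rightarrow> complex \<Rightarrow> complex \<Rightarrow> complex \<Rightarrow> complex \<Rightarrow> complex \<Rightarrow> complex \<Rightarrow> complex" where
  "phi43 q m b2 b3 b4 c1 c2 c3 =
     (\<Sum>k\<le>m. qpochs [q powi (- int m), b2, b3, b4] q k / qpochs [q, c1, c2, c3] q k * q ^ k)"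

text \<open>For \<open>j \<le> m\<close> this is the quotient of \<open>qpoch a q m\<close> by \<open>qpoch a q j\<close> with the common
  factors cancelled; it is used wherever these factors may vanish.\<close>

definition qpoch_quot :: "complex \<Rightarrow> complex \<Rightarrow> nat \<Rightarrow> nat \<Rightarrow> complex" where
  "qpoch_quot a q m j = (\<Prod>i\<in>{j..<m}. 1 - a * q ^ i)"

lemma qpoch_quot_mult:
  assumes "j \<le> m"
  shows "qpoch a q j * qpoch_quot a q m j = qpoch a q m"
  unfolding qpoch_def qpoch_quot_def
  using prod.atLeastLessThan_concat[of 0 j m "\<lambda>i. 1 - a * q ^ i"] assms
  by (simp add: atLeast0LessThan)

lemma qpoch_quot_eq:
  assumes "j \<le> m" "qpoch a q j \<noteq> 0"
  shows "qpoch_quot a q m j = qpoch a q m / qpoch a q j"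
  using qpoch_quot_mult[OF assms(1), of a q] assms(2) by (simp add: field_simps)

lemma qpoch_nonzero_mono: "qpoch a q m \<noteq> 0 \<Longrightarrow> j \<le> m \<Longrightarrow> qpoch a q j \<noteq> 0"
  by (metis mult_zero_left qpoch_quot_mult)

section \<open>Koornwinder polynomials in two variables\<close>

definition partitions2 :: "(nat \<times> nat) set" where
  "partitions2 = {(l1, l2). l2 \<le> l1}"

definition dom_le :: "nat \<times> nat \<Rightarrow> nat \<times> nat \<Rightarrow> bool" where
  "dom_le m l \<longleftrightarrow> fst m \<le> fst l \<and> fst m + snd m \<le> fst l + snd l"

definition strictly_below :: "nat \<times> nat \<Rightarrow> (nat \<times> nat) set" where
  "strictly_below l = {m \<in> partitions2. dom_le m l \<and> m \<noteq> l}"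

definition W2_orbit :: "nat \<times> nat \<Rightarrow> (int \<times> int) set" where
  "W2_orbit l = {(s1 * u, s2 * v) | s1 s2 u v. s1 \<in> {1, -1} \<and> s2 \<in> {1, -1} \<and>
     (u, v) \<in> {(int (fst l), int (snd l)), (int (snd l), int (fst l))}}"

definition orbit_sum :: "nat \<times> nat \<Rightarrow> complex \<Rightarrow> complex \<Rightarrow> complex" where
  "orbit_sum l x1 x2 = (\<Sum>(u, v)\<in>W2_orbit l. x1 powi u * x2 powi v)"

text \<open>The four parameters are the values of a function \<open>a\<close> at \<open>1, 2, 3, 4\<close>.\<close>

definition Delta_plus ::
  "complex \<Rightarrow> complex \<Rightarrow> (nat \<Rightarrow> complex) \<Rightarrow> complex \<Rightarrow> complex \<Rightarrow> complex" where
  "Delta_plus q t a x1 x2 =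
     (\<Prod>x\<leftarrow>[x1, x2]. qpoch_inf (x\<^sup>2) q / qpochs_inf [a 1 * x, a 2 * x, a 3 * x, a 4 * x] q) *
     (qpochs_inf [x1 * x2, x1 * inverse x2] q / qpochs_inf [t * x1 * x2, t * x1 * inverse x2] q)"

definition Delta ::
  "complex \<Rightarrow> complex \<Rightarrow> (nat \<Rightarrow> complex) \<Rightarrow> complex \<Rightarrow> complex \<Rightarrow> complex" where
  "Delta q t a x1 x2 = Delta_plus q t a x1 x2 * Delta_plus q t a (inverse x1) (inverse x2)"

text \<open>The integral of \<open>F x1 x2\<close> over the unit torus against \<open>dx1/x1 dx2/x2\<close>.\<close>

definition torus_integral :: "(complex \<Rightarrow> complex \<Rightarrow> complex) \<Rightarrow> complex" where
  "torus_integral F =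
     contour_integral (circlepath 0 1)
       (\<lambda>x1. contour_integral (circlepath 0 1) (\<lambda>x2. F x1 x2 / x2) / x1)"

text \<open>A Laurent polynomial is represented by the function it induces. The condition below fixes
  this function on all of \<open>complex\<close> (with the convention \<open>0 powi n = 0\<close> for negative \<open>n\<close>), so
  that it is determined by its coefficients; only nonzero arguments are meaningful.\<close>

definition is_koornwinder ::
  "complex \<Rightarrow> complex \<Rightarrow> (nat \<Rightarrow> complex) \<Rightarrow> nat \<times> nat \<Rightarrow> (complex \<Rightarrow> complex \<Rightarrow> complex) \<Rightarrow> bool" where
  "is_koornwinder q t a l P \<longleftrightarrow>
     (\<exists>u. \<forall>x1 x2. P x1 x2 = orbit_sum l x1 x2 + (\<Sum>m\<in>strictly_below l. u m * orbit_sum m x1 x2)) \<and>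
     (\<forall>m\<in>strictly_below l.
        torus_integral (\<lambda>x1 x2. P x1 x2 * orbit_sum m x1 x2 * Delta q t a x1 x2) = 0)"

definition koornwinder ::
  "complex \<Rightarrow> complex \<Rightarrow> (nat \<Rightarrow> complex) \<Rightarrow> nat \<times> nat \<Rightarrow> complex \<Rightarrow> complex \<Rightarrow> complex" where
  "koornwinder q t a l = (THE P. is_koornwinder q t a l P)"

section \<open>The ingredients of the explicit formula\<close>

definition Apar :: "complex \<Rightarrow> (nat \<Rightarrow> complex) \<Rightarrow> complex" where
  "Apar q a = inverse q * a 1 * a 2 * a 3 * a 4"

definition Qcoeff ::
  "complex \<Rightarrow> complex \<Rightarrow> (nat \<Rightarrow> complex) \<Rightarrow> nat \<Rightarrow> nat \<Rightarrow> nat \<Rightarrow> nat \<Rightarrow> complex" where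
  "Qcoeff q t a m1 m2 k1 k2 = (let A = Apar q a in
     qpochs [q ^ m1 * t * A, q powi (- int m1) * inverse t, q ^ m2 * A, q powi (- int m2)] q k2 /
     qpochs [q ^ k1 * t * A, q powi (- int k1) * inverse t, q ^ k2 * A, q powi (- int k2)] q k2 *
     (qpochs [q ^ (m1 + k2) * t\<^sup>2 * A, q powi (int k2 - int m1)] q (k1 - k2) /
      qpochs [q ^ (k1 + k2) * t\<^sup>2 * A, q powi (int k2 - int k1)] q (k1 - k2)) *
     phi43 q (k1 - k2) t (q ^ (m2 + k2) * A) (q powi (int k2 - int m2))
       (q powi (1 - int k1 + int k2) * inverse t) (q ^ (m1 + k2) * t\<^sup>2 * A)
       (q powi (int k2 - int m1)))"

text \<open>In \<open>Npoly\<close> the denominators of the series that depend on \<open>x1\<close> have been cancelled against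
  the prefactor, so that it is a Laurent polynomial in \<open>x1\<close> and \<open>x2\<close>; the uncancelled
  form is \<open>Npoly_eq\<close> below.\<close>

definition Npoly ::
  "complex \<Rightarrow> complex \<Rightarrow> (nat \<Rightarrow> complex) \<Rightarrow> nat \<Rightarrow> nat \<Rightarrow> complex \<Rightarrow> complex \<Rightarrow> complex" where
  "Npoly q t a k1 k2 x1 x2 =
     q powi (- int (k1 * (k1 - 1) div 2) - int (k2 * (k2 - 1) div 2)) /
       ((- t) ^ (k1 - k2) * a 1 ^ (k1 + k2)) *
     qpochs [a 1 * x1, a 1 * inverse x1, a 1 * x2, a 1 * inverse x2] q k2 *
     (\<Sum>j\<le>k1 - k2.
        qpochs [q powi (- int (k1 - k2)), t, q ^ k2 * a 1 * x2, q ^ k2 * a 1 * inverse x2] q j /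
        qpochs [q, q powi (1 - int k1 + int k2) * inverse t] q j * q ^ j *
        qpoch_quot (q ^ k2 * t * a 1 * x1) q (k1 - k2) j *
        qpoch_quot (q ^ k2 * t * a 1 * inverse x1) q (k1 - k2) j)"

lemma Npoly_eq:
  assumes "qpochs [q ^ k2 * t * a 1 * x1, q ^ k2 * t * a 1 * inverse x1] q (k1 - k2) \<noteq> 0"
  shows "Npoly q t a k1 k2 x1 x2 =
     q powi (- int (k1 * (k1 - 1) div 2) - int (k2 * (k2 - 1) div 2)) /
       ((- t) ^ (k1 - k2) * a 1 ^ (k1 + k2)) *
     qpochs [a 1 * x1, a 1 * inverse x1, a 1 * x2, a 1 * inverse x2] q k2 *
     qpochs [q ^ k2 * t * a 1 * x1, q ^ k2 * t * a 1 * inverse x1] q (k1 - k2) *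
     phi43 q (k1 - k2) t (q ^ k2 * a 1 * x2) (q ^ k2 * a 1 * inverse x2)
       (q powi (1 - int k1 + int k2) * inverse t)
       (q ^ k2 * t * a 1 * x1) (q ^ k2 * t * a 1 * inverse x1)"
proof -
  define n where "n = k1 - k2"
  define y where "y = q ^ k2 * t * a 1 * x1"
  define z where "z = q ^ k2 * t * a 1 * inverse x1"
  have yz: "qpoch y q n \<noteq> 0" "qpoch z q n \<noteq> 0"
    using assms by (auto simp: qpochs_def n_def y_def z_def)
  have "(\<Sum>j\<le>n. qpochs [u1, u2, u3, u4] q j / qpochs [q, c] q j * q ^ j *
            qpoch_quot y q n j * qpoch_quot z q n j) =
          qpochs [y, z] q n *
          (\<Sum>j\<le>n. qpochs [u1, u2, u3, u4] q j / qpochs [q, c, y, z] q j * q ^ j)"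
    for u1 u2 u3 u4 c
    unfolding sum_distrib_left
  proof (rule sum.cong[OF refl])
    fix j assume "j \<in> {..n}"
    then have j: "j \<le> n" by simp
    show "qpochs [u1, u2, u3, u4] q j / qpochs [q, c] q j * q ^ j *
            qpoch_quot y q n j * qpoch_quot z q n j =
          qpochs [y, z] q n * (qpochs [u1, u2, u3, u4] q j / qpochs [q, c, y, z] q j * q ^ j)"
      using qpoch_quot_eq[OF j qpoch_nonzero_mono[OF yz(1) j]]
        qpoch_quot_eq[OF j qpoch_nonzero_mono[OF yz(2) j]]
      by (simp add: qpochs_def mult_ac)
  qed
  then show ?thesis
    unfolding Npoly_def phi43_def n_def[symmetric] y_def[symmetric] z_def[symmetric]
    by (simp only: mult.assoc)
qed

text \<open>Likewise, the quotients of shifted factorials of \<open>A\<close>, \<open>t A\<close> and \<open>t\<^sup>2 A\<close>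
  in \<open>Evalue\<close> are in cancelled form; the uncancelled form is \<open>Evalue_eq\<close> below.\<close>

definition Evalue :: "complex \<Rightarrow> complex \<Rightarrow> (nat \<Rightarrow> complex) \<Rightarrow> nat \<Rightarrow> nat \<Rightarrow> complex" where
  "Evalue q t a k1 k2 = (let A = Apar q a in
     t powi (- int k1) * a 1 powi (- int k1 - int k2) *
     (1 / (qpoch_quot (t\<^sup>2 * A) q (2 * k1) (k1 + k2) * qpoch_quot (t * A) q (k1 + k2) k1 *
           qpoch_quot A q (2 * k2) k2)) *
     qpochs [t * a 1 * a 2, t * a 1 * a 3, t * a 1 * a 4] q k1 *
     qpochs [a 1 * a 2, a 1 * a 3, a 1 * a 4] q k2 *
     (qpoch (t\<^sup>2) q (k1 - k2) / qpoch t q (k1 - k2)))"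

lemma Evalue_eq:
  fixes q t a
  defines "A \<equiv> Apar q a"
  assumes "k2 \<le> k1"
    and "qpoch (t\<^sup>2 * A) q (2 * k1) \<noteq> 0" "qpoch A q (2 * k2) \<noteq> 0" "qpoch (t * A) q (k1 + k2) \<noteq> 0"
  shows "Evalue q t a k1 k2 =
     t powi (- int k1) * a 1 powi (- int k1 - int k2) *
     (qpoch (t * A) q k1 * qpoch A q k2 / (qpoch (t\<^sup>2 * A) q (2 * k1) * qpoch A q (2 * k2))) *
     qpochs [t * a 1 * a 2, t * a 1 * a 3, t * a 1 * a 4] q k1 *
     qpochs [a 1 * a 2, a 1 * a 3, a 1 * a 4] q k2 *
     (qpoch (t\<^sup>2 * A) q (k1 + k2) / qpoch (t * A) q (k1 + k2)) *
     (qpoch (t\<^sup>2) q (k1 - k2) / qpoch t q (k1 - k2))"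
proof -
  have le: "k1 + k2 \<le> 2 * k1" "k1 \<le> k1 + k2" "k2 \<le> 2 * k2"
    using assms by auto
  show ?thesis
    unfolding Evalue_def Let_def A_def[symmetric]
      qpoch_quot_eq[OF le(1) qpoch_nonzero_mono[OF assms(3) le(1)]]
      qpoch_quot_eq[OF le(2) qpoch_nonzero_mono[OF assms(5) le(2)]]
      qpoch_quot_eq[OF le(3) qpoch_nonzero_mono[OF assms(4) le(3)]]
    by (simp add: mult_ac)
qed

end

theory Submission
  imports Defs
begin

text \<open>
  The double sum on the right is a binomial formula: up to normalisation it is
  \<open>\<Sum>\<^sub>k wt k * dual k m * Npol k (x, y)\<close>, where \<open>Npol k\<close> and \<open>dual k m\<close> are values of one and the same
  family \<open>interp\<close> of symmetric two-variable interpolation polynomials, taken once at the variables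
  \<open>x, y\<close> and once at a spectral point attached to the partition \<open>m\<close>. The theorem says that this sum
  is the Koornwinder polynomial of \<open>m\<close>, normalised to the value 1 at \<open>(t a\<^sub>1, a\<^sub>1)\<close>.

  The polynomial is recognised through Koornwinder's second-order q-difference operator \<open>kop\<close>.
  On the interpolation polynomials the operator is bidiagonal (\<open>kop_Npol\<close>): it sends \<open>Npol k\<close> to an
  eigenvalue times \<open>Npol k\<close> plus multiples of the two polynomials with one part of \<open>k\<close> lowered
  by one. Dually, multiplication of \<open>interp\<close> by a linear function of the sum of its variables raises one part of
  \<open>k\<close> by one (\<open>interp_pieri\<close>), and at the spectral point of \<open>m\<close> that linear function is, up to the factor
  \<open>t\<close>, the difference of the eigenvalues of \<open>m\<close> and \<open>k\<close>. The weights \<open>wt\<close> are chosen so that the two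
  sets of coefficients agree (\<open>wt_beta1\<close>, \<open>wt_beta2\<close>); hence the sum is an eigenfunction
  (\<open>kop_binom_sum\<close>). It is finite because \<open>dual k m\<close> vanishes unless \<open>k\<close> is contained in \<open>m\<close>, and its value at
  \<open>(t a\<^sub>1, a\<^sub>1)\<close> is 1 because there every \<open>Npol k\<close> with \<open>k \<noteq> (0, 0)\<close> vanishes.

  It remains to see that the eigenfunction satisfies the two defining properties. Expanding the
  products of linear factors shows that \<open>Npol k\<close> is a combination of orbit sums of partitions below
  \<open>k\<close> with an explicit leading coefficient; after multiplication by \<open>E\<^sub>m\<close> the sum becomes monic
  (\<open>binom_sum_triangular\<close>). The operator is symmetric for the pairing given by the weight function: its
  coefficients are quotients of shifted and unshifted weights, and the shifted circle of integration can be moved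
  back by Cauchy's theorem (\<open>shift_form_commute\<close>, \<open>pairing_orthogonal\<close>). Since comparable partitions have
  different eigenvalues (\<open>eigenvalue_distinct\<close>), orthogonality follows, and since the weight is
  nonnegative on the torus and nonzero at generic points, a monic polynomial with these orthogonality relations is unique. So \<open>E\<^sub>m\<close> times
  the sum is the Koornwinder polynomial (\<open>koornwinder_binom_sum\<close>), and \<open>E\<^sub>m\<close> is its value at
  \<open>(t a\<^sub>1, a\<^sub>1)\<close>.
\<close>

section \<open>Rational identities for the q-difference operator\<close>

text \<open>The action of the operator on interpolation polynomials reduces to one rational identity,
  \<open>diff_coeff\<close> below. Here \<open>s\<close>, \<open>J\<close>, \<open>R\<close> stand for \<open>q\<^sup>k\<close> with \<open>k = k\<^sub>2\<close>, for \<open>q\<^sup>j\<close>, and for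
  \<open>q\<^sup>i\<close> with \<open>i = k\<^sub>1 - k\<^sub>2 - j\<close>, while \<open>X\<close> and \<open>Y\<close> replace quotients whose denominators
  \<open>q - t J\<close> and \<open>q - t R\<close> may vanish. The identity is linear in the coefficients of the cubic
  \<open>(1 - b\<^sub>2 x) (1 - b\<^sub>3 x) (1 - b\<^sub>4 x)\<close>, which is therefore replaced by a general cubic
  \<open>p\<^sub>0 + p\<^sub>1 x + p\<^sub>2 x\<^sup>2 + p\<^sub>3 x\<^sup>3\<close>; the next six lemmas are its components, sorted further by powers
  of \<open>a\<close> and \<open>c\<close>, so that each is small enough for Groebner bases.\<close>

lemma diff_coeff_linear:
  fixes q t s J R X :: complex
  assumes nz: "q \<noteq> 0" "t \<noteq> 0" "s \<noteq> 0" "J \<noteq> 0" "R \<noteq> 0"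
    and M: "1 - t * (J * R) \<noteq> 0"
    and X: "(q - t * J) * X = q * (1 - J) * (1 - q * J)"
  shows "(1 - q * J) * (1 - q * R) * (1 - (s*J)) * t / (s*J) - X * (1 - t * R) * (1 - (s*J)/q) * (q / (s*J)) = (1 - q * J) * (1 - q * R) * ((1/(s*J*R) - 1) + t * (1/s - 1)) - (1 - (s*J*R)) / (s*J*R) * ((1 - q * (J*R)) / (1 - t * (J*R))) * (1 - q * J) * (1 - t * R) - (t - s) / s * ((1 - t^2 * (J*R) / q) / (1 - t * (J*R))) * X * (1 - q * R)"
  using nz M
  apply (simp add: divide_simps)
  using X apply algebra
  done

lemma diff_coeff_const_high:
  fixes q t s J R X :: complex
  assumes nz: "q \<noteq> 0" "t \<noteq> 0" "s \<noteq> 0" "J \<noteq> 0" "R \<noteq> 0"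
    and M: "1 - t * (J * R) \<noteq> 0"
    and X: "(q - t * J) * X = q * (1 - J) * (1 - q * J)"
  shows "- (1 - q * J) * (1 - q * R) * (1 - (s*J)) + X * t * (1 - t * R) * (1 - (s*J)/q) = (1 - q * J) * (1 - q * R) * (s - 1 + t * ((s*J*R) - 1)) + t * (1 - (s*J*R)) * ((1 - q * (J*R)) / (1 - t * (J*R))) * (1 - q * J) * (1 - t * R) + (t - s) * ((1 - t^2 * (J*R) / q) / (1 - t * (J*R))) * X * (1 - q * R)"
  using nz M
  apply (simp add: divide_simps)
  using X apply algebra
  done

lemma diff_coeff_const_low:
  fixes q t s J R X Y :: complex
  assumes nz: "q \<noteq> 0" "t \<noteq> 0" "s \<noteq> 0" "J \<noteq> 0" "R \<noteq> 0"
    and M: "1 - t * (J * R) \<noteq> 0"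
    and X: "(q - t * J) * X = q * (1 - J) * (1 - q * J)"
    and Y: "(q - t * R) * Y = q * (1 - R) * (1 - q * R)"
  shows "- (1 - q * J) * (1 - q * R) * (1 - (s*J)) * (1 + q) / (s*J)^2 + t * (1 - t * J) * Y * (1 - q * (s*J)) / (q * (s*J)^2) + X * (1 - t * R) / t * (1 - (s*J)/q) * q^2 / (s*J)^2 = (1 - q * J) * (1 - q * R) * (- t * (1 + q) + (q / t + t - q - 1) / (J * R) - (1 + q) / (t * (J * R)^2) + s * (1 + q * t) * (1 + 1 / (t * (J * R)))) / s^2 + (1 - (s*J*R)) / (t * (s*J*R)^2) * ((1 - q * (J*R)) / (1 - t * (J*R))) * (1 - q * J) * (1 - t * R) + (t - s) / s^2 * ((1 - t^2 * (J*R) / q) / (1 - t * (J*R))) * X * (1 - q * R) + (1 - t * (s*J*R)) / (s*J*R) * ((1 - t^2 * (J*R) / q) / (1 - t * (J*R))) * (q / (t * (s*J*R))) * (1 - q * J) * Y - (1 - 1/s) * ((1 - q * (J*R)) / (1 - t * (J*R))) * (q / s) * t * (1 - t * J) * (1 - q * R)"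
  using nz M
  apply (simp add: divide_simps)
  using X Y apply algebra
  done

lemma diff_coeff_cubic_high:
  fixes q t s J R X Y :: complex
  assumes nz: "q \<noteq> 0" "t \<noteq> 0" "s \<noteq> 0" "J \<noteq> 0" "R \<noteq> 0"
    and M: "1 - t * (J * R) \<noteq> 0"
    and X: "(q - t * J) * X = q * (1 - J) * (1 - q * J)"
    and Y: "(q - t * R) * Y = q * (1 - R) * (1 - q * R)"
  shows "- (1 - q * J) * (1 - q * R) * (1 - (s*J)) * t^2 * (s*J) * (1 + q) / q^2 + t * (1 - t * J) * Y * (1 - q * (s*J)) * (s*J) / q + X * (1 - t * R) * (1 - (s*J)/q) * t^3 * (s*J) / q^2 = (1 - q * J) * (1 - q * R) * (s * (- (t/q^2) * (1 + t * q) * (1 + t * (J * R))) + s^2 * (t * (1 + q) / q^2 + (t^2 + t^2 * q - t * q - t^3) * (J * R) / q^2 + t^3 * (1 + q) * (J*R)^2 / q^2)) + t^3 * (s*J*R) / q * (1 - (s*J*R)) * ((1 - q * (J*R)) / (1 - t * (J*R))) * (1 - q * J) * (1 - t * R) + t * s / q * (t - s) * ((1 - t^2 * (J*R) / q) / (1 - t * (J*R))) * X * (1 - q * R) + (1 - t * (s*J*R)) / (s*J*R) * ((1 - t^2 * (J*R) / q) / (1 - t * (J*R))) * (t * (s*J*R) / q)^2 * (1 - q * J) * Y - (1 - 1/s) * ((1 - q * (J*R)) / (1 - t * (J*R))) * (s / q)^2 * t * (1 - t * J) * (1 - q * R)"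
  using nz M
  apply (simp add: divide_simps)
  using X Y apply algebra
  done

lemma diff_coeff_p1:
  fixes q t s J R a Y :: complex
  assumes nz: "q \<noteq> 0" "t \<noteq> 0" "s \<noteq> 0" "J \<noteq> 0" "R \<noteq> 0" "a \<noteq> 0"
    and M: "1 - t * (J * R) \<noteq> 0"
    and Y: "(q - t * R) * Y = q * (1 - R) * (1 - q * R)"
  shows "(a/q) * ((1 - q * J) * (1 - q * R) * (1 - s * J) * (- (q / (a * (s * J)))) + t * (1 - t * J) * Y * (1 - q * (s * J)) / (a * (s * J)))
   = - (1 - q * J) * (1 - q * R) * ((1 / (s*J*R) - 1) + t * (1 / s - 1)) + (1 - t * (s*J*R)) * ((1 - t^2 * (J*R) / q) / (1 - t * (J*R))) / (s*J*R) * (1 - q * J) * Y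
    - (1 - 1 / s) * ((1 - q * (J*R)) / (1 - t * (J*R))) * t * (1 - t * J) * (1 - q * R)"
  using nz M
  apply (simp add: divide_simps)
  using Y apply algebra
  done

lemma diff_coeff_p2:
  fixes q t s J R a Y :: complex
  assumes nz: "q \<noteq> 0" "t \<noteq> 0" "s \<noteq> 0" "J \<noteq> 0" "R \<noteq> 0" "a \<noteq> 0"
    and M: "1 - t * (J * R) \<noteq> 0"
    and Y: "(q - t * R) * Y = q * (1 - R) * (1 - q * R)"
  shows "(a/q) * ((1 - q * J) * (1 - q * R) * (1 - s * J) * (- (t^2)) + t * (1 - t * J) * Y * (1 - q * (s * J)))
   = (1 - q * J) * (1 - q * R) * (a / q) * (t^2 * (s * J * R - 1) + t * (s - 1)) + (1 - t * (s*J*R)) * ((1 - t^2 * (J*R) / q) / (1 - t * (J*R))) / (s*J*R) * (t * a * (s*J*R) / q) * (1 - q * J) * Y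
    - (1 - 1 / s) * ((1 - q * (J*R)) / (1 - t * (J*R))) * (a * s / q) * t * (1 - t * J) * (1 - q * R)"
  using nz M
  apply (simp add: divide_simps)
  using Y apply algebra
  done

text \<open>The coefficients of \<open>p\<^sub>0, \<dots>, p\<^sub>3\<close> on the two sides of \<open>diff_coeff\<close> (letters \<open>L\<close> and \<open>R\<close>), rewritten in terms
  of the expressions of the preceding lemmas. On the right, the factors \<open>K\<close> and \<open>S\<close>, which carry the only
  denominators that are not monomials, are left as variables.\<close>

lemma diff_coeff_L0:
  fixes J R X Y a c q s t :: complex
  assumes nz: "s \<noteq> 0" "J \<noteq> 0" "R \<noteq> 0" "q \<noteq> 0" "t \<noteq> 0" "a \<noteq> 0"
  shows "(a / q) * ((1 - q * J) * (1 - q * R) * (1 - s * J) * (t * c * q / (a * (s * J)) - q - q * (1 + q) / (a * (s * J))^2)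
      + t * (1 - t * J) * Y * (1 - q * (s * J)) * (1 / (a * (s * J))^2)
      + X * (1 - t * R) / t * (1 - s * J / q) * (q / (a * (s * J / q))^2) * (1 + t^2 * (a * (s * J / q))^2 - t * (s * J / q) * (a * c))) = ((- (1 - q * J) * (1 - q * R) * (1 - (s*J)) * (1 + q) / (s*J)^2 + t * (1 - t * J) * Y * (1 - q * (s*J)) / (q * (s*J)^2) + X * (1 - t * R) / t * (1 - (s*J)/q) * q^2 / (s*J)^2) / a + a * (- (1 - q * J) * (1 - q * R) * (1 - (s*J)) + X * t * (1 - t * R) * (1 - (s*J)/q)) + c * ((1 - q * J) * (1 - q * R) * (1 - (s*J)) * t / (s*J) - X * (1 - t * R) * (1 - (s*J)/q) * (q / (s*J))))"
  using nz by (simp add: divide_simps) algebra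

lemma diff_coeff_L1:
  fixes J R X Y a c q s t :: complex
  assumes nz: "s \<noteq> 0" "J \<noteq> 0" "R \<noteq> 0" "q \<noteq> 0" "t \<noteq> 0" "a \<noteq> 0"
  shows "(a / q) * ((1 - q * J) * (1 - q * R) * (1 - s * J) * (- (q / (a * (s * J))))
      + t * (1 - t * J) * Y * (1 - q * (s * J)) * ((a * (s * J)) / (a * (s * J))^2)
      + X * (1 - t * R) / t * (1 - s * J / q) * 0 * (1 + t^2 * (a * (s * J / q))^2 - t * (s * J / q) * (a * c))) = ((a/q) * ((1 - q * J) * (1 - q * R) * (1 - s * J) * (- (q / (a * (s * J)))) + t * (1 - t * J) * Y * (1 - q * (s * J)) / (a * (s * J))))"
  using nz by (simp add: divide_simps) algebra

lemma diff_coeff_L2: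
  fixes J R X Y a c q s t :: complex
  assumes nz: "s \<noteq> 0" "J \<noteq> 0" "R \<noteq> 0" "q \<noteq> 0" "t \<noteq> 0" "a \<noteq> 0"
  shows "(a / q) * ((1 - q * J) * (1 - q * R) * (1 - s * J) * (- (t^2))
      + t * (1 - t * J) * Y * (1 - q * (s * J)) * ((a * (s * J))^2 / (a * (s * J))^2)
      + X * (1 - t * R) / t * (1 - s * J / q) * 0 * (1 + t^2 * (a * (s * J / q))^2 - t * (s * J / q) * (a * c))) = ((a/q) * ((1 - q * J) * (1 - q * R) * (1 - s * J) * (- (t^2)) + t * (1 - t * J) * Y * (1 - q * (s * J))))"
  using nz by (simp add: divide_simps)

lemma diff_coeff_L3:
  fixes J R X Y a c q s t :: complex
  assumes nz: "s \<noteq> 0" "J \<noteq> 0" "R \<noteq> 0" "q \<noteq> 0" "t \<noteq> 0" "a \<noteq> 0"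
  shows "(a / q) * ((1 - q * J) * (1 - q * R) * (1 - s * J) * (t * c - t^2 / (a * (s * J)) - t^2 * (1 + q) * (a * (s * J)) / q)
      + t * (1 - t * J) * Y * (1 - q * (s * J)) * ((a * (s * J))^3 / (a * (s * J))^2)
      + X * (1 - t * R) / t * (1 - s * J / q) * (t^2 / (a * (s * J / q))) * (1 + t^2 * (a * (s * J / q))^2 - t * (s * J / q) * (a * c))) = (- (t/q) * ((1 - q * J) * (1 - q * R) * (1 - (s*J)) * t / (s*J) - X * (1 - t * R) * (1 - (s*J)/q) * (q / (s*J))) - (t/q) * a * c * (- (1 - q * J) * (1 - q * R) * (1 - (s*J)) + X * t * (1 - t * R) * (1 - (s*J)/q)) + a^2 * (- (1 - q * J) * (1 - q * R) * (1 - (s*J)) * t^2 * (s*J) * (1 + q) / q^2 + t * (1 - t * J) * Y * (1 - q * (s*J)) * (s*J) / q + X * (1 - t * R) * (1 - (s*J)/q) * t^3 * (s*J) / q^2))"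
  using nz by (simp add: divide_simps) algebra

lemma diff_coeff_R0:
  fixes J K R S X Y a c q s t :: complex
  assumes nz: "s \<noteq> 0" "J \<noteq> 0" "R \<noteq> 0" "q \<noteq> 0" "t \<noteq> 0" "a \<noteq> 0"
  shows "(1 - q * J) * (1 - q * R) * ((a * (s - 1 + t * (s * (J * R) - 1)) + (- t * (1 + q) + (q / t + t - q - 1) / (J * R) - (1 + q) / (t * (J * R)^2) + s * (1 + q * t) * (1 + 1 / (t * (J * R)))) / (a * s^2)) + ((1 / (s * (J * R)) - 1) + t * (1 / s - 1)) * c)
      + (a / (q * t) * (1 - s * (J * R)) * (q / (a * (s * (J * R)))^2) * K) * ((1 - q * J) * (1 - t * R) * (1 + t^2 * (a * (s * (J * R)))^2 - t * (s * (J * R)) * (a * c)))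
      + (t / (a * s^2) * (t - s) * 1 * S) * (X * (1 - q * R) / t * (1 + (a * s)^2 - s * (a * c)))
      + ((1 - t * (s * (J * R))) / (s * (J * R)) * S * (1 / (t * a * (s * (J * R)) / q))) * ((1 - q * J) * Y) + (- (1 - 1 / s) * K * (1 / (a * s / q))) * (t * (1 - t * J) * (1 - q * R)) = (((1 - q * J) * (1 - q * R) * (- t * (1 + q) + (q / t + t - q - 1) / (J * R) - (1 + q) / (t * (J * R)^2) + s * (1 + q * t) * (1 + 1 / (t * (J * R)))) / s^2 + (1 - (s*J*R)) / (t * (s*J*R)^2) * K * (1 - q * J) * (1 - t * R) + (t - s) / s^2 * S * X * (1 - q * R) + (1 - t * (s*J*R)) / (s*J*R) * S * (q / (t * (s*J*R))) * (1 - q * J) * Y - (1 - 1/s) * K * (q / s) * t * (1 - t * J) * (1 - q * R)) / a + a * ((1 - q * J) * (1 - q * R) * (s - 1 + t * ((s*J*R) - 1)) + t * (1 - (s*J*R)) * K * (1 - q * J) * (1 - t * R) + (t - s) * S * X * (1 - q * R)) + c * ((1 - q * J) * (1 - q * R) * ((1/(s*J*R) - 1) + t * (1/s - 1)) - (1 - (s*J*R)) / (s*J*R) * K * (1 - q * J) * (1 - t * R) - (t - s) / s * S * X * (1 - q * R)))"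
  using nz by (simp add: divide_simps) algebra

lemma diff_coeff_R1:
  fixes J K R S X Y a c q s t :: complex
  assumes nz: "s \<noteq> 0" "J \<noteq> 0" "R \<noteq> 0" "q \<noteq> 0" "t \<noteq> 0" "a \<noteq> 0"
  shows "(1 - q * J) * (1 - q * R) * ((- ((1 / (s * (J * R)) - 1) + t * (1 / s - 1))) + 0 * c)
      + (a / (q * t) * (1 - s * (J * R)) * 0 * K) * ((1 - q * J) * (1 - t * R) * (1 + t^2 * (a * (s * (J * R)))^2 - t * (s * (J * R)) * (a * c)))
      + (t / (a * s^2) * (t - s) * 0 * S) * (X * (1 - q * R) / t * (1 + (a * s)^2 - s * (a * c)))
      + ((1 - t * (s * (J * R))) / (s * (J * R)) * S * ((t * a * (s * (J * R)) / q) / (t * a * (s * (J * R)) / q))) * ((1 - q * J) * Y) + (- (1 - 1 / s) * K * ((a * s / q) / (a * s / q))) * (t * (1 - t * J) * (1 - q * R)) = (- (1 - q * J) * (1 - q * R) * ((1 / (s*J*R) - 1) + t * (1 / s - 1)) + (1 - t * (s*J*R)) * S / (s*J*R) * (1 - q * J) * Y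
    - (1 - 1 / s) * K * t * (1 - t * J) * (1 - q * R))"
  using nz by (simp add: divide_simps) algebra

lemma diff_coeff_R2:
  fixes J K R S X Y a c q s t :: complex
  assumes nz: "s \<noteq> 0" "J \<noteq> 0" "R \<noteq> 0" "q \<noteq> 0" "t \<noteq> 0" "a \<noteq> 0"
  shows "(1 - q * J) * (1 - q * R) * (((a / q) * (t^2 * (s * (J * R) - 1) + t * (s - 1))) + 0 * c)
      + (a / (q * t) * (1 - s * (J * R)) * 0 * K) * ((1 - q * J) * (1 - t * R) * (1 + t^2 * (a * (s * (J * R)))^2 - t * (s * (J * R)) * (a * c)))
      + (t / (a * s^2) * (t - s) * 0 * S) * (X * (1 - q * R) / t * (1 + (a * s)^2 - s * (a * c)))
      + ((1 - t * (s * (J * R))) / (s * (J * R)) * S * ((t * a * (s * (J * R)) / q)^2 / (t * a * (s * (J * R)) / q))) * ((1 - q * J) * Y) + (- (1 - 1 / s) * K * ((a * s / q)^2 / (a * s / q))) * (t * (1 - t * J) * (1 - q * R)) = ((1 - q * J) * (1 - q * R) * (a / q) * (t^2 * (s * J * R - 1) + t * (s - 1)) + (1 - t * (s*J*R)) * S / (s*J*R) * (t * a * (s*J*R) / q) * (1 - q * J) * Y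
    - (1 - 1 / s) * K * (a * s / q) * t * (1 - t * J) * (1 - q * R))"
  using nz by (simp add: divide_simps) algebra

lemma diff_coeff_R3:
  fixes J K R S X Y a c q s t :: complex
  assumes nz: "s \<noteq> 0" "J \<noteq> 0" "R \<noteq> 0" "q \<noteq> 0" "t \<noteq> 0" "a \<noteq> 0"
  shows "(1 - q * J) * (1 - q * R) * ((- (t/q) * ((1 / (s * (J * R)) - 1) + t * (1 / s - 1)) + a^2 * (s * (- (t/q^2) * (1 + t * q) * (1 + t * (J * R))) + s^2 * (t * (1 + q) / q^2 + (t^2 + t^2 * q - t * q - t^3) * (J * R) / q^2 + t^3 * (1 + q) * (J * R)^2 / q^2))) + (- (a / q) * (t^2 * (s * (J * R) - 1) + t * (s - 1))) * c)
      + (a / (q * t) * (1 - s * (J * R)) * (t^2 / (a * (s * (J * R)))) * K) * ((1 - q * J) * (1 - t * R) * (1 + t^2 * (a * (s * (J * R)))^2 - t * (s * (J * R)) * (a * c)))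
      + (t / (a * s^2) * (t - s) * (a * t * s / q) * S) * (X * (1 - q * R) / t * (1 + (a * s)^2 - s * (a * c)))
      + ((1 - t * (s * (J * R))) / (s * (J * R)) * S * ((t * a * (s * (J * R)) / q)^3 / (t * a * (s * (J * R)) / q))) * ((1 - q * J) * Y) + (- (1 - 1 / s) * K * ((a * s / q)^3 / (a * s / q))) * (t * (1 - t * J) * (1 - q * R)) = (- (t/q) * ((1 - q * J) * (1 - q * R) * ((1/(s*J*R) - 1) + t * (1/s - 1)) - (1 - (s*J*R)) / (s*J*R) * K * (1 - q * J) * (1 - t * R) - (t - s) / s * S * X * (1 - q * R)) - (t/q) * a * c * ((1 - q * J) * (1 - q * R) * (s - 1 + t * ((s*J*R) - 1)) + t * (1 - (s*J*R)) * K * (1 - q * J) * (1 - t * R) + (t - s) * S * X * (1 - q * R)) + a^2 * ((1 - q * J) * (1 - q * R) * (s * (- (t/q^2) * (1 + t * q) * (1 + t * (J * R))) + s^2 * (t * (1 + q) / q^2 + (t^2 + t^2 * q - t * q - t^3) * (J * R) / q^2 + t^3 * (1 + q) * (J*R)^2 / q^2)) + t^3 * (s*J*R) / q * (1 - (s*J*R)) * K * (1 - q * J) * (1 - t * R) + t * s / q * (t - s) * S * X * (1 - q * R) + (1 - t * (s*J*R)) / (s*J*R) * S * (t * (s*J*R) / q)^2 * (1 - q * J) * Y - (1 - 1/s) * K * (s / q)^2 * t * (1 - t * J) * (1 - q * R)))"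
  using nz by (simp add: divide_simps) algebra

locale q_and_t =
  fixes q t :: complex
  assumes q_nz: "q \<noteq> 0" and q_less: "norm q < 1" and t_nz: "t \<noteq> 0" and t_less: "norm t < 1"

text \<open>The parameter \<open>a\<close> is \<open>a\<^sub>1\<close>; the other three parameters enter only through the cubic with
  coefficients \<open>p0, p1, p2, p3\<close>.\<close>

locale koornwinder_coeffs = q_and_t +
  fixes a p0 p1 p2 p3 :: complex
  assumes a_nz: "a \<noteq> 0"
begin

definition "cubic x = p0 + p1 * x + p2 * x^2 + p3 * x^3"
definition "kap M = (1 - q * M) / (1 - t * M)"
definition "sig M = (1 - t^2 * M / q) / (1 - t * M)"
definition "shift_up L = p0 * (q / (a * L)^2) + p3 * (t^2 / (a * L))"
definition "shift_mid c L = p0 * (t * c * q / (a * L) - q - q * (1 + q) / (a * L)^2) + p1 * (- (q / (a * L)))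
   + p2 * (- (t^2)) + p3 * (t * c - t^2 / (a * L) - t^2 * (1 + q) * (a * L) / q)"
definition "eigen s M = p0 * ((1 / (s * M) - 1) + t * (1 / s - 1)) + p3 * (- (a / q) * (t^2 * (s * M - 1) + t * (s - 1)))"
definition "sym0 s M =
    p0 * (a * (s - 1 + t * (s * M - 1)) + (- t * (1 + q) + (q / t + t - q - 1) / M - (1 + q) / (t * M^2) + s * (1 + q * t) * (1 + 1 / (t * M))) / (a * s^2))
  + p1 * (- ((1 / (s * M) - 1) + t * (1 / s - 1)))
  + p2 * ((a / q) * (t^2 * (s * M - 1) + t * (s - 1)))
  + p3 * (- (t/q) * ((1 / (s * M) - 1) + t * (1 / s - 1)) + a^2 * (s * (- (t/q^2) * (1 + t * q) * (1 + t * M)) + s^2 * (t * (1 + q) / q^2 + (t^2 + t^2 * q - t * q - t^3) * M / q^2 + t^3 * (1 + q) * M^2 / q^2)))"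
definition "sym3 s M = a / (q * t) * (1 - s * M) * shift_up (s * M) * kap M"
definition "sym4 s M = t / (a * s^2) * (t - s) * (p0 + p3 * (a * t * s / q)) * sig M"
definition "low1 s M = (1 - t * (s * M)) / (s * M) * sig M * (cubic (t * a * (s * M) / q) / (t * a * (s * M) / q))"
definition "low2 s M = - (1 - 1 / s) * kap M * (cubic (a * s / q) / (a * s / q))"

text \<open>These two lemmas split the sides of \<open>diff_coeff\<close> by coefficients of the cubic. They are stated
  for generic expressions because expanding the actual ones would destroy their shape.\<close>

lemma cubic_linear_left: "f * (w1 * (p0 * m0 + p1 * m1 + p2 * m2 + p3 * m3) + w2 * ((p0 + p1 * x + p2 * x^2 + p3 * x^3) / d) + w3 * (p0 * u0 + p3 * u3) * w4)
  = p0 * (f * (w1 * m0 + w2 * (1 / d) + w3 * u0 * w4)) + p1 * (f * (w1 * m1 + w2 * (x / d) + w3 * 0 * w4))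
  + p2 * (f * (w1 * m2 + w2 * (x^2 / d) + w3 * 0 * w4)) + p3 * (f * (w1 * m3 + w2 * (x^3 / d) + w3 * u3 * w4))" for f :: complex
  by (simp add: algebra_simps add_divide_distrib)

lemma cubic_linear_right: "f * ((p0 * m0 + p1 * m1 + p2 * m2 + p3 * m3) + (p0 * e0 + p3 * e3) * c) + g * (p0 * u0 + p3 * u3) * K * z3
   + h * (p0 + p3 * v3) * S * z4 + l * S * ((p0 + p1 * x + p2 * x^2 + p3 * x^3) / x) * z5 + r * K * ((p0 + p1 * y + p2 * y^2 + p3 * y^3) / y) * z6
  = p0 * (f * (m0 + e0 * c) + g * u0 * K * z3 + h * 1 * S * z4 + l * S * (1 / x) * z5 + r * K * (1 / y) * z6)
  + p1 * (f * (m1 + 0 * c) + g * 0 * K * z3 + h * 0 * S * z4 + l * S * (x / x) * z5 + r * K * (y / y) * z6)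
  + p2 * (f * (m2 + 0 * c) + g * 0 * K * z3 + h * 0 * S * z4 + l * S * (x^2 / x) * z5 + r * K * (y^2 / y) * z6)
  + p3 * (f * (m3 + e3 * c) + g * u3 * K * z3 + h * v3 * S * z4 + l * S * (x^3 / x) * z5 + r * K * (y^3 / y) * z6)" for f :: complex
  by (simp add: algebra_simps add_divide_distrib)

lemma diff_coeff:
  assumes nz: "s \<noteq> 0" "J \<noteq> 0" "R \<noteq> 0"
    and M: "1 - t * (J * R) \<noteq> 0"
    and X: "(q - t * J) * X = q * (1 - J) * (1 - q * J)"
    and Y: "(q - t * R) * Y = q * (1 - R) * (1 - q * R)"
  shows "(a / q) * ((1 - q * J) * (1 - q * R) * (1 - s * J) * shift_mid c (s * J)
      + t * (1 - t * J) * Y * (1 - q * (s * J)) * (cubic (a * (s * J)) / (a * (s * J))^2)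
      + X * (1 - t * R) / t * (1 - s * J / q) * shift_up (s * J / q) * (1 + t^2 * (a * (s * J / q))^2 - t * (s * J / q) * (a * c)))
    = (1 - q * J) * (1 - q * R) * (sym0 s (J * R) + eigen s (J * R) * c)
      + sym3 s (J * R) * ((1 - q * J) * (1 - t * R) * (1 + t^2 * (a * (s * (J * R)))^2 - t * (s * (J * R)) * (a * c)))
      + sym4 s (J * R) * (X * (1 - q * R) / t * (1 + (a * s)^2 - s * (a * c)))
      + low1 s (J * R) * ((1 - q * J) * Y) + low2 s (J * R) * (t * (1 - t * J) * (1 - q * R))"
proof -
  note nz = nz q_nz t_nz a_nz
  define K where "K = kap (J * R)"
  define S where "S = sig (J * R)"
  have L: "(a / q) * ((1 - q * J) * (1 - q * R) * (1 - s * J) * shift_mid c (s * J)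
      + t * (1 - t * J) * Y * (1 - q * (s * J)) * (cubic (a * (s * J)) / (a * (s * J))^2)
      + X * (1 - t * R) / t * (1 - s * J / q) * shift_up (s * J / q) * (1 + t^2 * (a * (s * J / q))^2 - t * (s * J / q) * (a * c))) = p0 * ((a / q) * ((1 - q * J) * (1 - q * R) * (1 - s * J) * (t * c * q / (a * (s * J)) - q - q * (1 + q) / (a * (s * J))^2)
      + t * (1 - t * J) * Y * (1 - q * (s * J)) * (1 / (a * (s * J))^2)
      + X * (1 - t * R) / t * (1 - s * J / q) * (q / (a * (s * J / q))^2) * (1 + t^2 * (a * (s * J / q))^2 - t * (s * J / q) * (a * c)))) + p1 * ((a / q) * ((1 - q * J) * (1 - q * R) * (1 - s * J) * (- (q / (a * (s * J))))
      + t * (1 - t * J) * Y * (1 - q * (s * J)) * ((a * (s * J)) / (a * (s * J))^2)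
      + X * (1 - t * R) / t * (1 - s * J / q) * 0 * (1 + t^2 * (a * (s * J / q))^2 - t * (s * J / q) * (a * c)))) + p2 * ((a / q) * ((1 - q * J) * (1 - q * R) * (1 - s * J) * (- (t^2))
      + t * (1 - t * J) * Y * (1 - q * (s * J)) * ((a * (s * J))^2 / (a * (s * J))^2)
      + X * (1 - t * R) / t * (1 - s * J / q) * 0 * (1 + t^2 * (a * (s * J / q))^2 - t * (s * J / q) * (a * c)))) + p3 * ((a / q) * ((1 - q * J) * (1 - q * R) * (1 - s * J) * (t * c - t^2 / (a * (s * J)) - t^2 * (1 + q) * (a * (s * J)) / q)
      + t * (1 - t * J) * Y * (1 - q * (s * J)) * ((a * (s * J))^3 / (a * (s * J))^2)
      + X * (1 - t * R) / t * (1 - s * J / q) * (t^2 / (a * (s * J / q))) * (1 + t^2 * (a * (s * J / q))^2 - t * (s * J / q) * (a * c))))"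
    unfolding shift_mid_def shift_up_def cubic_def by (rule cubic_linear_left)
  have R: "(1 - q * J) * (1 - q * R) * (sym0 s (J * R) + eigen s (J * R) * c)
      + sym3 s (J * R) * ((1 - q * J) * (1 - t * R) * (1 + t^2 * (a * (s * (J * R)))^2 - t * (s * (J * R)) * (a * c)))
      + sym4 s (J * R) * (X * (1 - q * R) / t * (1 + (a * s)^2 - s * (a * c)))
      + low1 s (J * R) * ((1 - q * J) * Y) + low2 s (J * R) * (t * (1 - t * J) * (1 - q * R)) = p0 * ((1 - q * J) * (1 - q * R) * ((a * (s - 1 + t * (s * (J * R) - 1)) + (- t * (1 + q) + (q / t + t - q - 1) / (J * R) - (1 + q) / (t * (J * R)^2) + s * (1 + q * t) * (1 + 1 / (t * (J * R)))) / (a * s^2)) + ((1 / (s * (J * R)) - 1) + t * (1 / s - 1)) * c)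
      + (a / (q * t) * (1 - s * (J * R)) * (q / (a * (s * (J * R)))^2) * K) * ((1 - q * J) * (1 - t * R) * (1 + t^2 * (a * (s * (J * R)))^2 - t * (s * (J * R)) * (a * c)))
      + (t / (a * s^2) * (t - s) * 1 * S) * (X * (1 - q * R) / t * (1 + (a * s)^2 - s * (a * c)))
      + ((1 - t * (s * (J * R))) / (s * (J * R)) * S * (1 / (t * a * (s * (J * R)) / q))) * ((1 - q * J) * Y) + (- (1 - 1 / s) * K * (1 / (a * s / q))) * (t * (1 - t * J) * (1 - q * R))) + p1 * ((1 - q * J) * (1 - q * R) * ((- ((1 / (s * (J * R)) - 1) + t * (1 / s - 1))) + 0 * c)
      + (a / (q * t) * (1 - s * (J * R)) * 0 * K) * ((1 - q * J) * (1 - t * R) * (1 + t^2 * (a * (s * (J * R)))^2 - t * (s * (J * R)) * (a * c)))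
      + (t / (a * s^2) * (t - s) * 0 * S) * (X * (1 - q * R) / t * (1 + (a * s)^2 - s * (a * c)))
      + ((1 - t * (s * (J * R))) / (s * (J * R)) * S * ((t * a * (s * (J * R)) / q) / (t * a * (s * (J * R)) / q))) * ((1 - q * J) * Y) + (- (1 - 1 / s) * K * ((a * s / q) / (a * s / q))) * (t * (1 - t * J) * (1 - q * R))) + p2 * ((1 - q * J) * (1 - q * R) * (((a / q) * (t^2 * (s * (J * R) - 1) + t * (s - 1))) + 0 * c)
      + (a / (q * t) * (1 - s * (J * R)) * 0 * K) * ((1 - q * J) * (1 - t * R) * (1 + t^2 * (a * (s * (J * R)))^2 - t * (s * (J * R)) * (a * c)))
      + (t / (a * s^2) * (t - s) * 0 * S) * (X * (1 - q * R) / t * (1 + (a * s)^2 - s * (a * c)))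
      + ((1 - t * (s * (J * R))) / (s * (J * R)) * S * ((t * a * (s * (J * R)) / q)^2 / (t * a * (s * (J * R)) / q))) * ((1 - q * J) * Y) + (- (1 - 1 / s) * K * ((a * s / q)^2 / (a * s / q))) * (t * (1 - t * J) * (1 - q * R))) + p3 * ((1 - q * J) * (1 - q * R) * ((- (t/q) * ((1 / (s * (J * R)) - 1) + t * (1 / s - 1)) + a^2 * (s * (- (t/q^2) * (1 + t * q) * (1 + t * (J * R))) + s^2 * (t * (1 + q) / q^2 + (t^2 + t^2 * q - t * q - t^3) * (J * R) / q^2 + t^3 * (1 + q) * (J * R)^2 / q^2))) + (- (a / q) * (t^2 * (s * (J * R) - 1) + t * (s - 1))) * c)
      + (a / (q * t) * (1 - s * (J * R)) * (t^2 / (a * (s * (J * R)))) * K) * ((1 - q * J) * (1 - t * R) * (1 + t^2 * (a * (s * (J * R)))^2 - t * (s * (J * R)) * (a * c)))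
      + (t / (a * s^2) * (t - s) * (a * t * s / q) * S) * (X * (1 - q * R) / t * (1 + (a * s)^2 - s * (a * c)))
      + ((1 - t * (s * (J * R))) / (s * (J * R)) * S * ((t * a * (s * (J * R)) / q)^3 / (t * a * (s * (J * R)) / q))) * ((1 - q * J) * Y) + (- (1 - 1 / s) * K * ((a * s / q)^3 / (a * s / q))) * (t * (1 - t * J) * (1 - q * R)))"
    unfolding sym0_def eigen_def sym3_def sym4_def low1_def low2_def shift_up_def cubic_def K_def[symmetric] S_def[symmetric] by (rule cubic_linear_right)
  note e1 = diff_coeff_const_low[OF q_nz t_nz nz(1-3) M X Y, folded kap_def sig_def, folded K_def S_def]
  note e2 = diff_coeff_const_high[OF q_nz t_nz nz(1-3) M X, folded kap_def sig_def, folded K_def S_def]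
  note e3 = diff_coeff_linear[OF q_nz t_nz nz(1-3) M X, folded kap_def sig_def, folded K_def S_def]
  note e4 = diff_coeff_cubic_high[OF q_nz t_nz nz(1-3) M X Y, folded kap_def sig_def, folded K_def S_def]
  note e5 = diff_coeff_p1[OF q_nz t_nz nz(1-3) a_nz M Y, folded kap_def sig_def, folded K_def S_def]
  note e6 = diff_coeff_p2[OF q_nz t_nz nz(1-3) a_nz M Y, folded kap_def sig_def, folded K_def S_def]
  show ?thesis
    by (simp only: L R diff_coeff_L0[OF nz] diff_coeff_L1[OF nz] diff_coeff_L2[OF nz] diff_coeff_L3[OF nz]
      diff_coeff_R0[OF nz] diff_coeff_R1[OF nz] diff_coeff_R2[OF nz] diff_coeff_R3[OF nz] e1 e2 e3 e4 e5 e6)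
qed
end

section \<open>Two-variable interpolation polynomials\<close>

context q_and_t
begin

lemma one_minus_nz: "norm (x::complex) < 1 \<Longrightarrow> 1 - x \<noteq> 0"
  by (metis eq_iff_diff_eq_0 norm_one order_less_irrefl)

lemma norm_mult_less_1: "norm (x::complex) < 1 \<Longrightarrow> norm y \<le> 1 \<Longrightarrow> norm (x * y) < 1"
  by (metis mult.right_neutral mult_mono' norm_ge_zero norm_mult order_le_less_trans less_imp_le mult_left_mono)

lemma norm_q_power: "norm (q ^ i) \<le> 1"
  using q_less by (simp add: norm_power power_le_one)

lemma one_minus_t_q: "1 - t * q ^ i \<noteq> 0"
  by (rule one_minus_nz, rule norm_mult_less_1[OF t_less norm_q_power])

lemma one_minus_q_q: "1 - q * q ^ i \<noteq> 0"
  by (rule one_minus_nz, rule norm_mult_less_1[OF q_less norm_q_power])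

lemma one_minus_t2_q: "1 - t ^ 2 * q ^ i \<noteq> 0"
  by (rule one_minus_nz, rule norm_mult_less_1[OF _ norm_q_power])
     (use t_less in \<open>simp add: norm_power power_less_one_iff\<close>)

text \<open>The coefficients of the series \<open>(t z; q)\<^sub>\<infinity> / (z; q)\<^sub>\<infinity>\<close>. The companion \<open>qVm j\<close> is
  \<open>qV (j - 1)\<close> extended by 0, which removes the boundary cases from index shifts.\<close>

definition qV :: "nat \<Rightarrow> complex" where
  "qV j = qpoch t q j / qpoch q q j"

definition qVm :: "nat \<Rightarrow> complex" where
  "qVm j = (if j = 0 then 0 else qV (j - 1))"

lemma qpoch_0 [simp]: "qpoch x y 0 = 1"
  by (simp add: qpoch_def)

lemma qpoch_Suc: "qpoch x y (Suc n) = qpoch x y n * (1 - x * y ^ n)"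
  by (simp add: qpoch_def)

lemma qpoch_t_nz: "qpoch t q n \<noteq> 0"
  using one_minus_t_q by (simp add: qpoch_def)

lemma qpoch_q_nz: "qpoch q q n \<noteq> 0"
  using one_minus_q_q by (simp add: qpoch_def)

lemma qpoch_t2_nz: "qpoch (t^2) q n \<noteq> 0"
  using one_minus_t2_q by (simp add: qpoch_def)

lemma qV_0 [simp]: "qV 0 = 1"
  by (simp add: qV_def)

lemma qV_nz: "qV n \<noteq> 0"
  by (simp add: qV_def qpoch_t_nz qpoch_q_nz)

lemma qV_Suc: "(1 - q * q ^ j) * qV (Suc j) = (1 - t * q ^ j) * qV j"
  using one_minus_q_q[of j] qpoch_q_nz[of j] by (simp add: qV_def qpoch_Suc divide_simps)

lemma qVm_0 [simp]: "qVm 0 = 0" and qVm_Suc [simp]: "qVm (Suc j) = qV j"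
  by (simp_all add: qVm_def)

lemma qVm_eq: "(q - t * q ^ j) * qVm j = q * (1 - q ^ j) * qV j"
proof (cases j)
  case (Suc i)
  show ?thesis
    using arg_cong[OF qV_Suc[of i], of "\<lambda>x. q * x"] by (simp add: Suc algebra_simps)
qed simp

text \<open>For \<open>al = a\<^sup>2\<close> and \<open>u = a (x + 1/x)\<close> this is \<open>(1 - a q\<^sup>i x) (1 - a q\<^sup>i / x)\<close>. Keeping \<open>al\<close> and
  \<open>u\<close> as independent variables lets the same polynomials serve on the side of the variables and on the
  spectral side, where \<open>al\<close> is \<open>A\<close>.\<close>

definition linfac :: "complex \<Rightarrow> nat \<Rightarrow> complex \<Rightarrow> complex" where
  "linfac al i u = 1 + al * (q ^ i)^2 - q ^ i * u"

definition facs :: "complex \<Rightarrow> nat \<Rightarrow> nat \<Rightarrow> complex \<Rightarrow> complex" where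
  "facs al i j u = (\<Prod>r\<in>{i..<j}. linfac al r u)"

lemma facs_self [simp]: "facs al i i u = 1"
  by (simp add: facs_def)

lemma facs_Suc: "i \<le> j \<Longrightarrow> facs al i (Suc j) u = facs al i j u * linfac al j u"
  by (simp add: facs_def)

lemma facs_rec: "i < j \<Longrightarrow> facs al i j u = linfac al i u * facs al (Suc i) j u"
  by (simp add: facs_def prod.atLeast_Suc_lessThan)

text \<open>Up to a constant this is the polynomial part of \<open>N\<close> with \<open>k\<^sub>1, k\<^sub>2\<close>, written without
  denominators: the terminating series is turned into a convolution of \<open>qV\<close> with itself.\<close>

definition interp :: "complex \<Rightarrow> nat \<Rightarrow> nat \<Rightarrow> complex \<Rightarrow> complex \<Rightarrow> complex" where
  "interp al k1 k2 u v = (if k2 \<le> k1 then facs al 0 k2 u *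
     (\<Sum>j\<le>k1 - k2. qV j * qV (k1 - k2 - j) * t ^ j * facs (t^2 * al) (k2 + j) k1 (t * u) * facs al 0 (k2 + j) v)
   else 0)"

end

lemma sum_shift_up:
  fixes h f :: "nat \<Rightarrow> complex"
  shows "(\<Sum>j\<le>n. h j * f (Suc j)) = (\<Sum>j\<le>n. (if j = 0 then 0 else h (j - 1)) * f j) + h n * f (Suc n)"
proof -
  have "(\<Sum>j\<le>n. h j * f (Suc j)) = (\<Sum>j\<le>Suc n. (if j = 0 then 0 else h (j - 1)) * f j)"
    by (subst sum.atMost_Suc_shift) simp
  then show ?thesis by simp
qed

lemma sum_shift_down:
  fixes h f :: "nat \<Rightarrow> complex"
  shows "(\<Sum>j\<le>n. h j * (if j = 0 then f0 else f (j - 1))) = h 0 * f0 + (\<Sum>j\<le>n. (if j < n then h (Suc j) else 0) * f j)"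
proof (cases n)
  case (Suc m)
  have "(\<Sum>j\<le>Suc m. h j * (if j = 0 then f0 else f (j - 1))) = h 0 * f0 + (\<Sum>j\<le>m. h (Suc j) * f j)"
    by (subst sum.atMost_Suc_shift) simp
  also have "(\<Sum>j\<le>m. h (Suc j) * f j) = (\<Sum>j\<le>Suc m. (if j < Suc m then h (Suc j) else 0) * f j)"
    by (subst sum.atMost_Suc) (auto intro!: sum.cong)
  finally show ?thesis using Suc by simp
qed simp

context q_and_t
begin

lemma interp_expand:
  assumes "k2 \<le> k1"
  shows "interp al k1 k2 u v = facs al 0 k2 u *
     (\<Sum>j\<le>k1 - k2. qV j * qV (k1 - k2 - j) * t ^ j * facs (t^2 * al) (k2 + j) k1 (t * u) * facs al 0 (k2 + j) v)"
  using assms by (simp add: interp_def)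

text \<open>The four neighbours of \<open>interp al k1 k2\<close> are written over the basis that occurs in
  \<open>interp al k1 k2\<close> itself, so that later identities can be compared term by term.\<close>

lemma interp_up1:
  assumes "k2 \<le> k1"
  shows "interp al (Suc k1) k2 u v = facs al 0 k2 u *
     ((\<Sum>j\<le>k1 - k2. qV j * qV (Suc (k1 - k2 - j)) * t ^ j * facs (t^2 * al) (k2 + j) k1 (t * u) * linfac (t^2 * al) k1 (t * u) * facs al 0 (k2 + j) v)
      + qV (Suc (k1 - k2)) * t ^ Suc (k1 - k2) * facs al 0 (Suc k1) v)"
proof -
  have *: "Suc k1 - k2 = Suc (k1 - k2)" "k2 + Suc (k1 - k2) = Suc k1" using assms by auto
  show ?thesis
    unfolding interp_def using assms
    by (auto simp: * Suc_diff_le facs_Suc mult.assoc simp del: power_Suc intro!: disjI2 sum.cong)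
qed

lemma interp_up2:
  assumes "k2 \<le> k1"
  shows "interp al k1 (Suc k2) u v = facs al 0 k2 u * linfac al k2 u *
     (\<Sum>j\<le>k1 - k2. qVm j * qV (k1 - k2 - j) * (t ^ j / t) * facs (t^2 * al) (k2 + j) k1 (t * u) * facs al 0 (k2 + j) v)"
proof (cases "k1 = k2")
  case False
  then obtain m where m: "k1 - k2 = Suc m" "k1 - Suc k2 = m" "Suc k2 \<le> k1"
    using assms by (metis Suc_diff_Suc diff_is_0_eq' le_neq_implies_less Suc_leI)
  show ?thesis
    unfolding interp_expand[OF m(3)] m
    by (subst sum.atMost_Suc_shift) (simp add: t_nz facs_Suc)
qed (simp add: interp_def)

lemma interp_down1:
  assumes "k2 < k1"
  shows "linfac (t^2 * al) (k1 - 1) (t * u) * interp al (k1 - 1) k2 u v = facs al 0 k2 u *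
     (\<Sum>j\<le>k1 - k2. qV j * qVm (k1 - k2 - j) * t ^ j * facs (t^2 * al) (k2 + j) k1 (t * u) * facs al 0 (k2 + j) v)"
proof -
  obtain m where k1: "k1 = Suc (k2 + m)" using assms by (metis less_iff_Suc_add)
  show ?thesis
    unfolding k1 interp_def
    by (auto simp: Suc_diff_le sum_distrib_left facs_Suc intro!: sum.cong)
qed

lemma interp_down2:
  assumes "k2 \<le> k1" "0 < k2"
  shows "linfac al (k2 - 1) u * interp al k1 (k2 - 1) u v = facs al 0 k2 u *
     ((\<Sum>j\<le>k1 - k2. qV (Suc j) * qV (k1 - k2 - j) * t ^ Suc j * facs (t^2 * al) (k2 + j) k1 (t * u) * facs al 0 (k2 + j) v)
      + qV (Suc (k1 - k2)) * linfac (t^2 * al) (k2 - 1) (t * u) * facs (t^2 * al) k2 k1 (t * u) * facs al 0 (k2 - 1) v)"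
proof -
  obtain m where k2: "k2 = Suc m" using assms by (cases k2) auto
  have *: "k1 - m = Suc (k1 - Suc m)" using assms k2 by simp
  show ?thesis
    unfolding k2 using assms k2
    by (simp add: interp_expand facs_Suc * sum.atMost_Suc_shift facs_rec[of m k1] algebra_simps del: sum.atMost_Suc)
qed

text \<open>The value of \<open>u + v\<close> at the interpolation node of the partition \<open>(k1, k2)\<close>.\<close>

definition node :: "complex \<Rightarrow> nat \<Rightarrow> nat \<Rightarrow> complex" where
  "node al k1 k2 = t * al * q ^ k1 + 1 / (t * q ^ k1) + al * q ^ k2 + 1 / q ^ k2"

definition pieri1 :: "nat \<Rightarrow> nat \<Rightarrow> complex" where
  "pieri1 k1 k2 = - (1 - q * q ^ (k1 - k2)) / (t * q ^ k1 * (1 - t * q ^ (k1 - k2)))"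

definition pieri2 :: "nat \<Rightarrow> nat \<Rightarrow> complex" where
  "pieri2 k1 k2 = - t * (q - t^2 * q ^ (k1 - k2)) / (q * q ^ k2 * (1 - t * q ^ (k1 - k2)))"

lemma pieri_coeff:
  fixes s J R u v A B B' X B1 B2 :: complex
  assumes nz: "s \<noteq> 0" "J \<noteq> 0" "R \<noteq> 0"
    and B1: "t * (s * J * R) * (1 - t * J * R) * B1 = - (1 - q * J * R)"
    and B2: "q * s * (1 - t * J * R) * B2 = - t * (q - t^2 * J * R)"
    and M: "1 - t * J * R \<noteq> 0" and R: "1 - q * R \<noteq> 0"
    and B': "(1 - q * R) * B' = (1 - t * R) * B"
    and X: "(q - t * J) * X = q * (1 - J) * A"
  shows "(u + 1 / (s * J) + al * (s * J) - (t * al * (s * J * R) + 1/ (t * (s * J * R)) + al * s + 1/ s)) * A * B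
      - (q / (s * J * t)) * X * B' * (1 + t^2 * al * (s * J / q)^2 - (s * J / q) * (t * u))
    = B1 * (A * B' * (1 + t^2 * al * (s * J * R)^2 - (s * J * R) * (t * u)))
     + B2 / t * (X * B * (1 + al * s^2 - s * u))" (is "?L = ?R")
proof -
  note nz = nz q_nz t_nz
  \<comment> \<open>Parametrising \<open>B\<close> and \<open>B'\<close> by their common factor leaves a polynomial identity modulo \<open>X\<close>.\<close>
  define be where "be = B / (1 - q * R)"
  have b: "B = (1 - q * R) * be" "B' = (1 - t * R) * be"
    using B' R unfolding be_def by (auto simp: field_simps)
  let ?D = "t * s * J * R * (1 - t * J * R) * q * q"
  have L: "?D * ?L = (1 - t * J * R) * q * q * (t * s * J * R * u + t * R + t * al * s^2 * J^2 * R - (t^2 * al * s^2 * J^2 * R^2 + 1 + t * al * s^2 * J * R + t * J * R)) * A * B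
     - (1 - t * J * R) * R * q * X * B' * (q^2 + t^2 * al * s^2 * J^2 - s * J * q * t * u)"
    using nz by (simp add: divide_simps power2_eq_square) algebra
  have R: "?D * ?R = - (1 - q * J * R) * q * q * (A * B' * (1 + t^2 * al * (s * J * R)^2 - (s * J * R) * (t * u)))
     - t * (q - t^2 * J * R) * q * J * R * (X * B * (1 + al * s^2 - s * u))"
  proof -
    have "?D * ?R = (t * (s * J * R) * (1 - t * J * R) * B1) * q * q * (A * B' * (1 + t^2 * al * (s * J * R)^2 - (s * J * R) * (t * u)))
     + (q * s * (1 - t * J * R) * B2) * q * J * R * (X * B * (1 + al * s^2 - s * u))"
      using nz by (simp add: divide_simps) algebra
    then show ?thesis unfolding B1 B2 by (simp add: algebra_simps)
  qed
  have "?D * ?L = ?D * ?R"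
    apply (simp only: L R)
    apply (simp only: b)
    using X apply algebra
    done
  then show ?thesis using nz M by simp
qed

text \<open>Multiplication by \<open>v\<close> shifts \<open>j\<close> by one in the Newton-type basis \<open>facs al 0 (k2 + j) v\<close>; collecting
  the coefficients, each resulting term is an instance of \<open>pieri_coeff\<close>.\<close>

theorem interp_pieri:
  assumes "k2 \<le> k1"
  shows "(u + v - node al k1 k2) * interp al k1 k2 u v =
    pieri1 k1 k2 * interp al (Suc k1) k2 u v + pieri2 k1 k2 * interp al k1 (Suc k2) u v"
proof -
  define n where "n = k1 - k2"
  have k1: "k1 = k2 + n" using assms by (simp add: n_def)
  define f where "f j = facs al 0 (k2 + j) v" for j
  define g where "g j = facs (t^2 * al) (k2 + j) k1 (t * u)" for j
  define c where "c j = qV j * qV (n - j) * t ^ j" for j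
  define P where "P = facs al 0 k2 u"
  define T where "T j = 1 + t^2 * al * (q ^ k2 * q ^ j / q)^2 - (q ^ k2 * q ^ j / q) * (t * u)" for j
  have qk: "q ^ (k2 + j) = q ^ k2 * q ^ j" for j by (simp add: power_add)
  have vf: "v * f j = (1 / (q ^ k2 * q ^ j) + al * (q ^ k2 * q ^ j)) * f j - 1 / (q ^ k2 * q ^ j) * f (Suc j)" for j
    using q_nz by (simp add: f_def facs_Suc linfac_def qk divide_simps) algebra
  have gT: "g (j - 1) = T j * g j" if "0 < j" "j \<le> n" for j
  proof -
    obtain i where j: "j = Suc i" using \<open>0 < j\<close> gr0_conv_Suc by blast
    show ?thesis
      unfolding g_def j using that q_nz
      by (subst facs_rec) (simp_all add: j k1 T_def linfac_def power_add)
  qed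
  have gn: "g n = 1" by (simp add: g_def k1)
  have "(u + v - node al k1 k2) * interp al k1 k2 u v
     = P * (\<Sum>j\<le>n. c j * g j * ((u - node al k1 k2) * f j + v * f j))"
    unfolding interp_expand[OF assms] n_def[symmetric]
    by (simp add: f_def g_def c_def P_def sum_distrib_left algebra_simps)
  also have "(\<Sum>j\<le>n. c j * g j * ((u - node al k1 k2) * f j + v * f j))
    = (\<Sum>j\<le>n. c j * g j * (u + 1 / (q ^ k2 * q ^ j) + al * (q ^ k2 * q ^ j) - node al k1 k2) * f j)
      - (\<Sum>j\<le>n. (c j * g j / (q ^ k2 * q ^ j)) * f (Suc j))"
    unfolding vf by (simp add: sum_subtractf[symmetric] algebra_simps)
  also have "(\<Sum>j\<le>n. (c j * g j / (q ^ k2 * q ^ j)) * f (Suc j))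
    = (\<Sum>j\<le>n. (q / (q ^ k2 * q ^ j * t)) * qVm j * qV (Suc (n - j)) * T j * t ^ j * g j * f j) + 1 / q ^ k1 * qV n * t ^ n * f (Suc n)"
    unfolding sum_shift_up[of "\<lambda>j. c j * g j / (q ^ k2 * q ^ j)" f n]
  proof (intro arg_cong2[where f = "(+)"] sum.cong refl)
    fix j assume "j \<in> {..n}"
    then have j: "j \<le> n" by simp
    show "(if j = 0 then 0 else c (j - 1) * g (j - 1) / (q ^ k2 * q ^ (j - 1))) * f j =
        (q / (q ^ k2 * q ^ j * t)) * qVm j * qV (Suc (n - j)) * T j * t ^ j * g j * f j"
    proof (cases j)
      case (Suc i)
      have "n - i = Suc (n - j)" using Suc j by simp
      then show ?thesis using gT[of j] j Suc q_nz t_nz by (simp add: c_def)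
    qed simp
  qed (simp_all add: c_def gn k1 power_add)
  also have "(\<Sum>j\<le>n. c j * g j * (u + 1 / (q ^ k2 * q ^ j) + al * (q ^ k2 * q ^ j) - node al k1 k2) * f j)
     - ((\<Sum>j\<le>n. (q / (q ^ k2 * q ^ j * t)) * qVm j * qV (Suc (n - j)) * T j * t ^ j * g j * f j) + 1 / q ^ k1 * qV n * t ^ n * f (Suc n))
     = (\<Sum>j\<le>n. ((u + 1 / (q ^ k2 * q ^ j) + al * (q ^ k2 * q ^ j) - node al k1 k2) * qV j * qV (n - j)
          - (q / (q ^ k2 * q ^ j * t)) * qVm j * qV (Suc (n - j)) * T j) * (t ^ j * g j * f j)) - 1 / q ^ k1 * qV n * t ^ n * f (Suc n)"
    by (simp add: sum_subtractf[symmetric] c_def algebra_simps)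
  also have "(\<Sum>j\<le>n. ((u + 1 / (q ^ k2 * q ^ j) + al * (q ^ k2 * q ^ j) - node al k1 k2) * qV j * qV (n - j)
          - (q / (q ^ k2 * q ^ j * t)) * qVm j * qV (Suc (n - j)) * T j) * (t ^ j * g j * f j))
     = (\<Sum>j\<le>n. (pieri1 k1 k2 * (qV j * qV (Suc (n - j)) * linfac (t^2 * al) k1 (t * u))
           + pieri2 k1 k2 / t * (qVm j * qV (n - j) * linfac al k2 u)) * (t ^ j * g j * f j))"
  proof (intro sum.cong refl)
    fix j assume "j \<in> {..n}"
    then have j: "j \<le> n" by simp
    have k1': "q ^ k1 = q ^ k2 * q ^ j * q ^ (n - j)" using j by (simp add: k1 flip: power_add)
    have n': "q ^ n = q ^ j * q ^ (n - j)" using j by (simp flip: power_add)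
    have M: "1 - t * q ^ j * q ^ (n - j) \<noteq> 0" using one_minus_t_q[of n] by (simp add: n' mult.assoc)
    have B1: "t * (q ^ k2 * q ^ j * q ^ (n - j)) * (1 - t * q ^ j * q ^ (n - j)) * pieri1 k1 k2 = - (1 - q * q ^ j * q ^ (n - j))"
      unfolding pieri1_def n_def[symmetric] k1' n' using M q_nz t_nz by (simp add: mult.assoc)
    have B2: "q * q ^ k2 * (1 - t * q ^ j * q ^ (n - j)) * pieri2 k1 k2 = - t * (q - t^2 * q ^ j * q ^ (n - j))"
      unfolding pieri2_def n_def[symmetric] n' using M q_nz t_nz by (simp add: mult.assoc)
    note * = pieri_coeff[OF _ _ _ B1 B2 M one_minus_q_q qV_Suc qVm_eq, of u al]
    show "((u + 1 / (q ^ k2 * q ^ j) + al * (q ^ k2 * q ^ j) - node al k1 k2) * qV j * qV (n - j)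
          - (q / (q ^ k2 * q ^ j * t)) * qVm j * qV (Suc (n - j)) * T j) * (t ^ j * g j * f j) =
       (pieri1 k1 k2 * (qV j * qV (Suc (n - j)) * linfac (t^2 * al) k1 (t * u))
           + pieri2 k1 k2 / t * (qVm j * qV (n - j) * linfac al k2 u)) * (t ^ j * g j * f j)"
      unfolding node_def T_def linfac_def k1' using * q_nz by simp
  qed
  also have "P * (\<dots> - 1 / q ^ k1 * qV n * t ^ n * f (Suc n)) =
     pieri1 k1 k2 * (P * ((\<Sum>j\<le>n. qV j * qV (Suc (n - j)) * t ^ j * g j * linfac (t^2 * al) k1 (t * u) * f j) + qV (Suc n) * t ^ Suc n * f (Suc n)))
     + pieri2 k1 k2 * (P * linfac al k2 u * (\<Sum>j\<le>n. qVm j * qV (n - j) * (t ^ j / t) * g j * f j))"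
  proof -
    have "pieri1 k1 k2 * (qV (Suc n) * t ^ Suc n) = - (1 / q ^ k1 * qV n * t ^ n)"
    proof -
      have *: "qV n = (1 - q * q ^ n) / (1 - t * q ^ n) * qV (Suc n)"
        using qV_Suc[of n] one_minus_t_q[of n] by (simp add: divide_simps mult.commute)
      show ?thesis
        unfolding pieri1_def n_def[symmetric] * using q_nz t_nz one_minus_t_q[of n] by (simp add: field_simps)
    qed
    then have top: "1 / q ^ k1 * qV n * t ^ n * f (Suc n) = - pieri1 k1 k2 * (qV (Suc n) * t ^ Suc n) * f (Suc n)"
      by simp
    show ?thesis
      unfolding top by (simp add: algebra_simps sum.distrib sum_distrib_left)
  qed
  also have "pieri1 k1 k2 * (P * ((\<Sum>j\<le>n. qV j * qV (Suc (n - j)) * t ^ j * g j * linfac (t^2 * al) k1 (t * u) * f j) + qV (Suc n) * t ^ Suc n * f (Suc n)))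
      = pieri1 k1 k2 * interp al (Suc k1) k2 u v"
    unfolding interp_up1[OF assms] n_def[symmetric] by (simp add: f_def g_def P_def k1)
  also have "P * linfac al k2 u * (\<Sum>j\<le>n. qVm j * qV (n - j) * (t ^ j / t) * g j * f j) = interp al k1 (Suc k2) u v"
    unfolding interp_up2[OF assms] n_def[symmetric] by (simp add: f_def g_def P_def)
  finally show ?thesis .
qed

lemma pieri1_nz: "pieri1 k1 k2 \<noteq> 0"
  using one_minus_t_q one_minus_q_q q_nz t_nz by (simp add: pieri1_def)

text \<open>The explicit formula treats the two variables differently, and symmetry is not visible from it. It follows
  from the Pieri rule: the factor \<open>u + v - node\<close> is symmetric, and the rule expresses the polynomial
  with larger \<open>k1 - k2\<close> through polynomials with smaller difference.\<close>

theorem interp_commute: "interp al k1 k2 u v = interp al k1 k2 v u"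
proof (induction "k1 - k2" arbitrary: k1 k2 rule: less_induct)
  case less
  show ?case
  proof (cases "k2 < k1")
    case False
    then show ?thesis by (cases "k1 = k2") (simp_all add: interp_def)
  next
    case True
    then obtain m where k1: "k1 = Suc m" "k2 \<le> m" by (metis Suc_le_eq less_eq_Suc_le gr0_implies_Suc less_Suc_eq_le not_less_zero linorder_neqE_nat zero_less_iff_neq_zero)
    have 1: "interp al m k2 u v = interp al m k2 v u"
      using less[of m k2] k1 by simp
    have 2: "interp al m (Suc k2) u v = interp al m (Suc k2) v u"
    proof (cases "Suc k2 \<le> m")
      case True
      then show ?thesis using less[of m "Suc k2"] k1 by simp
    qed (simp add: interp_def)
    have "pieri1 m k2 * interp al k1 k2 u v = pieri1 m k2 * interp al k1 k2 v u"
      using interp_pieri[OF k1(2), of u v al] interp_pieri[OF k1(2), of v u al] 1 2 k1(1)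
      by (simp add: add.commute)
    then show ?thesis using pieri1_nz by simp
  qed
qed

end

context koornwinder_coeffs
begin

text \<open>The result of the one-variable operator \<open>op2\<close> below on the basis polynomial with index \<open>l\<close>, as a
  polynomial in \<open>v\<close> (lemma \<open>op2_phi\<close>).\<close>

definition op_coeff :: "complex \<Rightarrow> nat \<Rightarrow> complex \<Rightarrow> complex" where
  "op_coeff c l v = (a / q) * (1 - q ^ l) *
     (cubic (a * q ^ (l - 1)) / (a * q ^ (l - 1))^2 * linfac (t^2 * a^2) (l - 1) (t * (a * c)) * facs (a^2) 0 (l - 1) v
      + shift_mid c (q ^ l) * facs (a^2) 0 l v + shift_up (q ^ l) * facs (a^2) 0 (Suc l) v)"

definition "eigenvalue k1 k2 = eigen (q ^ k2) (q ^ (k1 - k2))"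
definition "coeff_low1 k1 k2 = (if k2 < k1 then low1 (q ^ k2) (q ^ (k1 - k2)) else 0)"
definition "coeff_low2 k1 k2 = low2 (q ^ k2) (q ^ (k1 - k2))"

text \<open>The polynomial core of the action of the operator: applied to the variable \<open>v\<close> alone it produces five terms,
  whose coefficients depend on \<open>c\<close> only through the eigenvalue term and the linear factors. In the
  antisymmetrisation over the two variables (\<open>kop_Npol\<close>) the terms \<open>sym0\<close>, \<open>sym3\<close> and \<open>sym4\<close> are symmetric
  and cancel.\<close>

theorem op_interp:
  fixes c v :: complex
  assumes "k2 \<le> k1"
  defines "u \<equiv> a * c"
  shows "facs (a^2) 0 k2 u * (\<Sum>j\<le>k1 - k2. qV j * qV (k1 - k2 - j) * t ^ j * facs (t^2 * a^2) (k2 + j) k1 (t * u) * op_coeff c (k2 + j) v)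
    = (sym0 (q ^ k2) (q ^ (k1 - k2)) + eigenvalue k1 k2 * c) * interp (a^2) k1 k2 u v
      + sym3 (q ^ k2) (q ^ (k1 - k2)) * interp (a^2) (Suc k1) k2 u v
      + sym4 (q ^ k2) (q ^ (k1 - k2)) * interp (a^2) k1 (Suc k2) u v
      + coeff_low1 k1 k2 * (linfac (t^2 * a^2) (k1 - 1) (t * u) * interp (a^2) (k1 - 1) k2 u v)
      + coeff_low2 k1 k2 * (linfac (a^2) (k2 - 1) u * interp (a^2) k1 (k2 - 1) u v)"
proof -
  define n where "n = k1 - k2"
  have k1: "k1 = k2 + n" using assms by (simp add: n_def)
  define s where "s = q ^ k2"
  define M where "M = q ^ n"
  define f where "f j = facs (a^2) 0 (k2 + j) v" for j
  define f0 where "f0 = facs (a^2) 0 (k2 - 1) v"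
  define g where "g j = facs (t^2 * a^2) (k2 + j) k1 (t * u)" for j
  define d where "d j = qV j * qV (n - j) * t ^ j" for j
  define P where "P = facs (a^2) 0 k2 u"
  define T where "T L = 1 + t^2 * (a * L)^2 - t * L * (a * c)" for L
  define e where "e j = (a / q) * (1 - q ^ (k2 + j))" for j
  have qk: "q ^ (k2 + j) = s * q ^ j" for j by (simp add: power_add s_def)
  have s_nz: "s \<noteq> 0" using q_nz by (simp add: s_def)
  have gT: "g (j - 1) = T (s * q ^ j / q) * g j" if "0 < j" "j \<le> n" for j
  proof -
    obtain i where j: "j = Suc i" using \<open>0 < j\<close> gr0_conv_Suc by blast
    show ?thesis
      unfolding g_def j using that q_nz
      by (subst facs_rec) (simp_all add: j k1 T_def linfac_def power_add s_def u_def power_mult_distrib mult_ac)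
  qed
  have gn: "g n = 1" by (simp add: g_def k1)
  have lf: "linfac (t^2 * a^2) i (t * u) = T (q ^ i)" for i
    by (simp add: linfac_def T_def u_def power_mult_distrib mult_ac)
  have lf2: "linfac (a^2) i u = 1 + (a * q ^ i)^2 - q ^ i * (a * c)" for i
    by (simp add: linfac_def u_def power_mult_distrib mult_ac)
  define b where "b j = d j * g j * e j * (cubic (a * q ^ (k2 + j - 1)) / (a * q ^ (k2 + j - 1))^2 * T (q ^ (k2 + j - 1)))" for j
  define h where "h j = d j * g j * e j * shift_up (q ^ (k2 + j))" for j

  have "(\<Sum>j\<le>n. qV j * qV (n - j) * t ^ j * facs (t^2 * a^2) (k2 + j) k1 (t * u) * op_coeff c (k2 + j) v)
     = (\<Sum>j\<le>n. b j * (if j = 0 then f0 else f (j - 1))) + (\<Sum>j\<le>n. d j * g j * e j * shift_mid c (q ^ (k2 + j)) * f j)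
       + (\<Sum>j\<le>n. h j * f (Suc j))"
  proof -
    have *: "facs (a^2) 0 (k2 + j - 1) v = (if j = 0 then f0 else f (j - 1))" for j
      by (cases j) (auto simp: f0_def f_def)
    show ?thesis
      unfolding op_coeff_def * u_def[symmetric] lf sum.distrib[symmetric]
      by (intro sum.cong refl) (simp add: b_def h_def d_def g_def e_def f_def distrib_left mult_ac)
  qed
  also have "(\<Sum>j\<le>n. b j * (if j = 0 then f0 else f (j - 1)))
     = b 0 * f0 + (\<Sum>j\<le>n. (a / q) * (t * qV (Suc j) * qVm (n - j) * (1 - q * (s * q ^ j)) * (cubic (a * (s * q ^ j)) / (a * (s * q ^ j))^2)) * (t ^ j * g j * f j))"
    unfolding sum_shift_down[of b f0 f n]
  proof (intro arg_cong2[where f = "(+)"] sum.cong refl)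
    fix j assume "j \<in> {..n}"
    then have j: "j \<le> n" by simp
    show "(if j < n then b (Suc j) else 0) * f j =
       (a / q) * (t * qV (Suc j) * qVm (n - j) * (1 - q * (s * q ^ j)) * (cubic (a * (s * q ^ j)) / (a * (s * q ^ j))^2)) * (t ^ j * g j * f j)"
    proof (cases "j < n")
      case True
      then have n: "n - j = Suc (n - Suc j)" by simp
      have g: "g j = T (s * q ^ j) * g (Suc j)"
        using gT[of "Suc j"] True q_nz by simp
      show ?thesis unfolding g n qVm_Suc
        using True by (simp add: b_def d_def e_def qk power_add s_def mult_ac)
    qed (use j in simp)
  qed
  also have "(\<Sum>j\<le>n. h j * f (Suc j)) = (\<Sum>j\<le>n. (a / q) * (qVm j * qV (Suc (n - j)) / t * (1 - s * q ^ j / q) * shift_up (s * q ^ j / q) * T (s * q ^ j / q)) * (t ^ j * g j * f j)) + h n * f (Suc n)"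
    unfolding sum_shift_up[of h f n]
  proof (intro arg_cong2[where f = "(+)"] sum.cong refl)
    fix j assume "j \<in> {..n}"
    then have j: "j \<le> n" by simp
    show "(if j = 0 then 0 else h (j - 1)) * f j =
       (a / q) * (qVm j * qV (Suc (n - j)) / t * (1 - s * q ^ j / q) * shift_up (s * q ^ j / q) * T (s * q ^ j / q)) * (t ^ j * g j * f j)"
    proof (cases j)
      case (Suc i)
      have "n - i = Suc (n - j)" using Suc j by simp
      then show ?thesis using gT[of j] j Suc q_nz t_nz by (simp add: h_def d_def e_def qk)
    qed simp
  qed
  also have "b 0 * f0 + (\<Sum>j\<le>n. (a / q) * (t * qV (Suc j) * qVm (n - j) * (1 - q * (s * q ^ j)) * (cubic (a * (s * q ^ j)) / (a * (s * q ^ j))^2)) * (t ^ j * g j * f j))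
      + (\<Sum>j\<le>n. d j * g j * e j * shift_mid c (q ^ (k2 + j)) * f j)
      + ((\<Sum>j\<le>n. (a / q) * (qVm j * qV (Suc (n - j)) / t * (1 - s * q ^ j / q) * shift_up (s * q ^ j / q) * T (s * q ^ j / q)) * (t ^ j * g j * f j)) + h n * f (Suc n))
    = (\<Sum>j\<le>n. (a / q) * (qV j * qV (n - j) * (1 - s * q ^ j) * shift_mid c (s * q ^ j)
         + t * qV (Suc j) * qVm (n - j) * (1 - q * (s * q ^ j)) * (cubic (a * (s * q ^ j)) / (a * (s * q ^ j))^2)
         + qVm j * qV (Suc (n - j)) / t * (1 - s * q ^ j / q) * shift_up (s * q ^ j / q) * T (s * q ^ j / q)) * (t ^ j * g j * f j))
      + b 0 * f0 + h n * f (Suc n)"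
  proof -
    have "(\<Sum>j\<le>n. (a / q) * (t * qV (Suc j) * qVm (n - j) * (1 - q * (s * q ^ j)) * (cubic (a * (s * q ^ j)) / (a * (s * q ^ j))^2)) * (t ^ j * g j * f j))
      + (\<Sum>j\<le>n. d j * g j * e j * shift_mid c (q ^ (k2 + j)) * f j)
      + (\<Sum>j\<le>n. (a / q) * (qVm j * qV (Suc (n - j)) / t * (1 - s * q ^ j / q) * shift_up (s * q ^ j / q) * T (s * q ^ j / q)) * (t ^ j * g j * f j)) =
      (\<Sum>j\<le>n. (a / q) * (qV j * qV (n - j) * (1 - s * q ^ j) * shift_mid c (s * q ^ j)
         + t * qV (Suc j) * qVm (n - j) * (1 - q * (s * q ^ j)) * (cubic (a * (s * q ^ j)) / (a * (s * q ^ j))^2)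
         + qVm j * qV (Suc (n - j)) / t * (1 - s * q ^ j / q) * shift_up (s * q ^ j / q) * T (s * q ^ j / q)) * (t ^ j * g j * f j))"
      unfolding sum.distrib[symmetric]
      by (intro sum.cong refl) (simp add: d_def e_def qk distrib_left distrib_right mult_ac)
    then show ?thesis by (simp only: ac_simps)
  qed
  also have "(\<Sum>j\<le>n. (a / q) * (qV j * qV (n - j) * (1 - s * q ^ j) * shift_mid c (s * q ^ j)
         + t * qV (Suc j) * qVm (n - j) * (1 - q * (s * q ^ j)) * (cubic (a * (s * q ^ j)) / (a * (s * q ^ j))^2)
         + qVm j * qV (Suc (n - j)) / t * (1 - s * q ^ j / q) * shift_up (s * q ^ j / q) * T (s * q ^ j / q)) * (t ^ j * g j * f j))
     = (\<Sum>j\<le>n. (qV j * qV (n - j) * (sym0 s M + eigen s M * c)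
         + sym3 s M * (qV j * qV (Suc (n - j)) * T (s * M))
         + sym4 s M * (qVm j * qV (n - j) / t * (1 + (a * s)^2 - s * (a * c)))
         + low1 s M * (qV j * qVm (n - j)) + low2 s M * (t * qV (Suc j) * qV (n - j))) * (t ^ j * g j * f j))"
  proof (intro sum.cong refl arg_cong2[where f = "(*)"])
    fix j assume "j \<in> {..n}"
    then have j: "j \<le> n" by simp
    define J where "J = q ^ j"
    define R where "R = q ^ (n - j)"
    have JR: "M = J * R" using j by (simp add: M_def J_def R_def flip: power_add)
    have nz: "J \<noteq> 0" "R \<noteq> 0" using q_nz by (simp_all add: J_def R_def)
    have M: "1 - t * (J * R) \<noteq> 0" using one_minus_t_q[of n] by (simp flip: JR M_def)
    have J: "1 - q * J \<noteq> 0" and R: "1 - q * R \<noteq> 0" using one_minus_q_q by (simp_all add: J_def R_def)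
    define A where "A = qV j / (1 - q * J)"
    define B where "B = qV (n - j) / (1 - q * R)"
    have A_nz: "A \<noteq> 0" "B \<noteq> 0" using qV_nz J R by (simp_all add: A_def B_def)
    define X where "X = qVm j / A"
    define Y where "Y = qVm (n - j) / B"
    have A: "qV j = A * (1 - q * J)" "qV (Suc j) = A * (1 - t * J)" "qVm j = A * X"
      using qV_Suc[of j] J A_nz by (simp_all add: A_def X_def J_def field_simps)
    have B: "qV (n - j) = B * (1 - q * R)" "qV (Suc (n - j)) = B * (1 - t * R)" "qVm (n - j) = B * Y"
      using qV_Suc[of "n - j"] R A_nz by (simp_all add: B_def Y_def R_def field_simps)
    have X: "(q - t * J) * X = q * (1 - J) * (1 - q * J)"
    proof -
      have "A * ((q - t * J) * X) = A * (q * (1 - J) * (1 - q * J))"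
        using qVm_eq[of j] unfolding A(1,3) J_def[symmetric] by (simp only: ac_simps)
      then show ?thesis using A_nz by (simp only: mult_left_cancel not_False_eq_True)
    qed
    have Y: "(q - t * R) * Y = q * (1 - R) * (1 - q * R)"
    proof -
      have "B * ((q - t * R) * Y) = B * (q * (1 - R) * (1 - q * R))"
        using qVm_eq[of "n - j"] unfolding B(1,3) R_def[symmetric] by (simp only: ac_simps)
      then show ?thesis using A_nz by (simp only: mult_left_cancel not_False_eq_True)
    qed
    have *: "A * B * w = z" if "w = w'" "A * B * w' = z" for w w' z using that by simp
    have "(a / q) * (qV j * qV (n - j) * (1 - s * J) * shift_mid c (s * J)
         + t * qV (Suc j) * qVm (n - j) * (1 - q * (s * J)) * (cubic (a * (s * J)) / (a * (s * J))^2)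
         + qVm j * qV (Suc (n - j)) / t * (1 - s * J / q) * shift_up (s * J / q) * T (s * J / q))
       = A * B * ((a / q) * ((1 - q * J) * (1 - q * R) * (1 - s * J) * shift_mid c (s * J)
      + t * (1 - t * J) * Y * (1 - q * (s * J)) * (cubic (a * (s * J)) / (a * (s * J))^2)
      + X * (1 - t * R) / t * (1 - s * J / q) * shift_up (s * J / q) * (1 + t^2 * (a * (s * J / q))^2 - t * (s * J / q) * (a * c))))"
      unfolding A B T_def by (simp add: algebra_simps)
    also have "\<dots> = A * B * ((1 - q * J) * (1 - q * R) * (sym0 s (J * R) + eigen s (J * R) * c)
      + sym3 s (J * R) * ((1 - q * J) * (1 - t * R) * (1 + t^2 * (a * (s * (J * R)))^2 - t * (s * (J * R)) * (a * c)))
      + sym4 s (J * R) * (X * (1 - q * R) / t * (1 + (a * s)^2 - s * (a * c)))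
      + low1 s (J * R) * ((1 - q * J) * Y) + low2 s (J * R) * (t * (1 - t * J) * (1 - q * R)))"
      by (simp only: diff_coeff[OF s_nz nz M X Y])
    also have "\<dots> = qV j * qV (n - j) * (sym0 s M + eigen s M * c)
         + sym3 s M * (qV j * qV (Suc (n - j)) * T (s * M))
         + sym4 s M * (qVm j * qV (n - j) / t * (1 + (a * s)^2 - s * (a * c)))
         + low1 s M * (qV j * qVm (n - j)) + low2 s M * (t * qV (Suc j) * qV (n - j))"
      unfolding A B T_def JR by (simp add: algebra_simps add_divide_distrib diff_divide_distrib)
    finally show "(a / q) * (qV j * qV (n - j) * (1 - s * q ^ j) * shift_mid c (s * q ^ j)
         + t * qV (Suc j) * qVm (n - j) * (1 - q * (s * q ^ j)) * (cubic (a * (s * q ^ j)) / (a * (s * q ^ j))^2)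
         + qVm j * qV (Suc (n - j)) / t * (1 - s * q ^ j / q) * shift_up (s * q ^ j / q) * T (s * q ^ j / q)) =
       qV j * qV (n - j) * (sym0 s M + eigen s M * c)
         + sym3 s M * (qV j * qV (Suc (n - j)) * T (s * M))
         + sym4 s M * (qVm j * qV (n - j) / t * (1 + (a * s)^2 - s * (a * c)))
         + low1 s M * (qV j * qVm (n - j)) + low2 s M * (t * qV (Suc j) * qV (n - j))"
      unfolding J_def .
  qed
  finally have main0: "(\<Sum>j\<le>n. qV j * qV (n - j) * t ^ j * facs (t^2 * a^2) (k2 + j) k1 (t * u) * op_coeff c (k2 + j) v) =
     (\<Sum>j\<le>n. (qV j * qV (n - j) * (sym0 s M + eigen s M * c)
         + sym3 s M * (qV j * qV (Suc (n - j)) * T (s * M))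
         + sym4 s M * (qVm j * qV (n - j) / t * (1 + (a * s)^2 - s * (a * c)))
         + low1 s M * (qV j * qVm (n - j)) + low2 s M * (t * qV (Suc j) * qV (n - j))) * (t ^ j * g j * f j))
     + b 0 * f0 + h n * f (Suc n)" .
  have split_sum: "(\<Sum>j\<le>n. (qV j * qV (n - j) * (sym0 s M + eigen s M * c)
         + sym3 s M * (qV j * qV (Suc (n - j)) * T (s * M))
         + sym4 s M * (qVm j * qV (n - j) / t * (1 + (a * s)^2 - s * (a * c)))
         + low1 s M * (qV j * qVm (n - j)) + low2 s M * (t * qV (Suc j) * qV (n - j))) * (t ^ j * g j * f j)) =
     (sym0 s M + eigen s M * c) * (\<Sum>j\<le>n. qV j * qV (n - j) * t ^ j * g j * f j)
     + sym3 s M * ((\<Sum>j\<le>n. qV j * qV (Suc (n - j)) * t ^ j * g j * T (s * M) * f j))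
     + sym4 s M * ((1 + (a * s)^2 - s * (a * c)) * (\<Sum>j\<le>n. qVm j * qV (n - j) * (t ^ j / t) * g j * f j))
     + low1 s M * (\<Sum>j\<le>n. qV j * qVm (n - j) * t ^ j * g j * f j)
     + low2 s M * (\<Sum>j\<le>n. qV (Suc j) * qV (n - j) * t ^ Suc j * g j * f j)"
    unfolding sum_distrib_left sum.distrib[symmetric]
    by (intro sum.cong refl) (simp add: algebra_simps add_divide_distrib diff_divide_distrib)
  note main = main0[unfolded split_sum]
  have kap: "qV n = kap M * qV (Suc n)"
    using qV_Suc[of n] one_minus_t_q[of n] by (simp add: kap_def M_def divide_simps mult.commute)
  have top: "h n = sym3 s M * (qV (Suc n) * t ^ Suc n)"
    unfolding h_def d_def gn e_def sym3_def qk M_def[symmetric] using kap t_nz by simp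
  have bot: "b 0 = low2 s M * (qV (Suc n) * T (q ^ (k2 - 1)) * g 0)" if "0 < k2"
  proof -
    have s: "q ^ (k2 - 1) = s / q" using that q_nz by (cases k2) (auto simp: s_def)
    have b0: "b 0 = qV n * g 0 * ((a / q) * (1 - s)) * (cubic (a * (s / q)) / (a * (s / q))^2 * T (s / q))"
      unfolding b_def e_def d_def by (simp add: s[simplified] s_def[symmetric])
    have l: "low2 s M = - (1 - 1 / s) * kap M * (cubic (a * (s / q)) / (a * (s / q)))"
      by (simp add: low2_def)
    show ?thesis
      unfolding b0 l kap s using s_nz q_nz a_nz
      by (simp add: divide_simps) (simp add: algebra_simps power2_eq_square)
  qed
  have I0: "interp (a^2) k1 k2 u v = P * (\<Sum>j\<le>n. qV j * qV (n - j) * t ^ j * g j * f j)"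
    unfolding interp_expand[OF assms(1)] by (simp add: P_def n_def f_def g_def)
  have I1: "interp (a^2) (Suc k1) k2 u v = P * ((\<Sum>j\<le>n. qV j * qV (Suc (n - j)) * t ^ j * g j * T (s * M) * f j) + qV (Suc n) * t ^ Suc n * f (Suc n))"
    unfolding interp_up1[OF assms(1)] n_def[symmetric] lf by (simp add: P_def f_def g_def k1 s_def M_def power_add)
  have I2: "interp (a^2) k1 (Suc k2) u v = P * ((1 + (a * s)^2 - s * (a * c)) * (\<Sum>j\<le>n. qVm j * qV (n - j) * (t ^ j / t) * g j * f j))"
    unfolding interp_up2[OF assms(1)] n_def[symmetric] lf2 by (simp add: P_def f_def g_def s_def)
  have I3: "coeff_low1 k1 k2 * (linfac (t^2 * a^2) (k1 - 1) (t * u) * interp (a^2) (k1 - 1) k2 u v) =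
      P * (low1 s M * (\<Sum>j\<le>n. qV j * qVm (n - j) * t ^ j * g j * f j))"
  proof (cases "k2 < k1")
    case True
    show ?thesis unfolding interp_down1[OF True]
      using True by (simp add: coeff_low1_def P_def n_def f_def g_def s_def M_def)
  next
    case False
    then show ?thesis using k1 by (simp add: coeff_low1_def)
  qed
  have I4: "coeff_low2 k1 k2 * (linfac (a^2) (k2 - 1) u * interp (a^2) k1 (k2 - 1) u v) =
      P * (low2 s M * (\<Sum>j\<le>n. qV (Suc j) * qV (n - j) * t ^ Suc j * g j * f j) + b 0 * f0)"
  proof (cases "k2 = 0")
    case True
    then show ?thesis by (simp add: coeff_low2_def low2_def s_def b_def e_def)
  next
    case False
    then show ?thesis
      unfolding interp_down2[OF assms(1) False[unfolded neq0_conv]] lf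
      using bot by (simp add: coeff_low2_def P_def n_def f_def f0_def g_def s_def M_def algebra_simps)
  qed
  show ?thesis
    unfolding I0 I1 I2 I3 I4 n_def[symmetric] main eigenvalue_def P_def[symmetric] top s_def[symmetric] M_def[symmetric]
    by (simp add: algebra_simps)
qed

end

section \<open>The Koornwinder operator\<close>

text \<open>Adding the contributions of \<open>x\<close> and \<open>1 / x\<close> removes the poles at \<open>x\<^sup>2 = 1\<close>, and the result is
  expanded in the products \<open>(1 - be x) (1 - be / x) (1 - q be x) (1 - q be / x) \<cdots>\<close>.\<close>

lemma bracket_identity:
  fixes x be q t c p0 p1 p2 p3 :: complex
  assumes nz: "x \<noteq> 0" "be \<noteq> 0" "q \<noteq> 0" "t \<noteq> 0" and x: "x\<^sup>2 \<noteq> 1"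
  defines "p \<equiv> \<lambda>x. p0 + p1 * x + p2 * x^2 + p3 * x^3"
  defines "H \<equiv> \<lambda>x. (1 - be * x) * p x * (1 - t * c * x + t^2 * x^2) / (x^2 * (1 - x^2))"
  shows "H x + H (1 / x) = p be / be^2 * (1 + t^2 * be^2 - t * be * c)
     + (p0 * (t * c / be - q - (1 + q) / (q * be^2)) - p1 * (1 / be) - p2 * t^2 + p3 * (t * c - t^2 / (q * be) - t^2 * (1 + q) * be))
        * ((1 - be * x) * (1 - be / x))
     + (p0 / (q * be^2) + p3 * t^2 / (q * be)) * ((1 - be * x) * (1 - be / x) * ((1 - q * be * x) * (1 - q * be / x)))"
proof -
  have x': "1 - x^2 \<noteq> 0" using x by simp
  define b where "b = 1 / (1 - x^2)"
  have b: "b * (1 - x^2) = 1" using x' by (simp add: b_def)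
  define y where "y = 1 / x"
  have y: "x * y = 1" using nz by (simp add: y_def)
  have H1: "H x = (1 - be * x) * p x * (1 - t * c * x + t^2 * x^2) * y^2 * b"
    using nz by (simp add: H_def y_def b_def divide_simps)
  have H2: "H (1 / x) = - (1 - be * y) * p y * (1 - t * c * y + t^2 * y^2) * x^4 * b"
  proof -
    have d: "1 / ((1 / x)^2 * (1 - (1 / x)^2)) = (- (x^4)) * b"
      using nz x' by (simp add: b_def divide_simps) algebra
    have "H (1 / x) = (1 - be * y) * p y * (1 - t * c * y + t^2 * y^2) * (1 / ((1 / x)^2 * (1 - (1 / x)^2)))"
      by (simp add: H_def y_def)
    then show ?thesis unfolding d by (simp add: algebra_simps)
  qed
  have *: "H x + H (1 / x) = b * ((1 - be * x) * p x * (1 - t * c * x + t^2 * x^2) * y^2 - (1 - be * y) * p y * (1 - t * c * y + t^2 * y^2) * x^4)"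
    unfolding H1 H2 by (simp add: algebra_simps)
  have R: "((1 - be * x) * p x * (1 - t * c * x + t^2 * x^2) * y^2 - (1 - be * y) * p y * (1 - t * c * y + t^2 * y^2) * x^4) * (q * be^2)
    = (1 - x^2) * (q * p be * (1 + t^2 * be^2 - t * be * c)
     + (p0 * (q * t * c * be - q^2 * be^2 - (1 + q)) - p1 * q * be - p2 * q * t^2 * be^2 + p3 * (q * t * c * be^2 - t^2 * be - t^2 * (1 + q) * q * be^3))
        * ((1 - be * x) * (1 - be * y))
     + (p0 + p3 * t^2 * be) * ((1 - be * x) * (1 - be * y) * ((1 - q * be * x) * (1 - q * be * y))))"
    unfolding p_def using y by algebra
  have "H x + H (1 / x) = 1 / (q * be^2) * (q * p be * (1 + t^2 * be^2 - t * be * c)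
     + (p0 * (q * t * c * be - q^2 * be^2 - (1 + q)) - p1 * q * be - p2 * q * t^2 * be^2 + p3 * (q * t * c * be^2 - t^2 * be - t^2 * (1 + q) * q * be^3))
        * ((1 - be * x) * (1 - be * y))
     + (p0 + p3 * t^2 * be) * ((1 - be * x) * (1 - be * y) * ((1 - q * be * x) * (1 - q * be * y))))" (is "_ = _ * ?Z")
  proof -
    have "(H x + H (1 / x)) * (q * be^2) = b * ((1 - x^2) * ?Z)"
      unfolding * R[symmetric] by (simp only: ac_simps)
    also have "\<dots> = ?Z" using b by (simp only: mult.assoc[symmetric] mult_1)
    finally show ?thesis using nz by (simp add: divide_simps)
  qed
  also have "\<dots> = p be / be^2 * (1 + t^2 * be^2 - t * be * c)
     + (p0 * (t * c / be - q - (1 + q) / (q * be^2)) - p1 * (1 / be) - p2 * t^2 + p3 * (t * c - t^2 / (q * be) - t^2 * (1 + q) * be))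
        * ((1 - be * x) * (1 - be * y))
     + (p0 / (q * be^2) + p3 * t^2 / (q * be)) * ((1 - be * x) * (1 - be * y) * ((1 - q * be * x) * (1 - q * be * y)))"
  proof -
    define W1 where "W1 = (1 - be * x) * (1 - be * y)"
    define W2 where "W2 = (1 - q * be * x) * (1 - q * be * y)"
    define pb where "pb = p be"
    show ?thesis unfolding W1_def[symmetric] W2_def[symmetric] pb_def[symmetric] using nz
      by (simp add: divide_simps) algebra
  qed
  finally show ?thesis by (simp add: y_def)
qed

lemma qpoch_shift: "qpoch x q (Suc m) = (1 - x) * qpoch (x * q) q m"
  unfolding qpoch_def by (subst prod.lessThan_Suc_shift) (simp add: mult_ac)

context koornwinder_coeffs
begin

definition csum :: "complex \<Rightarrow> complex" where "csum x = x + 1 / x"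

definition phi :: "nat \<Rightarrow> complex \<Rightarrow> complex" where
  "phi l x = facs (a\<^sup>2) 0 l (a * csum x)"

lemma csum_inverse: "csum (1 / x) = csum x"
  by (simp add: csum_def)

lemma linfac_csum: "x \<noteq> 0 \<Longrightarrow> linfac (a\<^sup>2) i (a * csum x) = (1 - a * q ^ i * x) * (1 - a * q ^ i / x)"
  by (simp add: linfac_def csum_def divide_simps) algebra

lemma linfac_t_csum: "x \<noteq> 0 \<Longrightarrow> linfac (t\<^sup>2 * a\<^sup>2) i (t * (a * csum x)) = (1 - t * a * q ^ i * x) * (1 - t * a * q ^ i / x)"
  by (simp add: linfac_def csum_def divide_simps) algebra

lemma phi_qpoch: "x \<noteq> 0 \<Longrightarrow> phi l x = qpoch (a * x) q l * qpoch (a / x) q l"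
  by (simp add: phi_def facs_def linfac_csum qpoch_def prod.distrib[symmetric] atLeast0LessThan mult_ac)

text \<open>The quotient \<open>\<omega> (q x) / \<omega> (x)\<close> of the one-variable weight function.\<close>

definition wfun :: "complex \<Rightarrow> complex" where
  "wfun x = (1 - a * x) * cubic x / ((1 - x\<^sup>2) * (1 - q * x\<^sup>2))"

lemma wfun_phi:
  assumes x: "x \<noteq> 0" "q * x\<^sup>2 \<noteq> 1"
  shows "wfun x * (phi (Suc m) (q * x) - phi (Suc m) x) =
     - (a / q) * (1 - q ^ Suc m) * ((1 - a * q ^ m * x) * cubic x / (x * (1 - x\<^sup>2))) * phi m x"
proof -
  define A where "A = qpoch (a * x * q) q m"
  define B where "B = qpoch (a / x) q m"
  define Q where "Q = q ^ m"
  have qx: "q * x \<noteq> 0" using x q_nz by simp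
  have e1: "qpoch (a * x) q (Suc m) = (1 - a * x) * A"
    by (simp add: qpoch_shift A_def)
  have e1': "(1 - a * x) * A = qpoch (a * x) q m * (1 - a * x * Q)"
    unfolding e1[symmetric] by (simp add: qpoch_Suc Q_def)
  have e2: "qpoch (a * (q * x)) q (Suc m) = A * (1 - a * x * q * Q)"
    by (simp add: qpoch_Suc A_def Q_def mult_ac)
  have e3: "qpoch (a / x) q (Suc m) = B * (1 - a / x * Q)"
    by (simp add: qpoch_Suc B_def Q_def)
  have e4: "qpoch (a / (q * x)) q (Suc m) = (1 - a / (q * x)) * B"
    using q_nz by (simp add: qpoch_shift B_def)
  have "phi (Suc m) (q * x) - phi (Suc m) x = A * B * ((1 - a * x * q * Q) * (1 - a / (q * x)) - (1 - a * x) * (1 - a / x * Q))"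
    unfolding phi_qpoch[OF x(1)] phi_qpoch[OF qx] e1 e2 e3 e4 by (simp add: algebra_simps)
  also have "(1 - a * x * q * Q) * (1 - a / (q * x)) - (1 - a * x) * (1 - a / x * Q) = - a * (1 - q * Q) * (1 - q * x^2) / (q * x)"
    using x q_nz by (simp add: divide_simps) algebra
  finally have d: "phi (Suc m) (q * x) - phi (Suc m) x = A * B * (- a * (1 - q * Q) * (1 - q * x^2) / (q * x))" .
  have "wfun x * (phi (Suc m) (q * x) - phi (Suc m) x) = ((1 - a * x) * A) * B * cubic x * (- a * (1 - q * Q)) / ((1 - x^2) * q * x)"
    unfolding d wfun_def using x(2) by (simp add: mult_ac)
  also have "\<dots> = - (a / q) * (1 - q ^ Suc m) * ((1 - a * q ^ m * x) * cubic x / (x * (1 - x\<^sup>2))) * phi m x"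
    unfolding e1' phi_qpoch[OF x(1)] B_def[symmetric] by (simp add: Q_def mult_ac)
  finally show ?thesis .
qed

text \<open>The part of \<open>(c - x - 1/x) * kop\<close> that shifts the variable \<open>x\<close>, with \<open>c\<close> in place of the other
  variable: multiplication by the difference of the two sums clears the mixed denominators \<open>(1 - x y) (1 - x / y)\<close>.\<close>

definition op2 :: "complex \<Rightarrow> (complex \<Rightarrow> complex) \<Rightarrow> complex \<Rightarrow> complex" where
  "op2 c F x = - (1 / x) * (1 - t * c * x + t\<^sup>2 * x\<^sup>2) * wfun x * (F (q * x) - F x)
     - x * (1 - t * c / x + t\<^sup>2 / x\<^sup>2) * wfun (1 / x) * (F (q / x) - F (1 / x))"

definition regular :: "complex \<Rightarrow> bool" where
  "regular x \<longleftrightarrow> x \<noteq> 0 \<and> x\<^sup>2 \<noteq> 1 \<and> q * x\<^sup>2 \<noteq> 1 \<and> x\<^sup>2 \<noteq> q"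

theorem op2_phi:
  assumes x: "regular x"
  shows "op2 c (phi l) x = op_coeff c l (a * csum x)"
proof (cases l)
  case 0
  then show ?thesis by (simp add: op2_def op_coeff_def phi_def)
next
  case (Suc m)
  have x0: "x \<noteq> 0" "1 / x \<noteq> 0" "q * x^2 \<noteq> 1" "q * (1 / x)^2 \<noteq> 1" "x^2 \<noteq> 1"
    using x by (auto simp: regular_def divide_simps power2_eq_square)
  define be where "be = a * q ^ m"
  have be: "be \<noteq> 0" using a_nz q_nz by (simp add: be_def)
  define H where "H y = (1 - be * y) * cubic y * (1 - t * c * y + t^2 * y^2) / (y^2 * (1 - y^2))" for y
  have inv: "phi m (1 / x) = phi m x" by (simp add: phi_def csum_inverse)
  have "op2 c (phi l) x = - (1 / x) * (1 - t * c * x + t^2 * x^2) * (wfun x * (phi (Suc m) (q * x) - phi (Suc m) x))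
     - x * (1 - t * c / x + t^2 / x^2) * (wfun (1 / x) * (phi (Suc m) (q * (1 / x)) - phi (Suc m) (1 / x)))"
    unfolding op2_def Suc by simp
  also have "\<dots> = (a / q) * (1 - q ^ Suc m) * phi m x * (H x + H (1 / x))"
  proof -
    define U1 U2 V1 V2 D1 D2 Ph K where "U1 = 1 - t * c * x + t^2 * x^2" "U2 = 1 - t * c / x + t^2 / x^2"
      "V1 = (1 - be * x) * cubic x" "V2 = (1 - be * (1 / x)) * cubic (1 / x)"
      "D1 = 1 - x^2" "D2 = 1 - (1 / x)^2" "Ph = phi m x" "K = 1 - q ^ Suc m"
    note defs = this
    have H: "H x = V1 * U1 / (x^2 * D1)" "H (1 / x) = V2 * U2 / ((1 / x)^2 * D2)"
      by (simp_all add: H_def defs power_divide)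
    show ?thesis
      unfolding wfun_phi[OF x0(1,3)] wfun_phi[OF x0(2,4)] inv be_def[symmetric] H unfolding defs(1-8)[symmetric]
      using x0(1) by (simp add: distrib_left power2_eq_square mult_ac)
  qed
  also have "H x + H (1 / x) = cubic be / be^2 * (1 + t^2 * be^2 - t * be * c)
     + shift_mid c (q ^ l) * ((1 - be * x) * (1 - be / x))
     + shift_up (q ^ l) * ((1 - be * x) * (1 - be / x) * ((1 - q * be * x) * (1 - q * be / x)))"
  proof -
    have L: "a * q ^ l = q * be" by (simp add: Suc be_def)
    show ?thesis
      unfolding H_def cubic_def
      by (subst bracket_identity[OF x0(1) be q_nz t_nz x0(5)])
         (use be q_nz in \<open>simp add: shift_mid_def shift_up_def L power2_eq_square mult_ac\<close>)
  qed
  also have "(a / q) * (1 - q ^ Suc m) * phi m x * \<dots> = op_coeff c l (a * csum x)"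
  proof -
    have 1: "linfac (a\<^sup>2) m (a * csum x) = (1 - be * x) * (1 - be / x)"
      using x0(1) by (simp add: linfac_csum be_def)
    have 2: "linfac (a\<^sup>2) (Suc m) (a * csum x) = (1 - q * be * x) * (1 - q * be / x)"
      using x0(1) by (simp add: linfac_csum be_def mult_ac)
    have 3: "linfac (t\<^sup>2 * a\<^sup>2) m (t * (a * c)) = 1 + t\<^sup>2 * be\<^sup>2 - t * be * c"
      by (simp add: linfac_def be_def power_mult_distrib mult_ac)
    show ?thesis
      unfolding op_coeff_def Suc diff_Suc_1 facs_Suc[OF le0] 1 2 3 be_def[symmetric] phi_def[symmetric]
      by (simp only: distrib_left ac_simps)
  qed
  finally show ?thesis .
qed

definition Phi :: "complex \<Rightarrow> complex \<Rightarrow> complex" where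
  "Phi x y = wfun x * ((1 - t * x * y) * (1 - t * x / y) / ((1 - x * y) * (1 - x / y)))"

text \<open>Koornwinder's q-difference operator. The coefficient of each shift is a quotient of weights, see \<open>Phi_De\<close>.\<close>

definition kop :: "(complex \<Rightarrow> complex \<Rightarrow> complex) \<Rightarrow> complex \<Rightarrow> complex \<Rightarrow> complex" where
  "kop f x y = Phi x y * (f (q * x) y - f x y) + Phi (1 / x) y * (f (q / x) y - f x y)
     + Phi y x * (f x (q * y) - f x y) + Phi (1 / y) x * (f x (q / y) - f x y)"

lemma Phi_csum:
  assumes "x \<noteq> 0" "y \<noteq> 0" "csum x \<noteq> csum y"
  shows "(csum x - csum y) * Phi y x = - (1 / y) * (1 - t * csum x * y + t\<^sup>2 * y\<^sup>2) * wfun y"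
proof -
  have 1: "(1 - y * x) * (1 - y / x) = - y * (csum x - csum y)"
    using assms by (simp add: csum_def divide_simps) algebra
  have 2: "(1 - t * y * x) * (1 - t * y / x) = 1 - t * csum x * y + t\<^sup>2 * y\<^sup>2"
    using assms by (simp add: csum_def divide_simps) algebra
  show ?thesis
    unfolding Phi_def 1 2 using assms by simp
qed

lemma kop_op2:
  assumes "x \<noteq> 0" "y \<noteq> 0" "csum x \<noteq> csum y" and "f (1 / x) y = f x y" "f x (1 / y) = f x y"
  shows "(csum x - csum y) * kop f x y = op2 (csum x) (\<lambda>y. f x y) y - op2 (csum y) (\<lambda>x. f x y) x"
proof -
  define dc where "dc = csum x - csum y"
  have 1: "dc * Phi y x = - (1 / y) * (1 - t * csum x * y + t\<^sup>2 * y\<^sup>2) * wfun y"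
    using Phi_csum[OF assms(1,2,3)] by (simp add: dc_def)
  have 2: "dc * Phi (1 / y) x = - y * (1 - t * csum x / y + t\<^sup>2 / y\<^sup>2) * wfun (1 / y)"
    using Phi_csum[of x "1 / y"] assms by (simp add: csum_inverse power_divide dc_def)
  have 3: "dc * Phi x y = (1 / x) * (1 - t * csum y * x + t\<^sup>2 * x\<^sup>2) * wfun x"
  proof -
    have "dc * Phi x y = - ((csum y - csum x) * Phi x y)" by (simp add: dc_def algebra_simps)
    then show ?thesis using Phi_csum[of y x] assms by simp
  qed
  have 4: "dc * Phi (1 / x) y = x * (1 - t * csum y / x + t\<^sup>2 / x\<^sup>2) * wfun (1 / x)"
  proof -
    have "dc * Phi (1 / x) y = - ((csum y - csum (1 / x)) * Phi (1 / x) y)" by (simp add: dc_def csum_inverse algebra_simps)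
    then show ?thesis using Phi_csum[of y "1 / x"] assms by (simp add: csum_inverse power_divide)
  qed
  have "dc * kop f x y = (dc * Phi x y) * (f (q * x) y - f x y) + (dc * Phi (1 / x) y) * (f (q / x) y - f x y)
     + (dc * Phi y x) * (f x (q * y) - f x y) + (dc * Phi (1 / y) x) * (f x (q / y) - f x y)"
    by (simp add: kop_def distrib_left mult.assoc)
  then show ?thesis
    unfolding 1 2 3 4 dc_def[symmetric] op2_def assms(4,5) by simp
qed

lemma op2_sum: "op2 c (\<lambda>x. \<Sum>j\<in>S. h j * F j x) x = (\<Sum>j\<in>S. h j * op2 c (F j) x)"
proof -
  define C1 C2 where "C1 = - (1 / x) * (1 - t * c * x + t\<^sup>2 * x\<^sup>2) * wfun x"
    and "C2 = x * (1 - t * c / x + t\<^sup>2 / x\<^sup>2) * wfun (1 / x)"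
  have *: "op2 c G x = C1 * (G (q * x) - G x) - C2 * (G (q / x) - G (1 / x))" for G
    by (simp add: op2_def C1_def C2_def)
  show ?thesis
    unfolding * by (simp add: sum_distrib_left sum_subtractf sum.distrib algebra_simps)
qed

lemma kop_sum: "kop (\<lambda>x y. \<Sum>j\<in>S. h j * F j x y) x y = (\<Sum>j\<in>S. h j * kop (F j) x y)"
proof -
  have "kop (\<lambda>x y. \<Sum>j\<in>S. h j * F j x y) x y =
     (\<Sum>j\<in>S. Phi x y * (h j * F j (q * x) y - h j * F j x y) + Phi (1 / x) y * (h j * F j (q / x) y - h j * F j x y)
     + Phi y x * (h j * F j x (q * y) - h j * F j x y) + Phi (1 / y) x * (h j * F j x (q / y) - h j * F j x y))"
    unfolding kop_def by (simp only: sum_subtractf[symmetric] sum_distrib_left sum.distrib[symmetric])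
  also have "\<dots> = (\<Sum>j\<in>S. h j * kop (F j) x y)"
    by (intro sum.cong refl) (simp add: kop_def algebra_simps)
  finally show ?thesis .
qed

definition Npol :: "nat \<Rightarrow> nat \<Rightarrow> complex \<Rightarrow> complex \<Rightarrow> complex" where
  "Npol k1 k2 x y = interp (a\<^sup>2) k1 k2 (a * csum x) (a * csum y)"

lemma Npol_commute: "Npol k1 k2 x y = Npol k1 k2 y x"
  by (simp add: Npol_def interp_commute)

lemma Npol_inverse: "Npol k1 k2 (1 / x) y = Npol k1 k2 x y" "Npol k1 k2 x (1 / y) = Npol k1 k2 x y"
  by (simp_all add: Npol_def csum_inverse)

definition "beta1 k1 k2 = - coeff_low1 k1 k2 * (t * q ^ (k1 - 1) * a)"
definition "beta2 k1 k2 = - coeff_low2 k1 k2 * (q ^ (k2 - 1) * a)"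

lemma op2_Npol:
  assumes "k2 \<le> k1" "regular y"
  shows "op2 (csum x) (\<lambda>y. Npol k1 k2 x y) y
    = (sym0 (q ^ k2) (q ^ (k1 - k2)) + eigenvalue k1 k2 * csum x) * Npol k1 k2 x y
      + sym3 (q ^ k2) (q ^ (k1 - k2)) * Npol (Suc k1) k2 x y
      + sym4 (q ^ k2) (q ^ (k1 - k2)) * Npol k1 (Suc k2) x y
      + coeff_low1 k1 k2 * (linfac (t\<^sup>2 * a\<^sup>2) (k1 - 1) (t * (a * csum x)) * Npol (k1 - 1) k2 x y)
      + coeff_low2 k1 k2 * (linfac (a\<^sup>2) (k2 - 1) (a * csum x) * Npol k1 (k2 - 1) x y)"
proof -
  have "(\<lambda>y. Npol k1 k2 x y) = (\<lambda>y. \<Sum>j\<le>k1 - k2. facs (a\<^sup>2) 0 k2 (a * csum x) *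
     (qV j * qV (k1 - k2 - j) * t ^ j * facs (t\<^sup>2 * a\<^sup>2) (k2 + j) k1 (t * (a * csum x))) * phi (k2 + j) y)"
    unfolding Npol_def interp_expand[OF assms(1)] sum_distrib_left phi_def by (simp only: mult.assoc)
  then have "op2 (csum x) (\<lambda>y. Npol k1 k2 x y) y = (\<Sum>j\<le>k1 - k2. facs (a\<^sup>2) 0 k2 (a * csum x) *
     (qV j * qV (k1 - k2 - j) * t ^ j * facs (t\<^sup>2 * a\<^sup>2) (k2 + j) k1 (t * (a * csum x))) * op_coeff (csum x) (k2 + j) (a * csum y))"
    by (simp only: op2_sum op2_phi[OF assms(2)])
  also have "\<dots> = facs (a\<^sup>2) 0 k2 (a * csum x) *
     (\<Sum>j\<le>k1 - k2. qV j * qV (k1 - k2 - j) * t ^ j * facs (t\<^sup>2 * a\<^sup>2) (k2 + j) k1 (t * (a * csum x)) * op_coeff (csum x) (k2 + j) (a * csum y))"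
    by (simp only: sum_distrib_left mult.assoc)
  also note op_interp[OF assms(1)]
  finally show ?thesis unfolding Npol_def .
qed

text \<open>By \<open>kop_op2\<close> the operator is an antisymmetrised version of \<open>op2\<close>, divided by the difference of the sums.
  The three symmetric terms of \<open>op_interp\<close> drop out. In the others only the dependence on \<open>x + 1/x\<close>, which is
  linear, survives, and the difference of the sums cancels.\<close>

theorem kop_Npol:
  assumes "k2 \<le> k1" "regular x" "regular y" "csum x \<noteq> csum y"
  shows "kop (Npol k1 k2) x y = eigenvalue k1 k2 * Npol k1 k2 x y
     + beta1 k1 k2 * Npol (k1 - 1) k2 x y + beta2 k1 k2 * Npol k1 (k2 - 1) x y"
proof -
  have nz: "x \<noteq> 0" "y \<noteq> 0" using assms by (auto simp: regular_def)
  have sw: "op2 (csum y) (\<lambda>x. Npol k1 k2 x y) x = op2 (csum y) (\<lambda>x. Npol k1 k2 y x) x"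
    by (simp add: Npol_commute[of k1 k2 y])
  have "(csum x - csum y) * kop (Npol k1 k2) x y =
      (csum x - csum y) * (eigenvalue k1 k2 * Npol k1 k2 x y
     + beta1 k1 k2 * Npol (k1 - 1) k2 x y + beta2 k1 k2 * Npol k1 (k2 - 1) x y)"
    unfolding kop_op2[where f = "Npol k1 k2", OF nz assms(4) Npol_inverse] sw op2_Npol[OF assms(1,3)] op2_Npol[OF assms(1,2)]
      Npol_commute[of _ _ y x] linfac_def beta1_def beta2_def
    by (simp add: algebra_simps)
  then show ?thesis using assms(4) by simp
qed

end

section \<open>The binomial sum is an eigenfunction\<close>

context q_and_t
begin

lemma facs_eq_0: "i \<le> m \<Longrightarrow> m < j \<Longrightarrow> linfac al m u = 0 \<Longrightarrow> facs al i j u = 0"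
  by (auto simp: facs_def intro!: prod_zero)

text \<open>The extra vanishing property: at a node with parts \<open>m1, m2\<close>, every term of the sum contains a vanishing
  linear factor unless \<open>k1 \<le> m1\<close> and \<open>k2 \<le> m2\<close>.\<close>

lemma interp_eq_0:
  assumes "linfac (t\<^sup>2 * al) m1 (t * u) = 0" "linfac al m2 v = 0" "m2 \<le> m1" "m1 < k1 \<or> m2 < k2"
  shows "interp al k1 k2 u v = 0"
proof (cases "k2 \<le> k1")
  case True
  have *: "facs (t\<^sup>2 * al) (k2 + j) k1 (t * u) * facs al 0 (k2 + j) v = 0" for j
  proof (cases "m2 < k2 + j")
    case True
    then show ?thesis using facs_eq_0[of 0 m2 "k2 + j" al v] assms by simp
  next
    case False
    then show ?thesis using facs_eq_0[of "k2 + j" m1 k1 "t\<^sup>2 * al" "t * u"] assms by simp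
  qed
  show ?thesis
    unfolding interp_expand[OF True] mult.assoc * by simp
qed (simp add: interp_def)

lemma interp_0 [simp]: "interp al 0 0 u v = 1"
  by (simp add: interp_def)

definition wt_core :: "nat \<Rightarrow> nat \<Rightarrow> complex" where
  "wt_core n k2 = qV n * qpoch q q k2 * qpoch (t * q ^ Suc n) q k2 * qpoch (t\<^sup>2) q n"

lemma qpoch_t_power_nz: "qpoch (t * q ^ n) q k \<noteq> 0"
  using one_minus_t_q by (simp add: qpoch_def mult.assoc flip: power_add)

lemma wt_core_nz: "wt_core n k \<noteq> 0"
  using qV_nz qpoch_q_nz qpoch_t_power_nz[of "Suc n"] qpoch_t2_nz by (simp add: wt_core_def)

lemma wt_core_Suc1:
  "wt_core (Suc n) k * ((1 - q * q ^ n) * (1 - t * q ^ Suc n)) =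
   wt_core n k * ((1 - t * q ^ n) * (1 - t * q ^ Suc n * q ^ k) * (1 - t\<^sup>2 * q ^ n))"
proof -
  have *: "(1 - t * q ^ Suc n) * qpoch (t * q ^ Suc (Suc n)) q k = qpoch (t * q ^ Suc n) q k * (1 - t * q ^ Suc n * q ^ k)"
    using qpoch_shift[of "t * q ^ Suc n" q k] by (simp add: qpoch_Suc mult_ac)
  have "wt_core (Suc n) k * ((1 - q * q ^ n) * (1 - t * q ^ Suc n)) =
     ((1 - q * q ^ n) * qV (Suc n)) * qpoch q q k * (qpoch (t * q ^ Suc n) q k * (1 - t * q ^ Suc n * q ^ k)) * (qpoch (t\<^sup>2) q n * (1 - t\<^sup>2 * q ^ n))"
    unfolding *[symmetric] by (simp only: wt_core_def qpoch_Suc ac_simps)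
  then show ?thesis unfolding qV_Suc by (simp only: wt_core_def ac_simps)
qed

lemma wt_core_Suc2:
  "wt_core n (Suc k) * ((1 - t * q ^ n) * (1 - t\<^sup>2 * q ^ n)) =
   wt_core (Suc n) k * ((1 - q * q ^ n) * (1 - q * q ^ k) * (1 - t * q ^ Suc n))"
proof -
  have "wt_core n (Suc k) * ((1 - t * q ^ n) * (1 - t\<^sup>2 * q ^ n)) =
     ((1 - t * q ^ n) * qV n) * (qpoch q q k * (1 - q * q ^ k)) * ((1 - t * q ^ Suc n) * qpoch (t * q ^ Suc (Suc n)) q k) * qpoch (t\<^sup>2) q (Suc n)"
    using qpoch_shift[of "t * q ^ Suc n" q k] by (simp add: wt_core_def qpoch_Suc mult_ac)
  then show ?thesis unfolding qV_Suc[symmetric] by (simp only: wt_core_def qpoch_Suc ac_simps)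
qed

end

text \<open>From here on the cubic is \<open>(1 - b\<^sub>2 x) (1 - b\<^sub>3 x) (1 - b\<^sub>4 x)\<close>. The parameters are called \<open>b1, \<dots>, b4\<close>
  because only at the end are they the values of a function \<open>a\<close>.\<close>

locale koornwinder_product = koornwinder_coeffs q t b1 1 p1 p2 p3 for q t b1 p1 p2 p3 +
  fixes b2 b3 b4 :: complex
  assumes p1: "p1 = - (b2 + b3 + b4)" and p2: "p2 = b2 * b3 + b2 * b4 + b3 * b4" and p3: "p3 = - (b2 * b3 * b4)"
    and t_pair_nz: "\<And>k. 1 - t * b1 * b2 * q ^ k \<noteq> 0" "\<And>k. 1 - t * b1 * b3 * q ^ k \<noteq> 0" "\<And>k. 1 - t * b1 * b4 * q ^ k \<noteq> 0"
    and pair_nz: "\<And>k. 1 - b1 * b2 * q ^ k \<noteq> 0" "\<And>k. 1 - b1 * b3 * q ^ k \<noteq> 0" "\<And>k. 1 - b1 * b4 * q ^ k \<noteq> 0"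
    and norm_b: "norm (b1 * b2 * b3 * b4) < 1"
begin

lemma cubic_eq: "cubic x = (1 - b2 * x) * (1 - b3 * x) * (1 - b4 * x)"
  unfolding cubic_def using p1 p2 p3 by algebra

definition A :: complex where "A = b1 * b2 * b3 * b4 / q"

definition pairs :: "nat \<Rightarrow> nat \<Rightarrow> complex" where
  "pairs k1 k2 = qpoch (t * b1 * b2) q k1 * qpoch (t * b1 * b3) q k1 * qpoch (t * b1 * b4) q k1 *
     (qpoch (b1 * b2) q k2 * qpoch (b1 * b3) q k2 * qpoch (b1 * b4) q k2)"

lemma pairs_nz: "pairs k1 k2 \<noteq> 0"
  using t_pair_nz pair_nz by (simp add: pairs_def qpoch_def)

lemma pairs_Suc1: "pairs (Suc k1) k2 = pairs k1 k2 * cubic (t * b1 * q ^ k1)"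
  by (simp add: pairs_def qpoch_Suc cubic_eq mult_ac)

lemma pairs_Suc2: "pairs k1 (Suc k2) = pairs k1 k2 * cubic (b1 * q ^ k2)"
  by (simp add: pairs_def qpoch_Suc cubic_eq mult_ac)

lemma cubic_nz: "cubic (t * b1 * q ^ k) \<noteq> 0" "cubic (b1 * q ^ k) \<noteq> 0"
  using t_pair_nz[of k] pair_nz[of k] by (simp_all add: cubic_eq mult_ac)

definition wt :: "nat \<Rightarrow> nat \<Rightarrow> complex" where
  "wt k1 k2 = q ^ (k1 + k2) * t ^ (2 * k2) / (wt_core (k1 - k2) k2 * pairs k1 k2)"

text \<open>The defining property of the weights: they turn the lowering coefficients of the operator into the raising
  coefficients of the Pieri rule on the spectral side.\<close>

lemma wt_beta1:
  assumes "k2 \<le> k1"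
  shows "wt (Suc k1) k2 * beta1 (Suc k1) k2 = wt k1 k2 * (t * pieri1 k1 k2)"
proof -
  define n where "n = k1 - k2"
  have k1: "k1 = n + k2" "Suc k1 - k2 = Suc n" "k1 - k2 = n" using assms by (auto simp: n_def)
  define Q S C W W' P where "Q = q ^ n" "S = q ^ k2" "C = cubic (t * b1 * q ^ k1)" "W = wt_core n k2" "W' = wt_core (Suc n) k2" "P = pairs k1 k2"
  note defs = this
  have nz: "Q \<noteq> 0" "S \<noteq> 0" "C \<noteq> 0" "W \<noteq> 0" "W' \<noteq> 0" "P \<noteq> 0" "1 - q * Q \<noteq> 0" "1 - t * Q \<noteq> 0" "1 - t * q * Q \<noteq> 0" "1 - t * q * Q * S \<noteq> 0" "1 - t\<^sup>2 * Q \<noteq> 0"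
    using q_nz wt_core_nz cubic_nz pairs_nz one_minus_q_q one_minus_t_q[of n] one_minus_t_q[of "Suc n"] one_minus_t_q[of "Suc n + k2"] one_minus_t2_q
    by (auto simp: defs power_add mult.assoc)
  have qk: "q ^ k1 = Q * S" by (simp add: k1 defs power_add)
  have W': "W' = W * ((1 - t * Q) * (1 - t * q * Q * S) * (1 - t\<^sup>2 * Q)) / ((1 - q * Q) * (1 - t * q * Q))"
    using wt_core_Suc1[of n k2] nz by (simp add: defs divide_simps mult_ac)
  have beta: "beta1 (Suc k1) k2 = - ((1 - t * (q * Q * S)) / (q * Q * S) * ((1 - t\<^sup>2 * Q) / (1 - t * q * Q)) * C)"
  proof -
    have e: "t * b1 * (S * (q * Q)) / q = t * b1 * q ^ k1" using q_nz by (simp add: qk)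
    have "low1 S (q * Q) = (1 - t * (S * (q * Q))) / (S * (q * Q)) * ((1 - t\<^sup>2 * Q) / (1 - t * q * Q)) * (C / (t * b1 * q ^ k1))"
      unfolding low1_def sig_def e using q_nz by (simp add: defs(3) mult_ac)
    moreover have "beta1 (Suc k1) k2 = - low1 S (q * Q) * (t * b1 * q ^ k1)"
      using assms by (simp add: beta1_def coeff_low1_def k1(2) defs Suc_diff_le n_def[symmetric] mult_ac)
    ultimately show ?thesis using q_nz t_nz a_nz by (simp add: mult_ac)
  qed
  have 1: "wt (Suc k1) k2 = q * (q ^ (k1 + k2) * t ^ (2 * k2)) / (W' * (P * C))"
    unfolding wt_def k1(2) pairs_Suc1 by (simp add: defs)
  have 2: "wt k1 k2 = q ^ (k1 + k2) * t ^ (2 * k2) / (W * P)"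
    unfolding wt_def k1(3) by (simp add: defs)
  have 3: "pieri1 k1 k2 = - (1 - q * Q) / (t * (Q * S) * (1 - t * Q))"
    unfolding pieri1_def k1(3) qk by (simp add: defs)
  define Z where "Z = q ^ (k1 + k2) * t ^ (2 * k2)"
  define X where "X = 1 - t * q * Q * S"
  have X: "1 - t * (q * Q * S) = X" by (simp add: X_def mult_ac)
  define X2 X3 X4 X5 where "X2 = 1 - t\<^sup>2 * Q" "X3 = 1 - t * q * Q" "X4 = 1 - q * Q" "X5 = 1 - t * Q"
  note Xd = this
  show ?thesis
    unfolding 1 2 3 beta W' Z_def[symmetric] X_def[symmetric] X unfolding Xd[symmetric]
    using nz[folded X_def, folded Xd] q_nz t_nz by (simp add: divide_simps)
qed

lemma wt_beta2:
  assumes "k2 < k1"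
  shows "wt k1 (Suc k2) * beta2 k1 (Suc k2) = wt k1 k2 * (t * pieri2 k1 k2)"
proof -
  define n where "n = k1 - Suc k2"
  have k1: "k1 = Suc n + k2" "k1 - k2 = Suc n" "k1 - Suc k2 = n" using assms by (auto simp: n_def)
  define Q S C W W' P where "Q = q ^ n" "S = q ^ k2" "C = cubic (b1 * q ^ k2)" "W = wt_core (Suc n) k2" "W' = wt_core n (Suc k2)" "P = pairs k1 k2"
  note defs = this
  define X1 X2 X3 X4 X5 where "X1 = 1 - q * S" "X2 = 1 - t\<^sup>2 * Q" "X3 = 1 - t * q * Q" "X4 = 1 - q * Q" "X5 = 1 - t * Q"
  note Xd = this
  have nz: "Q \<noteq> 0" "S \<noteq> 0" "C \<noteq> 0" "W \<noteq> 0" "W' \<noteq> 0" "P \<noteq> 0" "X1 \<noteq> 0" "X2 \<noteq> 0" "X3 \<noteq> 0" "X4 \<noteq> 0" "X5 \<noteq> 0"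
    using q_nz wt_core_nz cubic_nz pairs_nz one_minus_q_q one_minus_t_q[of n] one_minus_t_q[of "Suc n"] one_minus_t2_q
    by (auto simp: defs Xd mult.assoc)
  have W': "W' = W * (X4 * X1 * X3) / (X5 * X2)"
    using wt_core_Suc2[of n k2] nz(8,11) by (simp add: defs Xd divide_simps mult_ac)
  have beta: "beta2 k1 (Suc k2) = - (X1 / (q * S) * (X4 / X5) * C)"
  proof -
    have "b1 * (q * S) / q = b1 * q ^ k2" using q_nz by (simp add: defs)
    then have "low2 (q * S) Q = - (1 - 1 / (q * S)) * (X4 / X5) * (C / (b1 * q ^ k2))"
      by (simp add: low2_def kap_def defs Xd)
    moreover have "beta2 k1 (Suc k2) = - low2 (q * S) Q * (b1 * q ^ k2)"
      by (simp add: beta2_def coeff_low2_def k1(3) defs mult_ac)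
    ultimately have "beta2 k1 (Suc k2) = (1 - 1 / (q * S)) * (X4 / X5) * C"
      using q_nz a_nz by (simp add: left_diff_distrib diff_divide_distrib)
    moreover have "1 - 1 / (q * S) = - (X1 / (q * S))" using q_nz nz by (simp add: Xd divide_simps)
    ultimately show ?thesis by simp
  qed
  have 1: "wt k1 (Suc k2) = q * t\<^sup>2 * (q ^ (k1 + k2) * t ^ (2 * k2)) / (W' * (P * C))"
    unfolding wt_def k1(3) pairs_Suc2 by (simp add: defs power2_eq_square)
  have 2: "wt k1 k2 = q ^ (k1 + k2) * t ^ (2 * k2) / (W * P)"
    unfolding wt_def k1(2) by (simp add: defs)
  have 3: "pieri2 k1 k2 = - t * X2 / (S * X3)"
  proof -
    have "q - t\<^sup>2 * q ^ Suc n = q * X2" by (simp add: Xd defs algebra_simps)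
    then show ?thesis unfolding pieri2_def k1(2) using q_nz by (simp add: defs Xd mult_ac)
  qed
  define Z where "Z = q ^ (k1 + k2) * t ^ (2 * k2)"
  show ?thesis
    unfolding 1 2 3 beta W' Z_def[symmetric]
    using nz q_nz t_nz by (simp add: divide_simps power2_eq_square)
qed

text \<open>The spectral point of the partition \<open>(m1, m2)\<close>, a node of the interpolation polynomials with
  parameter \<open>A\<close>.\<close>

definition yu :: "nat \<Rightarrow> complex" where "yu m1 = t * A * q ^ m1 + 1 / (t * q ^ m1)"
definition yv :: "nat \<Rightarrow> complex" where "yv m2 = A * q ^ m2 + 1 / q ^ m2"

definition dual :: "nat \<Rightarrow> nat \<Rightarrow> nat \<Rightarrow> nat \<Rightarrow> complex" where
  "dual k1 k2 m1 m2 = interp A k1 k2 (yu m1) (yv m2)"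

lemma linfac_yv: "linfac A m (yv m) = 0"
  using q_nz by (simp add: linfac_def yv_def algebra_simps power2_eq_square)

lemma linfac_yu: "linfac (t\<^sup>2 * A) m (t * yu m) = 0"
  using q_nz t_nz by (simp add: linfac_def yu_def algebra_simps power2_eq_square)

lemma dual_eq_0: "m2 \<le> m1 \<Longrightarrow> m1 < k1 \<or> m2 < k2 \<Longrightarrow> dual k1 k2 m1 m2 = 0"
  unfolding dual_def by (rule interp_eq_0[OF linfac_yu linfac_yv])

lemma Npol_base: "Npol k1 k2 (t * b1) b1 = (if k1 = 0 \<and> k2 = 0 then 1 else 0)"
proof (cases "k1 = 0 \<and> k2 = 0")
  case False
  have 1: "linfac (t\<^sup>2 * b1\<^sup>2) 0 (t * (b1 * csum (t * b1))) = 0"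
    using t_nz a_nz by (simp add: linfac_def csum_def algebra_simps power2_eq_square)
  have 2: "linfac (b1\<^sup>2) 0 (b1 * csum b1) = 0"
    using a_nz by (simp add: linfac_def csum_def algebra_simps power2_eq_square)
  from False show ?thesis unfolding Npol_def by (subst interp_eq_0[OF 1 2]) auto
qed (simp add: Npol_def)

lemma eigenvalue_node: "eigenvalue m1 m2 - eigenvalue k1 k2 = t * (node A m1 m2 - node A k1 k2)"
  if "m2 \<le> m1" "k2 \<le> k1"
proof -
  have *: "eigenvalue m1 m2 = t * node A m1 m2 - (1 + t + A * t\<^sup>2 + A * t)" if "m2 \<le> m1" for m1 m2
  proof -
    have e: "q ^ m2 * q ^ (m1 - m2) = q ^ m1" using that by (simp flip: power_add)
    define X Y where "X = q ^ m1" "Y = q ^ m2"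
    have nz: "X \<noteq> 0" "Y \<noteq> 0" using q_nz by (simp_all add: X_Y_def)
    show ?thesis
      unfolding eigenvalue_def eigen_def node_def A_def X_Y_def[symmetric] e[folded X_Y_def] unfolding p3
      using nz q_nz t_nz by (simp add: divide_simps) algebra
  qed
  show ?thesis unfolding *[OF that(1)] *[OF that(2)] by (simp add: algebra_simps)
qed

definition binom_sum :: "nat \<Rightarrow> nat \<Rightarrow> complex \<Rightarrow> complex \<Rightarrow> complex" where
  "binom_sum m1 m2 x y = (\<Sum>(k1, k2)\<in>{..m1} \<times> {..m2}. wt k1 k2 * dual k1 k2 m1 m2 * Npol k1 k2 x y)"

lemma binom_sum_base: "binom_sum m1 m2 (t * b1) b1 = 1"
proof -
  have "binom_sum m1 m2 (t * b1) b1 = (\<Sum>(k1, k2)\<in>{..m1} \<times> {..m2}. if k1 = 0 \<and> k2 = 0 then 1 else 0)"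
    unfolding binom_sum_def
    by (intro sum.cong refl) (auto simp: Npol_base wt_def wt_core_def pairs_def dual_def)
  also have "\<dots> = (\<Sum>k1\<le>m1. \<Sum>k2\<le>m2. if k1 = 0 then (if k2 = 0 then 1 else 0) else 0)"
    unfolding sum.cartesian_product[symmetric] by (intro sum.cong refl) auto
  also have "\<dots> = (\<Sum>k1\<le>m1. if k1 = 0 then (\<Sum>k2\<le>m2. if k2 = 0 then 1 else 0) else (0 :: complex))"
    by (intro sum.cong refl) auto
  finally show ?thesis by (simp add: sum.delta)
qed

lemma Npol_eq_0: "k1 < k2 \<Longrightarrow> Npol k1 k2 x y = 0"
  by (simp add: Npol_def interp_def)

text \<open>After an index shift, the coefficient of \<open>Npol k1 k2\<close> in the image is \<open>wt k1 k2\<close> times the eigenvalue of \<open>k\<close> times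
  \<open>dual\<close>, plus \<open>t\<close> times the right-hand side of the Pieri rule at the spectral point. The
  Pieri rule and \<open>eigenvalue_node\<close> convert this into the eigenvalue of \<open>m\<close>.\<close>

theorem kop_binom_sum:
  assumes m: "m2 \<le> m1" and xy: "regular x" "regular y" "csum x \<noteq> csum y"
  shows "kop (binom_sum m1 m2) x y = eigenvalue m1 m2 * binom_sum m1 m2 x y"
proof -
  define N where "N k1 k2 = Npol k1 k2 x y" for k1 k2
  define d where "d k1 k2 = dual k1 k2 m1 m2" for k1 k2
  define c where "c k1 k2 = wt k1 k2 * d k1 k2" for k1 k2
  have d0: "d k1 k2 = 0" if "k1 < k2 \<or> m1 < k1 \<or> m2 < k2" for k1 k2
    using that dual_eq_0[OF m, of k1 k2] by (cases "k1 < k2") (auto simp: d_def dual_def interp_def)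
  have "kop (binom_sum m1 m2) x y = (\<Sum>(k1, k2)\<in>{..m1} \<times> {..m2}. c k1 k2 * kop (Npol k1 k2) x y)"
    unfolding binom_sum_def case_prod_beta
    by (subst kop_sum) (simp add: c_def d_def)
  also have "\<dots> = (\<Sum>(k1, k2)\<in>{..m1} \<times> {..m2}. c k1 k2 * (eigenvalue k1 k2 * N k1 k2
      + beta1 k1 k2 * N (k1 - 1) k2 + beta2 k1 k2 * N k1 (k2 - 1)))"
  proof (intro sum.cong refl, clarify)
    fix k1 k2
    show "c k1 k2 * kop (Npol k1 k2) x y = c k1 k2 * (eigenvalue k1 k2 * N k1 k2
      + beta1 k1 k2 * N (k1 - 1) k2 + beta2 k1 k2 * N k1 (k2 - 1))"
      using kop_Npol[OF _ xy, of k2 k1] d0[of k1 k2] by (cases "k2 \<le> k1") (auto simp: N_def c_def)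
  qed
  also have "\<dots> = (\<Sum>k1\<le>m1. \<Sum>k2\<le>m2. c k1 k2 * eigenvalue k1 k2 * N k1 k2)
      + (\<Sum>k1\<le>m1. \<Sum>k2\<le>m2. c k1 k2 * beta1 k1 k2 * N (k1 - 1) k2)
      + (\<Sum>k1\<le>m1. \<Sum>k2\<le>m2. c k1 k2 * beta2 k1 k2 * N k1 (k2 - 1))"
    unfolding sum.cartesian_product[symmetric] sum.distrib[symmetric] by (simp add: algebra_simps)
  also have "(\<Sum>k1\<le>m1. \<Sum>k2\<le>m2. c k1 k2 * beta1 k1 k2 * N (k1 - 1) k2)
     = (\<Sum>k1\<le>m1. \<Sum>k2\<le>m2. c (Suc k1) k2 * beta1 (Suc k1) k2 * N k1 k2)"
  proof -
    let ?f = "\<lambda>k1. \<Sum>k2\<le>m2. c k1 k2 * beta1 k1 k2 * N (k1 - 1) k2"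
    have "sum ?f {..m1} = sum ?f {..Suc m1}"
      using d0[of "Suc m1"] by (simp add: c_def)
    also have "\<dots> = ?f 0 + (\<Sum>k1\<le>m1. ?f (Suc k1))" by (rule sum.atMost_Suc_shift)
    also have "?f 0 = 0" by (simp add: beta1_def coeff_low1_def)
    finally show ?thesis by simp
  qed
  also have "(\<Sum>k1\<le>m1. \<Sum>k2\<le>m2. c k1 k2 * beta2 k1 k2 * N k1 (k2 - 1))
     = (\<Sum>k1\<le>m1. \<Sum>k2\<le>m2. c k1 (Suc k2) * beta2 k1 (Suc k2) * N k1 k2)"
  proof (rule sum.cong[OF refl])
    fix k1
    let ?f = "\<lambda>k2. c k1 k2 * beta2 k1 k2 * N k1 (k2 - 1)"
    have "sum ?f {..m2} = sum ?f {..Suc m2}"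
      using d0[of k1 "Suc m2"] by (simp add: c_def)
    also have "\<dots> = ?f 0 + (\<Sum>k2\<le>m2. ?f (Suc k2))" by (rule sum.atMost_Suc_shift)
    also have "?f 0 = 0" by (simp add: beta2_def coeff_low2_def low2_def)
    finally show "sum ?f {..m2} = (\<Sum>k2\<le>m2. c k1 (Suc k2) * beta2 k1 (Suc k2) * N k1 k2)" by simp
  qed
  also have "(\<Sum>k1\<le>m1. \<Sum>k2\<le>m2. c k1 k2 * eigenvalue k1 k2 * N k1 k2)
      + (\<Sum>k1\<le>m1. \<Sum>k2\<le>m2. c (Suc k1) k2 * beta1 (Suc k1) k2 * N k1 k2)
      + (\<Sum>k1\<le>m1. \<Sum>k2\<le>m2. c k1 (Suc k2) * beta2 k1 (Suc k2) * N k1 k2)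
     = (\<Sum>k1\<le>m1. \<Sum>k2\<le>m2. (c k1 k2 * eigenvalue k1 k2 + c (Suc k1) k2 * beta1 (Suc k1) k2
         + c k1 (Suc k2) * beta2 k1 (Suc k2)) * N k1 k2)"
    unfolding sum.distrib[symmetric] by (simp add: algebra_simps)
  also have "\<dots> = (\<Sum>k1\<le>m1. \<Sum>k2\<le>m2. eigenvalue m1 m2 * (c k1 k2 * N k1 k2))"
  proof (intro sum.cong refl)
    fix k1 k2
    show "(c k1 k2 * eigenvalue k1 k2 + c (Suc k1) k2 * beta1 (Suc k1) k2
         + c k1 (Suc k2) * beta2 k1 (Suc k2)) * N k1 k2 = eigenvalue m1 m2 * (c k1 k2 * N k1 k2)"
    proof (cases "k2 \<le> k1")
      case False
      then show ?thesis by (simp add: N_def Npol_eq_0)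
    next
      case True
      have e1: "c (Suc k1) k2 * beta1 (Suc k1) k2 = wt k1 k2 * (t * pieri1 k1 k2) * d (Suc k1) k2"
        using wt_beta1[OF True] by (simp add: c_def mult_ac)
      have e2: "c k1 (Suc k2) * beta2 k1 (Suc k2) = wt k1 k2 * (t * pieri2 k1 k2) * d k1 (Suc k2)"
      proof (cases "k2 < k1")
        case True
        then show ?thesis using wt_beta2[OF True] by (simp add: c_def mult_ac)
      qed (use d0 in \<open>simp add: c_def\<close>)
      have "pieri1 k1 k2 * d (Suc k1) k2 + pieri2 k1 k2 * d k1 (Suc k2) = (node A m1 m2 - node A k1 k2) * d k1 k2"
        unfolding d_def dual_def interp_pieri[OF True, symmetric] by (simp add: yu_def yv_def node_def algebra_simps)
      then have "t * (pieri1 k1 k2 * d (Suc k1) k2 + pieri2 k1 k2 * d k1 (Suc k2)) = (eigenvalue m1 m2 - eigenvalue k1 k2) * d k1 k2"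
        unfolding eigenvalue_node[OF m True] by (simp add: mult.assoc)
      then have "wt k1 k2 * (t * (pieri1 k1 k2 * d (Suc k1) k2 + pieri2 k1 k2 * d k1 (Suc k2))) = (eigenvalue m1 m2 - eigenvalue k1 k2) * c k1 k2"
        by (simp add: c_def)
      then have "c (Suc k1) k2 * beta1 (Suc k1) k2 + c k1 (Suc k2) * beta2 k1 (Suc k2) = (eigenvalue m1 m2 - eigenvalue k1 k2) * c k1 k2"
        unfolding e1 e2 by (simp add: algebra_simps)
      then show ?thesis by (simp add: algebra_simps)
    qed
  qed
  also have "\<dots> = eigenvalue m1 m2 * binom_sum m1 m2 x y"
    by (simp add: binom_sum_def c_def d_def N_def sum_distrib_left sum.cartesian_product case_prod_beta)
  finally show ?thesis .
qed

end

section \<open>Comparison with the explicit formula\<close>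

lemma qpoch_add: "qpoch x q (i + j) = qpoch x q i * qpoch (x * q ^ i) q j"
proof -
  have "qpoch x q (i + j) = (\<Prod>r<i. 1 - x * q ^ r) * (\<Prod>r\<in>{i..<i + j}. 1 - x * q ^ r)"
    unfolding qpoch_def using prod.atLeastLessThan_concat[of 0 i "i + j" "\<lambda>r. 1 - x * q ^ r"]
    by (simp add: atLeast0LessThan)
  also have "(\<Prod>r\<in>{i..<i + j}. 1 - x * q ^ r) = qpoch (x * q ^ i) q j"
    using prod.shift_bounds_nat_ivl[of "\<lambda>r. 1 - x * q ^ r" 0 i j]
    by (simp add: qpoch_def atLeast0LessThan power_add mult_ac add.commute)
  finally show ?thesis by (simp add: qpoch_def)
qed

lemma qpoch_quot_shift: "j \<le> m \<Longrightarrow> qpoch_quot a q m j = qpoch (a * q ^ j) q (m - j)"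
  unfolding qpoch_quot_def qpoch_def
  using prod.shift_bounds_nat_ivl[of "\<lambda>r. 1 - a * q ^ r" 0 j "m - j"]
  by (simp add: atLeast0LessThan power_add mult_ac)

definition tri :: "nat \<Rightarrow> nat" where "tri k = k * (k - 1) div 2"

lemma tri_double: "2 * tri k + k = k * k"
proof -
  have "2 * tri k = k * (k - 1)" unfolding tri_def by (cases k) auto
  then show ?thesis by (cases k) auto
qed

lemma tri_Suc: "tri (Suc k) = tri k + k"
  using tri_double[of k] tri_double[of "Suc k"] by simp

lemma tri_add: "tri (n + k) = tri n + tri k + n * k"
  by (induction k) (auto simp: tri_Suc tri_def[of 0])

lemma qpoch_reverse:
  assumes "q \<noteq> 0" "c \<noteq> 0" "k \<le> m"
  shows "qpoch (1 / (c * q ^ m)) q k = (- 1) ^ k * q ^ tri k / (c ^ k * q ^ (m * k)) * qpoch (c * q ^ (Suc m - k)) q k"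
  using assms(3)
proof (induction k)
  case 0
  then show ?case by (simp add: qpoch_def tri_def)
next
  case (Suc k)
  have e: "Suc (m - Suc k) = m - k" "Suc m - Suc k = m - k" using Suc by auto
  have 1: "qpoch (c * q ^ (m - k)) q (Suc k) = (1 - c * q ^ (m - k)) * qpoch (c * q ^ (Suc m - k)) q k"
    using Suc by (simp add: qpoch_shift Suc_diff_le mult_ac)
  have 2: "1 - 1 / (c * q ^ m) * q ^ k = - (q ^ k / (c * q ^ m)) * (1 - c * q ^ (m - k))"
  proof -
    have "q ^ m = q ^ (m - k) * q ^ k" using Suc by (simp flip: power_add)
    then show ?thesis using assms by (simp add: field_simps)
  qed
  have "qpoch (1 / (c * q ^ m)) q (Suc k) = qpoch (1 / (c * q ^ m)) q k * (1 - 1 / (c * q ^ m) * q ^ k)"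
    by (simp add: qpoch_def)
  also have "\<dots> = (- 1) ^ Suc k * q ^ tri (Suc k) / (c ^ Suc k * q ^ (m * Suc k)) * qpoch (c * q ^ (m - k)) q (Suc k)"
    unfolding 1 2 tri_Suc using Suc by (simp add: power_add mult_ac)
  finally show ?case unfolding e .
qed

lemma powi_neg_nat: "q powi (- int n) = 1 / (q :: complex) ^ n"
  by (simp add: power_int_minus inverse_eq_divide)

lemma powi_diff_nat: "q \<noteq> 0 \<Longrightarrow> q powi (int n - int m) = q ^ n / (q :: complex) ^ m"
  by (simp add: power_int_diff)

context q_and_t
begin

lemma facs_qpoch:
  assumes "\<And>i. linfac al i u = (1 - X * q ^ i) * (1 - Y * q ^ i)" "i \<le> j"
  shows "facs al i j u = qpoch (X * q ^ i) q (j - i) * qpoch (Y * q ^ i) q (j - i)"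
  using qpoch_quot_shift[OF assms(2), of X q] qpoch_quot_shift[OF assms(2), of Y q]
  by (simp add: facs_def assms(1) prod.distrib qpoch_quot_def)

text \<open>The convolution coefficients of \<open>interp\<close> are, up to the constant \<open>qV n\<close>, the coefficients of the
  terminating series in the statement; the factors with negative powers of \<open>q\<close> are reversed.\<close>

lemma qV_binomial:
  assumes "j \<le> n"
  shows "qpoch (1 / q ^ n) q j * qpoch t q j / (qpoch q q j * qpoch (q / q ^ n * inverse t) q j) * q ^ j =
    qV j * qV (n - j) * t ^ j / qV n"
  using assms
proof (induction j)
  case 0
  then show ?case using qV_nz by simp
next
  case (Suc j)
  define m where "m = n - Suc j"
  have nj: "n - j = Suc m" "n = Suc m + j" using Suc by (auto simp: m_def)
  define z where "z = q ^ m"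
  have z: "z \<noteq> 0" "1 - t * z \<noteq> 0" "1 - q * z \<noteq> 0" "1 - q * q ^ j \<noteq> 0" "1 - t * q ^ j \<noteq> 0"
    using q_nz one_minus_t_q one_minus_q_q by (auto simp: z_def)
  have qn: "q ^ n = q * z * q ^ j" by (simp add: nj z_def power_add)
  have s1: "qpoch (1 / q ^ n) q (Suc j) = qpoch (1 / q ^ n) q j * (1 - 1 / (q * z))"
    using q_nz z by (simp add: qpoch_Suc qn)
  have s2: "qpoch (q / q ^ n * inverse t) q (Suc j) = qpoch (q / q ^ n * inverse t) q j * (1 - 1 / (t * z))"
    using q_nz t_nz z by (simp add: qpoch_Suc qn divide_simps)
  have V1: "qV (Suc j) = (1 - t * q ^ j) / (1 - q * q ^ j) * qV j"
    using qV_Suc[of j] z by (simp add: field_simps)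
  have V2: "qV m = (1 - q * z) / (1 - t * z) * qV (Suc m)"
    using qV_Suc[of m] z by (simp add: z_def field_simps)
  have "qpoch (1 / q ^ n) q (Suc j) * qpoch t q (Suc j) / (qpoch q q (Suc j) * qpoch (q / q ^ n * inverse t) q (Suc j)) * q ^ Suc j
     = (qpoch (1 / q ^ n) q j * qpoch t q j / (qpoch q q j * qpoch (q / q ^ n * inverse t) q j) * q ^ j)
        * (q * (1 - 1 / (q * z)) * (1 - t * q ^ j) / ((1 - q * q ^ j) * (1 - 1 / (t * z))))"
    unfolding s1 s2 by (simp add: qpoch_Suc mult_ac)
  also have "\<dots> = (qV j * qV (Suc m) * t ^ j / qV n) * (t * (1 - q * z) / (1 - t * z) * ((1 - t * q ^ j) / (1 - q * q ^ j)))"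
  proof -
    have "q * (1 - 1 / (q * z)) / (1 - 1 / (t * z)) = t * (1 - q * z) / (1 - t * z)"
    proof -
      have "1 - 1 / (q * z) = - (1 - q * z) / (q * z)" "1 - 1 / (t * z) = - (1 - t * z) / (t * z)"
        using q_nz t_nz z by (simp_all add: divide_simps)
      then show ?thesis using q_nz t_nz z by (simp add: divide_simps) algebra
    qed
    then have *: "q * (1 - 1 / (q * z)) * (1 - t * q ^ j) / ((1 - q * q ^ j) * (1 - 1 / (t * z)))
      = t * (1 - q * z) / (1 - t * z) * ((1 - t * q ^ j) / (1 - q * q ^ j))"
      by (metis (no_types, opaque_lifting) mult.commute times_divide_times_eq)
    show ?thesis using Suc by (simp only: * nj(1))
  qed
  also have "\<dots> = qV (Suc j) * qV (n - Suc j) * t ^ Suc j / qV n"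
    unfolding m_def[symmetric] V1 V2 by (simp add: mult_ac)
  finally show ?case .
qed

end

context koornwinder_product
begin

lemma Npoly_Npol:
  assumes "k2 \<le> k1" "x \<noteq> 0" "y \<noteq> 0" and a1: "a 1 = b1"
  shows "Npoly q t a k1 k2 x y = 1 / (q ^ tri k1 * q ^ tri k2 * ((- t) ^ (k1 - k2) * b1 ^ (k1 + k2))) * (Npol k1 k2 x y / qV (k1 - k2))"
proof -
  define n where "n = k1 - k2"
  have k1: "k1 = k2 + n" using assms by (simp add: n_def)
  have lx: "linfac (b1\<^sup>2) i (b1 * csum x) = (1 - b1 * x * q ^ i) * (1 - b1 * inverse x * q ^ i)" for i
    using linfac_csum[OF assms(2), of i] by (simp add: field_simps)
  have ly: "linfac (b1\<^sup>2) i (b1 * csum y) = (1 - b1 * y * q ^ i) * (1 - b1 * inverse y * q ^ i)" for i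
    using linfac_csum[OF assms(3), of i] by (simp add: field_simps)
  have lt: "linfac (t\<^sup>2 * b1\<^sup>2) i (t * (b1 * csum x)) = (1 - t * b1 * x * q ^ i) * (1 - t * b1 * inverse x * q ^ i)" for i
    using linfac_t_csum[OF assms(2), of i] by (simp add: field_simps)
  have pw: "q powi (1 - int k1 + int k2) = q / q ^ n" "q powi (- int n) = 1 / q ^ n"
    using q_nz by (simp_all add: k1 power_int_diff power_int_minus inverse_eq_divide)
  have "Npol k1 k2 x y / qV n = qpoch (b1 * x) q k2 * qpoch (b1 * inverse x) q k2 *
     (\<Sum>j\<le>n. (qV j * qV (n - j) * t ^ j / qV n) * facs (t\<^sup>2 * b1\<^sup>2) (k2 + j) k1 (t * (b1 * csum x)) * facs (b1\<^sup>2) 0 (k2 + j) (b1 * csum y))"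
    unfolding Npol_def interp_expand[OF assms(1)] facs_qpoch[OF lx le0] n_def[symmetric]
    by (simp add: sum_divide_distrib sum_distrib_left mult_ac)
  also have "\<dots> = qpoch (b1 * x) q k2 * qpoch (b1 * inverse x) q k2 *
     (\<Sum>j\<le>n. (qV j * qV (n - j) * t ^ j / qV n) *
        (qpoch_quot (q ^ k2 * t * b1 * x) q n j * qpoch_quot (q ^ k2 * t * b1 * inverse x) q n j) *
        (qpoch (b1 * y) q k2 * qpoch (q ^ k2 * b1 * y) q j * (qpoch (b1 * inverse y) q k2 * qpoch (q ^ k2 * b1 * inverse y) q j)))"
  proof (intro arg_cong2[where f = "(*)"] refl sum.cong)
    fix j assume "j \<in> {..n}"
    then have j: "j \<le> n" "k2 + j \<le> k1" "k1 - (k2 + j) = n - j" by (auto simp: k1)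
    show "facs (t\<^sup>2 * b1\<^sup>2) (k2 + j) k1 (t * (b1 * csum x)) = qpoch_quot (q ^ k2 * t * b1 * x) q n j * qpoch_quot (q ^ k2 * t * b1 * inverse x) q n j"
      unfolding facs_qpoch[OF lt j(2)] qpoch_quot_shift[OF j(1)] j(3) by (simp add: power_add mult_ac)
    show "facs (b1\<^sup>2) 0 (k2 + j) (b1 * csum y) = qpoch (b1 * y) q k2 * qpoch (q ^ k2 * b1 * y) q j * (qpoch (b1 * inverse y) q k2 * qpoch (q ^ k2 * b1 * inverse y) q j)"
      unfolding facs_qpoch[OF ly le0] by (simp add: qpoch_add mult_ac)
  qed
  also have "\<dots> = qpochs [b1 * x, b1 * inverse x, b1 * y, b1 * inverse y] q k2 *
     (\<Sum>j\<le>n. (qV j * qV (n - j) * t ^ j / qV n) *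
        (qpoch_quot (q ^ k2 * t * b1 * x) q n j * qpoch_quot (q ^ k2 * t * b1 * inverse x) q n j) *
        (qpoch (q ^ k2 * b1 * y) q j * qpoch (q ^ k2 * b1 * inverse y) q j))"
    by (simp add: qpochs_def sum_distrib_left mult_ac)
  also have "(\<Sum>j\<le>n. (qV j * qV (n - j) * t ^ j / qV n) *
        (qpoch_quot (q ^ k2 * t * b1 * x) q n j * qpoch_quot (q ^ k2 * t * b1 * inverse x) q n j) *
        (qpoch (q ^ k2 * b1 * y) q j * qpoch (q ^ k2 * b1 * inverse y) q j)) =
     (\<Sum>j\<le>n.
        qpochs [q powi (- int n), t, q ^ k2 * b1 * y, q ^ k2 * b1 * inverse y] q j /
        qpochs [q, q powi (1 - int k1 + int k2) * inverse t] q j * q ^ j *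
        qpoch_quot (q ^ k2 * t * b1 * x) q n j *
        qpoch_quot (q ^ k2 * t * b1 * inverse x) q n j)" (is "_ = ?S")
    by (intro sum.cong refl) (simp add: qV_binomial[symmetric] qpochs_def pw)
  finally have main: "Npol k1 k2 x y / qV n = qpochs [b1 * x, b1 * inverse x, b1 * y, b1 * inverse y] q k2 * ?S" .
  have "q powi (- int (k1 * (k1 - 1) div 2) - int (k2 * (k2 - 1) div 2)) = 1 / (q ^ tri k1 * q ^ tri k2)"
    unfolding tri_def using q_nz by (simp add: power_int_diff power_int_minus inverse_eq_divide)
  then show ?thesis
    unfolding n_def[symmetric] unfolding main unfolding Npoly_def a1 n_def[symmetric] by (simp add: mult.assoc)
qed

lemma one_minus_A: "0 < m \<Longrightarrow> 1 - q ^ m * A * q ^ i \<noteq> 0"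
  and one_minus_tA: "0 < m \<Longrightarrow> 1 - q ^ m * (t * A) * q ^ i \<noteq> 0"
  and one_minus_t2A: "0 < m \<Longrightarrow> 1 - q ^ m * (t\<^sup>2 * A) * q ^ i \<noteq> 0"
proof -
  have *: "1 - q ^ m * (t ^ r * A) * q ^ i \<noteq> 0" if "0 < m" for r
  proof -
    obtain m' where m: "m = Suc m'" using \<open>0 < m\<close> gr0_conv_Suc by blast
    have B: "q * A = b1 * b2 * b3 * b4" using q_nz by (simp add: A_def)
    have e: "q ^ m * (t ^ r * A) * q ^ i = b1 * b2 * b3 * b4 * (t ^ r * q ^ (m' + i))"
      unfolding B[symmetric] m power_add power_Suc by (simp only: ac_simps)
    have "norm (t ^ r) \<le> 1" using t_less by (simp add: norm_power power_le_one)
    then have n: "norm (t ^ r * q ^ (m' + i)) \<le> 1"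
      unfolding norm_mult using norm_q_power[of "m' + i"] by (intro mult_le_one) auto
    show ?thesis unfolding e by (rule one_minus_nz[OF norm_mult_less_1[OF norm_b n]])
  qed
  show "0 < m \<Longrightarrow> 1 - q ^ m * A * q ^ i \<noteq> 0" using *[of 0] by simp
  show "0 < m \<Longrightarrow> 1 - q ^ m * (t * A) * q ^ i \<noteq> 0" using *[of 1] by simp
  show "0 < m \<Longrightarrow> 1 - q ^ m * (t\<^sup>2 * A) * q ^ i \<noteq> 0" using *[of 2] by simp
qed

text \<open>The denominators of the two quotients in front of the series in \<open>Qcoeff\<close>.\<close>

definition Qden :: "nat \<Rightarrow> nat \<Rightarrow> complex" where
  "Qden k1 k2 = qpochs [q ^ k1 * t * A, q powi (- int k1) * inverse t, q ^ k2 * A, q powi (- int k2)] q k2 *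
     qpochs [q ^ (k1 + k2) * t\<^sup>2 * A, q powi (int k2 - int k1)] q (k1 - k2)"

lemma Qcoeff_dual:
  assumes k: "k2 \<le> k1" "k1 \<le> m1" "k2 \<le> m2" and A: "Apar q a = A"
  shows "Qcoeff q t a m1 m2 k1 k2 = dual k1 k2 m1 m2 / (qV (k1 - k2) * Qden k1 k2)"
proof -
  define n where "n = k1 - k2"
  have k1: "k1 = k2 + n" using assms by (simp add: n_def)
  define E F B C where "E = q ^ (m1 + k2) * t\<^sup>2 * A" "F = q powi (int k2 - int m1)"
    "B = q ^ (m2 + k2) * A" "C = q powi (int k2 - int m2)"
  note defs = this
  have lyu: "linfac A i (yu m1) = (1 - q ^ m1 * t * A * q ^ i) * (1 - q powi (- int m1) * inverse t * q ^ i)" for i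
    using q_nz t_nz by (simp add: linfac_def yu_def powi_neg_nat field_simps power2_eq_square)
  have ltyu: "linfac (t\<^sup>2 * A) i (t * yu m1) = (1 - q ^ m1 * (t\<^sup>2 * A) * q ^ i) * (1 - q powi (- int m1) * q ^ i)" for i
    using q_nz t_nz by (simp add: linfac_def yu_def powi_neg_nat field_simps power2_eq_square)
  have lyv: "linfac A i (yv m2) = (1 - q ^ m2 * A * q ^ i) * (1 - q powi (- int m2) * q ^ i)" for i
    using q_nz by (simp add: linfac_def yv_def powi_neg_nat field_simps power2_eq_square)
  have EF: "qpoch E q j \<noteq> 0 \<and> qpoch F q j \<noteq> 0" if "j \<le> n" for j
  proof (cases "n = 0")
    case False
    then have m1: "0 < m1" "k2 + n \<le> m1" using k by (auto simp: k1)
    have "1 - E * q ^ i \<noteq> 0" for i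
      using one_minus_t2A[of "m1 + k2" i] m1 by (simp add: defs mult.assoc)
    moreover have "1 - F * q ^ i \<noteq> 0" if "i < n" for i
    proof -
      have "q ^ m1 = q ^ k2 * q ^ i * (q * q ^ (m1 - k2 - i - 1))"
        using that m1 by (simp flip: power_add power_Suc)
      then have "F * q ^ i * (q * q ^ (m1 - k2 - i - 1)) = 1"
        using q_nz by (simp add: defs powi_diff_nat)
      then show ?thesis using one_minus_q_q[of "m1 - k2 - i - 1"] by auto
    qed
    ultimately show ?thesis using that by (auto simp: qpoch_def)
  qed (use that in simp)
  have f1: "facs A 0 k2 (yu m1) = qpoch (q ^ m1 * t * A) q k2 * qpoch (q powi (- int m1) * inverse t) q k2"
    unfolding facs_qpoch[OF lyu le0] by simp
  have f2: "facs A 0 (k2 + j) (yv m2) = qpoch (q ^ m2 * A) q k2 * qpoch (q powi (- int m2)) q k2 * (qpoch B q j * qpoch C q j)" for j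
    unfolding facs_qpoch[OF lyv le0] using q_nz
    by (simp add: qpoch_add defs power_add powi_diff_nat powi_neg_nat mult_ac)
  have f3: "facs (t\<^sup>2 * A) (k2 + j) k1 (t * yu m1) = qpoch E q n * qpoch F q n / (qpoch E q j * qpoch F q j)" if "j \<le> n" for j
  proof -
    have j: "k2 + j \<le> k1" "k1 - (k2 + j) = n - j" using that by (auto simp: k1)
    have 1: "qpoch E q n = qpoch E q j * qpoch (E * q ^ j) q (n - j)" "qpoch F q n = qpoch F q j * qpoch (F * q ^ j) q (n - j)"
      using qpoch_add[of _ q j "n - j"] that by simp_all
    have 2: "q ^ m1 * (t\<^sup>2 * A) * q ^ (k2 + j) = E * q ^ j" "q powi (- int m1) * q ^ (k2 + j) = F * q ^ j"
      using q_nz by (simp_all add: defs power_add powi_diff_nat powi_neg_nat)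
    show ?thesis unfolding facs_qpoch[OF ltyu j(1)] j(2) 1 2 using EF[OF that] by simp
  qed
  have pw: "q powi (1 - int k1 + int k2) = q / q ^ n" "q powi (- int n) = 1 / q ^ n"
    using q_nz by (simp_all add: k1 power_int_diff power_int_minus inverse_eq_divide)
  have "dual k1 k2 m1 m2 = facs A 0 k2 (yu m1) * (\<Sum>j\<le>n. qV j * qV (n - j) * t ^ j *
     (qpoch E q n * qpoch F q n / (qpoch E q j * qpoch F q j)) * (qpoch (q ^ m2 * A) q k2 * qpoch (q powi (- int m2)) q k2 * (qpoch B q j * qpoch C q j)))"
    unfolding dual_def interp_expand[OF k(1)] n_def[symmetric] f2 by (simp add: f3)
  also have "\<dots> = qpochs [q ^ m1 * t * A, q powi (- int m1) * inverse t, q ^ m2 * A, q powi (- int m2)] q k2 *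
      qpochs [E, F] q n * (\<Sum>j\<le>n. qV n * ((qV j * qV (n - j) * t ^ j / qV n) * (qpoch B q j * qpoch C q j) / (qpoch E q j * qpoch F q j)))"
    unfolding f1 using qV_nz[of n] by (simp add: qpochs_def sum_distrib_left mult_ac)
  also have "(\<Sum>j\<le>n. qV n * ((qV j * qV (n - j) * t ^ j / qV n) * (qpoch B q j * qpoch C q j) / (qpoch E q j * qpoch F q j)))
      = qV n * phi43 q n t B C (q powi (1 - int k1 + int k2) * inverse t) E F"
    unfolding phi43_def sum_distrib_left
    by (intro sum.cong refl arg_cong2[where f = "(*)"], subst qV_binomial[symmetric]) (auto simp: qpochs_def pw mult_ac)
  finally have "dual k1 k2 m1 m2 / (qV n * Qden k1 k2) = qpochs [q ^ m1 * t * A, q powi (- int m1) * inverse t, q ^ m2 * A, q powi (- int m2)] q k2 *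
      qpochs [E, F] q n * phi43 q n t B C (q powi (1 - int k1 + int k2) * inverse t) E F / Qden k1 k2"
    using qV_nz[of n] by (simp add: divide_simps)
  then show ?thesis
    unfolding Qcoeff_def Let_def A Qden_def n_def[symmetric] defs[symmetric] by (simp add: mult_ac)
qed

text \<open>The combination of these factors is what makes the weight equal to the constant that appears when
  \<open>Q N / E\<close> is written in terms of \<open>dual\<close> and \<open>Npol\<close>.\<close>

lemma Evalue_Qden:
  assumes k: "k2 \<le> k1" and A: "Apar q a = A" and a: "a 1 = b1" "a 2 = b2" "a 3 = b3" "a 4 = b4"
  shows "Evalue q t a k1 k2 \<noteq> 0"
    and "wt k1 k2 = 1 / (q ^ tri k1 * q ^ tri k2 * ((- t) ^ (k1 - k2) * b1 ^ (k1 + k2))) /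
       (qV (k1 - k2) * qV (k1 - k2) * Qden k1 k2 * Evalue q t a k1 k2)"
proof -
  define n where "n = k1 - k2"
  have k1: "k1 = n + k2" using assms by (simp add: n_def)
  define Z1 Z2 Z3 where "Z1 = qpoch (q ^ (k1 + k2) * t\<^sup>2 * A) q n" "Z2 = qpoch (q ^ k1 * t * A) q k2" "Z3 = qpoch (q ^ k2 * A) q k2"
  note Z = this
  have "Z1 \<noteq> 0"
  proof (cases "n = 0")
    case False
    then show ?thesis using one_minus_t2A[of "k1 + k2"] by (simp add: Z qpoch_def k1 mult.assoc)
  qed (simp add: Z)
  moreover have "Z2 \<noteq> 0" "Z3 \<noteq> 0"
  proof -
    show "Z2 \<noteq> 0"
    proof (cases "k2 = 0")
      case False
      then show ?thesis using one_minus_tA[of k1] k by (simp add: Z qpoch_def mult.assoc)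
    qed (simp add: Z)
    show "Z3 \<noteq> 0"
    proof (cases "k2 = 0")
      case False
      then show ?thesis using one_minus_A[of k2] by (simp add: Z qpoch_def mult.assoc)
    qed (simp add: Z)
  qed
  ultimately have Z_nz: "Z1 \<noteq> 0" "Z2 \<noteq> 0" "Z3 \<noteq> 0" by auto
  define T Qk Qn T2 tn P where "T = qpoch (t * q ^ Suc n) q k2" "Qk = qpoch q q k2" "Qn = qpoch q q n"
    "T2 = qpoch (t\<^sup>2) q n" "tn = qpoch t q n" "P = pairs k1 k2"
  note defs = this
  have nz: "T \<noteq> 0" "Qk \<noteq> 0" "Qn \<noteq> 0" "T2 \<noteq> 0" "tn \<noteq> 0" "P \<noteq> 0"
    unfolding defs using qpoch_t_power_nz[of "Suc n"] qpoch_q_nz qpoch_t2_nz qpoch_t_nz pairs_nz by auto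
  have quots: "qpoch_quot (t\<^sup>2 * A) q (2 * k1) (k1 + k2) = Z1" "qpoch_quot (t * A) q (k1 + k2) k1 = Z2"
    "qpoch_quot A q (2 * k2) k2 = Z3"
    using k by (simp_all add: qpoch_quot_shift Z k1 mult_ac)
  have E: "Evalue q t a k1 k2 = 1 / (t ^ k1 * b1 ^ (k1 + k2)) * (1 / (Z1 * Z2 * Z3)) * P * (T2 / tn)"
  proof -
    have "b1 powi (- int k1 - int k2) = 1 / b1 ^ (k1 + k2)"
      using powi_neg_nat[of b1 "k1 + k2"] by simp
    then show ?thesis
      unfolding Evalue_def Let_def A a quots n_def[symmetric]
      by (simp add: powi_neg_nat qpochs_def defs pairs_def mult_ac)
  qed
  show "Evalue q t a k1 k2 \<noteq> 0" unfolding E using nz Z_nz t_nz a_nz by simp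
  have r1: "qpoch (q powi (- int k1) * inverse t) q k2 = (- 1) ^ k2 * q ^ tri k2 / (t ^ k2 * q ^ (k1 * k2)) * T"
    using qpoch_reverse[OF q_nz t_nz k] k by (simp add: powi_neg_nat defs n_def Suc_diff_le divide_inverse mult_ac)
  have r2: "qpoch (q powi (- int m)) q m = (- 1) ^ m * q ^ tri m / q ^ (m * m) * qpoch q q m" for m
    using qpoch_reverse[OF q_nz one_neq_zero order_refl, of m] by (simp add: powi_neg_nat)
  have r3: "q powi (int k2 - int k1) = q powi (- int n)" by (simp add: k1)
  have Qd: "Qden k1 k2 = Z1 * Z2 * Z3 * ((- 1) ^ k2 * q ^ tri k2 / (t ^ k2 * q ^ (k1 * k2)) * T) *
     ((- 1) ^ k2 * q ^ tri k2 / q ^ (k2 * k2) * Qk) * ((- 1) ^ n * q ^ tri n / q ^ (n * n) * Qn)"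
    unfolding Qden_def r3 n_def[symmetric] Z defs(2,3)
    by (simp only: qpochs_def list.map prod_list.Cons prod_list.Nil r1 r2 mult_1_right mult.assoc)
      (simp only: ac_simps)
  have V: "qV n = tn / Qn" by (simp add: qV_def defs)
  define x1 x2 x3 where "x1 = q ^ tri n" "x2 = q ^ tri k2" "x3 = q ^ (n * k2)"
  define y1 y2 where "y1 = q ^ n" "y2 = q ^ k2"
  have tk: "q ^ tri k1 = x1 * x2 * x3" by (simp add: k1 tri_add power_add x1_x2_x3_def)
  have nn: "q ^ (n * n) = x1 * x1 * y1" "q ^ (k2 * k2) = x2 * x2 * y2" "q ^ (k1 * k2) = x3 * (x2 * x2 * y2)"
    unfolding tri_double[of n, symmetric] k1 add_mult_distrib tri_double[of k2, symmetric]
    by (simp_all add: power_add mult_2 x1_x2_x3_def y1_y2_def)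
  have kk: "q ^ (k1 + k2) = y1 * y2 * y2" by (simp add: k1 power_add y1_y2_def)
  have xnz: "x1 \<noteq> 0" "x2 \<noteq> 0" "x3 \<noteq> 0" "y1 \<noteq> 0" "y2 \<noteq> 0" using q_nz by (simp_all add: x1_x2_x3_def y1_y2_def)
  define s where "s = (- 1 :: complex) ^ n"
  have s: "s * s = 1" "(- 1 :: complex) ^ k2 * (- 1) ^ k2 = 1" by (simp_all add: s_def flip: power_mult_distrib)
  have mt: "(- t) ^ n = s * t ^ n" unfolding s_def by (metis power_minus)
  have snz: "s \<noteq> 0" using s by auto
  have inv_s: "1 / s = s" using s snz by (simp add: divide_simps)
  have Qd': "Qden k1 k2 = Z1 * Z2 * Z3 * s * T * Qk * Qn / (x1 * x2 * x2 * x3 * y1 * y2 * y2 * t ^ k2)"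
  proof -
    have "Qden k1 k2 = ((- 1) ^ k2 * (- 1) ^ k2) * (Z1 * Z2 * Z3 * s * T * Qk * Qn) * (x2 * x2 * x1) / (t ^ k2 * (x3 * (x2 * x2 * y2)) * (x2 * x2 * y2) * (x1 * x1 * y1))"
      unfolding Qd nn by (simp add: s_def x1_x2_x3_def mult_ac)
    also have "t ^ k2 * (x3 * (x2 * x2 * y2)) * (x2 * x2 * y2) * (x1 * x1 * y1) = (x1 * x2 * x2 * x3 * y1 * y2 * y2 * t ^ k2) * (x2 * x2 * x1)"
      by (simp only: ac_simps)
    finally show ?thesis
      unfolding s using xnz by (simp only: nonzero_mult_divide_mult_cancel_right mult_1 mult_eq_0_iff simp_thms)
  qed
  define X Y where "X = x1 * x2 * x2 * x3 * y1 * y2 * y2 * t ^ k2" "Y = t ^ k1 * b1 ^ (k1 + k2)"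
  have XY: "X \<noteq> 0" "Y \<noteq> 0" using xnz t_nz a_nz by (simp_all add: X_Y_def)
  have VQE: "qV n * qV n * Qden k1 k2 * Evalue q t a k1 k2 = qV n * (s * T * Qk * P * T2) / (X * Y)"
  proof -
    define Zp where "Zp = Z1 * Z2 * Z3"
    have "Zp \<noteq> 0" using Z_nz by (simp add: Zp_def)
    then show ?thesis
      unfolding E Qd' V X_Y_def[symmetric] Zp_def[symmetric] using nz XY by simp
  qed
  have "1 / (q ^ tri k1 * q ^ tri k2 * ((- t) ^ n * b1 ^ (k1 + k2))) / (qV n * qV n * Qden k1 k2 * Evalue q t a k1 k2)
     = (X * Y) / ((x1 * x2 * x3 * x2 * t ^ n * b1 ^ (k1 + k2)) * (s * s) * (qV n * Qk * T * T2 * P))"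
    unfolding VQE tk mt x1_x2_x3_def(2)[symmetric] by (simp add: mult_ac)
  also have "X * Y = (x1 * x2 * x3 * x2 * t ^ n * b1 ^ (k1 + k2)) * (y1 * y2 * y2 * t ^ (2 * k2))"
  proof -
    have tt: "t ^ (2 * k2) = t ^ k2 * t ^ k2" by (simp only: mult_2 power_add)
    show ?thesis unfolding X_Y_def tt by (simp add: k1 power_add mult_ac)
  qed
  also have "\<dots> / ((x1 * x2 * x3 * x2 * t ^ n * b1 ^ (k1 + k2)) * (s * s) * (qV n * Qk * T * T2 * P)) =
     y1 * y2 * y2 * t ^ (2 * k2) / (qV n * Qk * T * T2 * P) * (1 / (s * s))"
  proof -
    have *: "(c * u) / (c * w * v) = u / v * (1 / w)" if "c \<noteq> 0" for c u v w :: complex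
      using that by simp
    show ?thesis by (rule *) (use xnz t_nz a_nz in simp)
  qed
  also have "\<dots> = wt k1 k2"
    unfolding s(1) wt_def wt_core_def n_def[symmetric] kk by (simp add: defs mult_ac)
  finally show "wt k1 k2 = 1 / (q ^ tri k1 * q ^ tri k2 * ((- t) ^ (k1 - k2) * b1 ^ (k1 + k2))) /
       (qV (k1 - k2) * qV (k1 - k2) * Qden k1 k2 * Evalue q t a k1 k2)" by (simp add: n_def)
qed

theorem binomial_summand:
  assumes k: "k2 \<le> k1" "k1 \<le> m1" "k2 \<le> m2" and A: "Apar q a = A" and a: "a 1 = b1" "a 2 = b2" "a 3 = b3" "a 4 = b4"
    and xy: "x \<noteq> 0" "y \<noteq> 0"
  shows "Qcoeff q t a m1 m2 k1 k2 * (Npoly q t a k1 k2 x y / Evalue q t a k1 k2) = wt k1 k2 * dual k1 k2 m1 m2 * Npol k1 k2 x y"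
  unfolding Qcoeff_dual[OF k A] Npoly_Npol[of k2 k1 x y a, OF k(1) xy a(1)] Evalue_Qden(2)[OF k(1) A a]
  by (simp add: mult_ac)

theorem binomial_formula:
  assumes m: "m2 \<le> m1" and A: "Apar q a = A" and a: "a 1 = b1" "a 2 = b2" "a 3 = b3" "a 4 = b4"
    and xy: "x \<noteq> 0" "y \<noteq> 0"
  shows "(\<Sum>k2 = 0..m2. \<Sum>k1 = k2..m1. Qcoeff q t a m1 m2 k1 k2 * (Npoly q t a k1 k2 x y / Evalue q t a k1 k2)) = binom_sum m1 m2 x y"
proof -
  have "(\<Sum>k2 = 0..m2. \<Sum>k1 = k2..m1. Qcoeff q t a m1 m2 k1 k2 * (Npoly q t a k1 k2 x y / Evalue q t a k1 k2))
     = (\<Sum>k2\<le>m2. \<Sum>k1 = k2..m1. wt k1 k2 * dual k1 k2 m1 m2 * Npol k1 k2 x y)"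
    using binomial_summand[OF _ _ _ A a xy] by (intro sum.cong) (auto simp: atLeast0AtMost)
  also have "\<dots> = (\<Sum>k2\<le>m2. \<Sum>k1\<le>m1. wt k1 k2 * dual k1 k2 m1 m2 * Npol k1 k2 x y)"
    by (intro sum.cong refl sum.mono_neutral_left) (auto simp: Npol_eq_0)
  also have "\<dots> = binom_sum m1 m2 x y"
    unfolding binom_sum_def sum.cartesian_product[symmetric] by (rule sum.swap)
  finally show ?thesis .
qed

end

section \<open>Infinite products and means over the torus\<close>

lemma qpoch_inf_LIMSEQ:
  assumes "norm q < 1"
  shows "(\<lambda>n. qpoch x q n) \<longlonglongrightarrow> qpoch_inf x q"
proof -
  have "summable (\<lambda>i. norm (1 - x * q ^ i - 1))"
    using assms by (auto simp: norm_mult norm_power intro!: summable_mult summable_geometric)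
  then have "convergent_prod (\<lambda>i. 1 - x * q ^ i)"
    by (intro abs_convergent_prod_imp_convergent_prod summable_imp_abs_convergent_prod)
  then have "(\<lambda>n. \<Prod>i\<le>n. 1 - x * q ^ i) \<longlonglongrightarrow> qpoch_inf x q"
    unfolding qpoch_inf_def by (rule convergent_prod_LIMSEQ)
  then have "(\<lambda>n. qpoch x q (Suc n)) \<longlonglongrightarrow> qpoch_inf x q"
    by (simp add: qpoch_def lessThan_Suc_atMost)
  then show ?thesis by (rule LIMSEQ_imp_Suc)
qed

lemma qpoch_inf_rec:
  assumes "norm q < 1"
  shows "qpoch_inf x q = (1 - x) * qpoch_inf (x * q) q"
proof -
  have "(\<lambda>n. qpoch x q (Suc n)) \<longlonglongrightarrow> qpoch_inf x q"
    using qpoch_inf_LIMSEQ[OF assms] by (rule LIMSEQ_Suc)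
  moreover have "qpoch x q (Suc n) = (1 - x) * qpoch (x * q) q n" for n
    unfolding qpoch_def by (subst prod.lessThan_Suc_shift) (simp add: mult_ac)
  moreover have "(\<lambda>n. (1 - x) * qpoch (x * q) q n) \<longlonglongrightarrow> (1 - x) * qpoch_inf (x * q) q"
    by (intro tendsto_intros qpoch_inf_LIMSEQ assms)
  ultimately show ?thesis by (simp add: LIMSEQ_unique)
qed

lemma qpoch_inf_nonzero:
  assumes "norm q < 1" "norm x < 1"
  shows "qpoch_inf x q \<noteq> 0"
proof -
  have "summable (\<lambda>i. norm (1 - x * q ^ i - 1))"
    using assms by (auto simp: norm_mult norm_power intro!: summable_mult summable_geometric)
  then have "convergent_prod (\<lambda>i. 1 - x * q ^ i)"
    by (intro abs_convergent_prod_imp_convergent_prod summable_imp_abs_convergent_prod)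
  moreover have "1 - x * q ^ i \<noteq> 0" for i
  proof
    assume "1 - x * q ^ i = 0"
    then have "norm (x * q ^ i) = 1" by (metis eq_iff_diff_eq_0 norm_one)
    moreover have "norm (x * q ^ i) \<le> norm x * 1"
      unfolding norm_mult using assms by (intro mult_left_mono) (auto simp: norm_power power_le_one)
    ultimately show False using assms by simp
  qed
  ultimately show ?thesis unfolding qpoch_inf_def by (rule prodinf_nonzero)
qed

lemma qpoch_inf_cnj:
  assumes "norm q < 1" "cnj q = q"
  shows "cnj (qpoch_inf x q) = qpoch_inf (cnj x) q"
proof -
  have "(\<lambda>n. cnj (qpoch x q n)) \<longlonglongrightarrow> cnj (qpoch_inf x q)"
    by (intro tendsto_cnj qpoch_inf_LIMSEQ assms)
  moreover have "cnj (qpoch x q n) = qpoch (cnj x) q n" for n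
    by (simp add: qpoch_def assms)
  ultimately show ?thesis
    using qpoch_inf_LIMSEQ[OF assms(1), of "cnj x"] by (simp add: LIMSEQ_unique)
qed

text \<open>The finite products converge uniformly on small discs because \<open>\<Sum> |q|\<^sup>i\<close> does.\<close>

lemma qpoch_inf_holomorphic:
  assumes "norm q < 1"
  shows "(\<lambda>x. qpoch_inf x q) holomorphic_on UNIV"
proof (rule holomorphic_uniform_sequence[OF open_UNIV])
  fix n show "(\<lambda>x. qpoch x q n) holomorphic_on UNIV"
    unfolding qpoch_def by (intro holomorphic_intros)
next
  fix z :: complex
  have "uniform_limit (cball z 1) (\<lambda>n x. \<Sum>i<n. norm (- x * q ^ i)) (\<lambda>x. \<Sum>i. norm (- x * q ^ i)) sequentially"
  proof (rule Weierstrass_m_test)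
    show "norm (norm (- x * q ^ i)) \<le> (norm z + 1) * norm q ^ i" if "x \<in> cball z 1" for i x
    proof -
      have "norm x \<le> norm z + norm (x - z)" by (metis add.commute diff_add_cancel norm_triangle_ineq)
      also have "norm (x - z) \<le> 1" using that by (simp add: dist_norm norm_minus_commute)
      finally show ?thesis by (simp add: norm_mult norm_power mult_right_mono)
    qed
    show "summable (\<lambda>i. (norm z + 1) * norm q ^ i)"
      using assms by (intro summable_mult summable_geometric) auto
  qed
  then have "uniformly_convergent_on (cball z 1) (\<lambda>n x. \<Sum>i<n. norm (- x * q ^ i))"
    by (rule uniformly_convergentI)
  then have "uniformly_convergent_on (cball z 1) (\<lambda>n x. \<Prod>i<n. 1 + (- x * q ^ i))"
    by (intro uniformly_convergent_on_prod continuous_intros) auto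
  then have "uniformly_convergent_on (cball z 1) (\<lambda>n x. qpoch x q n)"
    by (simp add: qpoch_def)
  then obtain l where l: "uniform_limit (cball z 1) (\<lambda>n x. qpoch x q n) l sequentially"
    by (auto simp: uniformly_convergent_on_def)
  have "l x = qpoch_inf x q" if "x \<in> cball z 1" for x
    using tendsto_uniform_limitI[OF l that] qpoch_inf_LIMSEQ[OF assms, of x] by (rule LIMSEQ_unique)
  then have "uniform_limit (cball z 1) (\<lambda>n x. qpoch x q n) l sequentially \<longleftrightarrow>
      uniform_limit (cball z 1) (\<lambda>n x. qpoch x q n) (\<lambda>x. qpoch_inf x q) sequentially"
    by (intro uniform_limit_cong') auto
  with l have "uniform_limit (cball z 1) (\<lambda>n x. qpoch x q n) (\<lambda>x. qpoch_inf x q) sequentially"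
    by blast
  then show "\<exists>d. 0 < d \<and> cball z d \<subseteq> UNIV \<and> uniform_limit (cball z d) (\<lambda>n x. qpoch x q n) (\<lambda>x. qpoch_inf x q) sequentially"
    by (intro exI[of _ 1]) auto
qed

lemma holomorphic_on_qpoch_inf [holomorphic_intros]:
  assumes "norm q < 1" "f holomorphic_on S"
  shows "(\<lambda>x. qpoch_inf (f x) q) holomorphic_on S"
  using holomorphic_on_compose[OF assms(2) holomorphic_on_subset[OF qpoch_inf_holomorphic[OF assms(1)]]]
  by (simp add: o_def)

lemma continuous_on_qpoch_inf [continuous_intros]:
  assumes "norm q < 1" "continuous_on S f"
  shows "continuous_on S (\<lambda>x. qpoch_inf (f x) q)"
  using continuous_on_compose2[OF holomorphic_on_imp_continuous_on[OF qpoch_inf_holomorphic[OF assms(1)]] assms(2)]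
  by simp

section \<open>Averages over circles and over the torus\<close>

definition ep :: "real \<Rightarrow> complex" where "ep s = exp (2 * of_real pi * \<i> * of_real s)"

lemma norm_ep [simp]: "norm (ep s) = 1"
  by (simp add: ep_def norm_exp_eq_Re)

lemma ep_nz [simp]: "ep s \<noteq> 0"
  by (simp add: ep_def)

lemma ep_reflect: "ep (1 - s) = 1 / ep s"
proof -
  have "ep (1 - s) = exp (2 * of_real pi * \<i>) * exp (- (2 * of_real pi * \<i> * of_real s))"
    unfolding ep_def exp_add[symmetric] by (simp add: algebra_simps)
  then show ?thesis by (simp add: ep_def exp_minus inverse_eq_divide)
qed

lemma continuous_on_ep [continuous_intros]: "continuous_on S f \<Longrightarrow> continuous_on S (\<lambda>x. ep (f x))"
  unfolding ep_def by (intro continuous_intros)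

lemma finite_ep_vimage: "finite S \<Longrightarrow> finite {s \<in> {0..1}. ep s \<in> S}"
proof -
  assume "finite S"
  have "inj_on ep {0..<1}"
  proof (rule inj_onI)
    fix x y :: real assume xy: "x \<in> {0..<1}" "y \<in> {0..<1}" "ep x = ep y"
    then obtain n :: int where "2 * of_real pi * \<i> * of_real x = 2 * of_real pi * \<i> * of_real y + (of_int (2 * n) * pi) * \<i>"
      unfolding ep_def exp_eq by auto
    then have "complex_of_real (2 * pi * x) = of_real (2 * pi * y + of_int (2 * n) * pi)"
      by (simp add: complex_eq_iff)
    then have "2 * pi * x = 2 * pi * y + of_int (2 * n) * pi" by (simp only: of_real_eq_iff)
    then have "2 * pi * (x - y - of_int n) = 0" by (simp add: algebra_simps)
    then have n: "x - y = of_int n" by simp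
    have "\<bar>x - y\<bar> < 1" using xy by auto
    then have "n = 0" unfolding n by linarith
    then show "x = y" using n by simp
  qed
  then have "inj_on ep {s \<in> {0..<1}. ep s \<in> S}" by (rule inj_on_subset) auto
  moreover have "finite (ep ` {s \<in> {0..<1}. ep s \<in> S})" by (rule finite_subset[OF _ \<open>finite S\<close>]) auto
  ultimately have "finite {s \<in> {0..<1}. ep s \<in> S}" by (simp add: finite_image_iff)
  then have "finite (insert 1 {s \<in> {0..<1}. ep s \<in> S})" by simp
  then show ?thesis by (rule rev_finite_subset) auto
qed

lemma contour_integral_circle:
  "contour_integral (circlepath 0 1) (\<lambda>x. F x / x) = 2 * of_real pi * \<i> * integral {0..1} (\<lambda>s. F (ep s))"
proof -
  have "contour_integral (circlepath 0 1) (\<lambda>x. F x / x) = integral {0..1} (\<lambda>s. 2 * of_real pi * \<i> * F (ep s))"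
    unfolding contour_integral_integral vector_derivative_circlepath
    by (simp add: circlepath ep_def mult_ac)
  then show ?thesis by simp
qed

text \<open>Integrals over the torus in angular coordinates; working on the unit square gives access to
  Fubini's theorem and to the reflection \<open>s \<mapsto> 1 - s\<close>, which is \<open>x \<mapsto> 1 / x\<close> on the circle.\<close>

definition torus_mean :: "(complex \<Rightarrow> complex \<Rightarrow> complex) \<Rightarrow> complex" where
  "torus_mean F = integral {0..1} (\<lambda>s. integral {0..1} (\<lambda>r. F (ep s) (ep r)))"

lemma torus_integral_mean: "torus_integral F = (2 * of_real pi * \<i>)\<^sup>2 * torus_mean F"
  unfolding torus_integral_def contour_integral_circle torus_mean_def
  by (simp add: power2_eq_square mult.assoc)

text \<open>Finitely many values of \<open>x\<close>, and for each \<open>x\<close> finitely many values of \<open>y\<close>, may be ignored. This disposes of the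
  points where the coefficients of the operator have poles.\<close>

lemma torus_mean_cong:
  assumes "finite N" "\<And>x. finite (M x)"
    and "\<And>x y. norm x = 1 \<Longrightarrow> norm y = 1 \<Longrightarrow> x \<notin> N \<Longrightarrow> y \<notin> M x \<Longrightarrow> F x y = G x y"
  shows "torus_mean F = torus_mean G"
  unfolding torus_mean_def
proof (rule integral_spike[OF negligible_finite[OF finite_ep_vimage[OF assms(1)]]])
  fix s :: real assume "s \<in> {0..1} - {s \<in> {0..1}. ep s \<in> N}"
  then have s: "ep s \<notin> N" by auto
  show "integral {0..1} (\<lambda>r. G (ep s) (ep r)) = integral {0..1} (\<lambda>r. F (ep s) (ep r))"
  proof (rule integral_spike[OF negligible_finite[OF finite_ep_vimage[OF assms(2)[of "ep s"]]]])
    fix r :: real assume "r \<in> {0..1} - {r \<in> {0..1}. ep r \<in> M (ep s)}"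
    then show "F (ep s) (ep r) = G (ep s) (ep r)"
      using assms(3)[OF norm_ep norm_ep s, of r] by auto
  qed
qed

definition torus_continuous :: "(complex \<Rightarrow> complex \<Rightarrow> complex) \<Rightarrow> bool" where
  "torus_continuous F \<longleftrightarrow> continuous_on (cbox (0, 0) (1, 1)) (\<lambda>p :: real \<times> real. F (ep (fst p)) (ep (snd p)))"

lemma torus_mean_box:
  assumes "torus_continuous F"
  shows "torus_mean F = integral (cbox (0, 0) (1, 1)) (\<lambda>p :: real \<times> real. F (ep (fst p)) (ep (snd p)))"
  using integral_prod_continuous[OF assms[unfolded torus_continuous_def]]
  by (simp add: torus_mean_def)

lemma torus_mean_linear:
  assumes "torus_continuous F" "torus_continuous G"
  shows "torus_mean (\<lambda>x y. F x y + G x y) = torus_mean F + torus_mean G"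
    and "torus_mean (\<lambda>x y. F x y - G x y) = torus_mean F - torus_mean G"
    and "torus_mean (\<lambda>x y. c * F x y) = c * torus_mean F"
proof -
  have i: "(\<lambda>p :: real \<times> real. F (ep (fst p)) (ep (snd p))) integrable_on cbox (0, 0) (1, 1)"
    "(\<lambda>p :: real \<times> real. G (ep (fst p)) (ep (snd p))) integrable_on cbox (0, 0) (1, 1)"
    using assms unfolding torus_continuous_def by (simp_all only: integrable_continuous)
  have c: "torus_continuous (\<lambda>x y. F x y + G x y)" "torus_continuous (\<lambda>x y. F x y - G x y)" "torus_continuous (\<lambda>x y. c * F x y)"
    using assms unfolding torus_continuous_def by (auto intro!: continuous_intros)
  show "torus_mean (\<lambda>x y. F x y + G x y) = torus_mean F + torus_mean G"
    "torus_mean (\<lambda>x y. F x y - G x y) = torus_mean F - torus_mean G"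
    "torus_mean (\<lambda>x y. c * F x y) = c * torus_mean F"
    unfolding torus_mean_box[OF c(1)] torus_mean_box[OF c(2)] torus_mean_box[OF c(3)]
      torus_mean_box[OF assms(1)] torus_mean_box[OF assms(2)]
    using i by (simp_all add: integral_add integral_diff)
qed

lemma torus_mean_swap:
  assumes "torus_continuous F"
  shows "torus_mean (\<lambda>x y. F y x) = torus_mean F"
proof -
  have c: "continuous_on (cbox (0, 0) (1, 1)) (\<lambda>(s, r). F (ep s) (ep r))"
    using assms unfolding torus_continuous_def by (simp add: case_prod_beta)
  show ?thesis
    using integral_swap_continuous[OF c] by (simp add: torus_mean_def)
qed

lemma integral_reflect_unit: "integral {0..1} (\<lambda>s. f (1 - s)) = integral {0..1} (f :: real \<Rightarrow> complex)"
proof -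
  have "integral {0..1} (\<lambda>s. f (1 - s)) = integral {- 1..0} (\<lambda>s. f (1 + s))"
    using Henstock_Kurzweil_Integration.integral_reflect_real[of 0 "- 1" "\<lambda>s. f (1 + s)"] by simp
  also have "\<dots> = integral {0..1} f"
    using integral_shift_Icc_real[of "- 1" 0 f 1] by (simp add: o_def)
  finally show ?thesis .
qed

lemma torus_mean_inverse: "torus_mean (\<lambda>x y. F (1 / x) y) = torus_mean F"
  unfolding torus_mean_def ep_reflect[symmetric]
  using integral_reflect_unit[of "\<lambda>s. integral {0..1} (\<lambda>r. F (ep s) (ep r))"] by simp

text \<open>Cauchy's theorem for the homotopy between two concentric circles.\<close>

lemma circle_mean_radius:
  assumes "0 < r" "0 < r'" "open S" "f holomorphic_on S" "\<And>x. min r r' \<le> norm x \<Longrightarrow> norm x \<le> max r r' \<Longrightarrow> x \<in> S" "0 \<notin> S"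
  shows "integral {0..1} (\<lambda>s. f (of_real r * ep s)) = integral {0..1} (\<lambda>s. f (of_real r' * ep s))"
proof -
  have mean: "contour_integral (circlepath 0 \<rho>) (\<lambda>x. f x / x) = 2 * of_real pi * \<i> * integral {0..1} (\<lambda>s. f (of_real \<rho> * ep s))" if "0 < \<rho>" for \<rho> :: real
  proof -
    have "contour_integral (circlepath 0 \<rho>) (\<lambda>x. f x / x) = integral {0..1} (\<lambda>s. 2 * of_real pi * \<i> * f (of_real \<rho> * ep s))"
      unfolding contour_integral_integral vector_derivative_circlepath
      using that by (simp add: circlepath ep_def mult_ac)
    then show ?thesis by simp
  qed
  have "contour_integral (circlepath 0 r) (\<lambda>x. f x / x) = contour_integral (circlepath 0 r') (\<lambda>x. f x / x)"
  proof (rule Cauchy_theorem_homotopic_loops[where S = S])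
    show "homotopic_loops S (circlepath 0 r) (circlepath 0 r')"
    proof (rule homotopic_loops_linear)
      fix s :: real
      show "closed_segment (circlepath 0 r s) (circlepath 0 r' s) \<subseteq> S"
      proof
        fix x assume "x \<in> closed_segment (circlepath 0 r s) (circlepath 0 r' s)"
        then obtain u where u: "0 \<le> u" "u \<le> 1" "x = of_real ((1 - u) * r + u * r') * ep s"
          by (auto simp: closed_segment_def circlepath ep_def scaleR_conv_of_real algebra_simps)
        have pos: "0 \<le> (1 - u) * r + u * r'" using u assms by auto
        then have n: "norm x = (1 - u) * r + u * r'"
          unfolding u(3) norm_mult norm_ep norm_of_real by simp
        have "min r r' \<le> (1 - u) * r + u * r'" "(1 - u) * r + u * r' \<le> max r r'"
          using convex_bound_le[of r "max r r'" r' "1 - u" u] convex_bound_le[of "- r" "- min r r'" "- r'" "1 - u" u] u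
          by (auto simp: algebra_simps)
        then show "x \<in> S" using assms(5) n by simp
      qed
    qed auto
    show "(\<lambda>x. f x / x) holomorphic_on S"
      using assms by (auto intro!: holomorphic_intros)
  qed (use assms in auto)
  then show ?thesis using mean assms(1,2) by simp
qed

lemma torus_mean_eq_0_imp:
  assumes "torus_continuous (\<lambda>x y. of_real (F x y))" "\<And>x y. norm x = 1 \<Longrightarrow> norm y = 1 \<Longrightarrow> 0 \<le> F x y"
    and "torus_mean (\<lambda>x y. of_real (F x y)) = 0" "norm x = 1" "norm y = 1"
  shows "F x y = 0"
proof -
  define f where "f p = F (ep (fst p)) (ep (snd p))" for p :: "real \<times> real"
  have c: "continuous_on (cbox (0, 0) (1, 1)) f"
    using continuous_on_Re[OF assms(1)[unfolded torus_continuous_def]] by (simp add: f_def[abs_def])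
  have "complex_of_real (integral (cbox (0, 0) (1, 1)) f) = 0"
    using assms(3) unfolding torus_mean_box[OF assms(1)] f_def[symmetric]
    using integral_linear[OF integrable_continuous[OF c] bounded_linear_of_real[where 'a = complex]] by (simp add: o_def)
  then have "integral (cbox (0, 0) (1, 1)) f = 0" by simp
  moreover have "box (0, 0) (1, 1) \<noteq> ({} :: (real \<times> real) set)"
    by (auto simp: box_ne_empty Basis_prod_def)
  ultimately have z: "\<forall>p \<in> cbox (0, 0) (1, 1). f p = 0"
    using integral_cbox_eq_0_iff[OF c] assms(2) by (auto simp: f_def)
  have ex: "\<exists>s \<in> {0..1}. x = ep s" if "norm x = 1" for x
  proof -
    have e: "exp (\<i> * of_real (Arg2pi x)) = x" using complex_norm_eq_1_exp[of x] that by simp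
    have "ep (Arg2pi x / (2 * pi)) = exp (\<i> * of_real (Arg2pi x))"
      unfolding ep_def by (rule arg_cong[of _ _ exp]) (simp add: field_simps)
    then have "x = ep (Arg2pi x / (2 * pi))" using e by simp
    moreover have "Arg2pi x / (2 * pi) \<in> {0..1}"
      using Arg2pi_ge_0[of x] Arg2pi_lt_2pi[of x] by (simp add: field_simps)
    ultimately show ?thesis by blast
  qed
  obtain s r where "s \<in> {0..1}" "r \<in> {0..1}" "x = ep s" "y = ep r"
    using ex[OF assms(4)] ex[OF assms(5)] by auto
  then show ?thesis using z[rule_format, of "(s, r)"] by (auto simp: f_def)
qed

section \<open>The weight function and orthogonality\<close>

text \<open>The weights have to be holomorphic on a slightly larger disc, so that contours can be moved.\<close>

lemma radius_exists:
  assumes "finite C" "\<And>c. c \<in> C \<Longrightarrow> norm c < 1"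
  shows "\<exists>\<rho>>1. \<forall>c\<in>C. \<forall>x :: complex. norm x < \<rho> \<longrightarrow> norm (c * x) < 1"
  using assms
proof (induction C rule: finite_induct)
  case empty
  then show ?case by (intro exI[of _ 2]) auto
next
  case (insert c C)
  then obtain \<rho> where \<rho>: "1 < \<rho>" "\<And>c x. c \<in> C \<Longrightarrow> norm x < \<rho> \<Longrightarrow> norm (c * x) < 1"
    by blast
  define M where "M = max (norm c) (1 / 2)"
  have M: "0 < M" "M < 1" "norm c \<le> M" using insert.prems by (auto simp: M_def)
  have "norm (c * x) < 1" if "norm x < 1 / M" for x
  proof -
    have "norm (c * x) \<le> M * norm x" using M by (simp add: norm_mult mult_right_mono)
    also have "\<dots> < 1" using that M by (simp add: field_simps)
    finally show ?thesis .
  qed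
  moreover have "1 < 1 / M" using M by (simp add: field_simps)
  ultimately show ?case using \<rho> by (intro exI[of _ "min \<rho> (1 / M)"]) auto
qed

text \<open>Parameters on the unit circle are \<open>1\<close> or \<open>-1\<close>: if \<open>norm b = 1\<close> then \<open>b * cnj b = 1\<close>, and \<open>cnj b\<close>
  occurs among the parameters, where it must be \<open>b\<close> itself because of the conditions \<open>b\<^sub>i b\<^sub>j \<noteq> 1\<close>.\<close>

locale koornwinder_weight = koornwinder_product q t b1 p1 p2 p3 b2 b3 b4 for q t b1 p1 p2 p3 b2 b3 b4 +
  fixes q0 t0 :: real
  assumes q0: "q = of_real q0" "0 < q0" and t0: "t = of_real t0"
    and norm_b1: "norm b1 \<le> 1" and norm_b2: "norm b2 \<le> 1" and norm_b3: "norm b3 \<le> 1" and norm_b4: "norm b4 \<le> 1"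
    and unit: "\<And>b. b \<in> {b1, b2, b3, b4} \<Longrightarrow> norm b = 1 \<Longrightarrow> b = 1 \<or> b = - 1"
    and distinct: "b1 * b2 \<noteq> 1" "b1 * b3 \<noteq> 1" "b1 * b4 \<noteq> 1" "b2 * b3 \<noteq> 1" "b2 * b4 \<noteq> 1" "b3 * b4 \<noteq> 1"
    and cnj_b: "image_mset cnj {#b1, b2, b3, b4#} = {#b1, b2, b3, b4#}"
begin

text \<open>A parameter \<open>b = 1\<close> or \<open>b = -1\<close> makes a denominator of the weight vanish on the torus. The first factor
  \<open>1 - b x\<close> of the corresponding infinite product is split off (\<open>head\<close>), leaving a product with parameter \<open>b q\<close>
  (\<open>dc\<close>, \<open>den\<close>) that has no zero near the closed disc. By the conditions \<open>b\<^sub>i b\<^sub>j \<noteq> 1\<close> each of the two values occurs at most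
  once, so the heads divide \<open>1 - x\<^sup>2\<close>, and \<open>pol\<close> is the quotient.\<close>

definition dc :: "complex \<Rightarrow> complex" where "dc b = (if norm b = 1 then b * q else b)"
definition den :: "complex \<Rightarrow> complex \<Rightarrow> complex" where "den b x = qpoch_inf (dc b * x) q"
definition head :: "complex \<Rightarrow> complex \<Rightarrow> complex" where "head b x = (if norm b = 1 then 1 - b * x else 1)"
definition dens :: "complex \<Rightarrow> complex" where "dens x = den b1 x * den b2 x * den b3 x * den b4 x"
definition heads :: "complex \<Rightarrow> complex" where "heads x = head b1 x * head b2 x * head b3 x * head b4 x"
definition pol :: "complex \<Rightarrow> complex" where
  "pol x = (if 1 \<in> {b1, b2, b3, b4} then 1 else 1 - x) * (if - 1 \<in> {b1, b2, b3, b4} then 1 else 1 + x)"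

lemma norm_dc: "norm b \<le> 1 \<Longrightarrow> norm (dc b) < 1"
  using q_less by (simp add: dc_def norm_mult)

lemma qpoch_inf_head: "qpoch_inf (b * x) q = head b x * den b x"
  using qpoch_inf_rec[OF q_less, of "b * x"] by (simp add: head_def den_def dc_def mult_ac)

lemma heads_pol: "heads x * pol x = 1 - x\<^sup>2"
proof -
  have u: "norm b = 1 \<Longrightarrow> b = 1 \<or> b = - 1" if "b \<in> {b1, b2, b3, b4}" for b using unit that by blast
  have n: "norm b = 1 \<longleftrightarrow> b = 1 \<or> b = - 1" if "b \<in> {b1, b2, b3, b4}" for b using u[OF that] by auto
  have h: "head b x = (if b = 1 then 1 - x else 1) * (if b = - 1 then 1 + x else 1)" if "b \<in> {b1, b2, b3, b4}" for b
    using n[OF that] by (auto simp: head_def)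
  have plus: "(if b1 = 1 then 1 - x else 1) * (if b2 = 1 then 1 - x else 1) * (if b3 = 1 then 1 - x else 1) * (if b4 = 1 then 1 - x else 1)
      * (if 1 \<in> {b1, b2, b3, b4} then 1 else 1 - x) = 1 - x"
    using distinct by (cases "b1 = 1"; cases "b2 = 1"; cases "b3 = 1"; cases "b4 = 1"; simp)
  have minus: "(if b1 = - 1 then 1 + x else 1) * (if b2 = - 1 then 1 + x else 1) * (if b3 = - 1 then 1 + x else 1) * (if b4 = - 1 then 1 + x else 1)
      * (if - 1 \<in> {b1, b2, b3, b4} then 1 else 1 + x) = 1 + x"
    using distinct by (cases "b1 = - 1"; cases "b2 = - 1"; cases "b3 = - 1"; cases "b4 = - 1"; simp)
  have "heads x * pol x = ((if b1 = 1 then 1 - x else 1) * (if b2 = 1 then 1 - x else 1) * (if b3 = 1 then 1 - x else 1) * (if b4 = 1 then 1 - x else 1)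
      * (if 1 \<in> {b1, b2, b3, b4} then 1 else 1 - x)) *
      ((if b1 = - 1 then 1 + x else 1) * (if b2 = - 1 then 1 + x else 1) * (if b3 = - 1 then 1 + x else 1) * (if b4 = - 1 then 1 + x else 1)
      * (if - 1 \<in> {b1, b2, b3, b4} then 1 else 1 + x))"
    unfolding heads_def pol_def h[of b1, simplified] h[of b2, simplified] h[of b3, simplified] h[of b4, simplified]
    by (simp only: ac_simps)
  also have "\<dots> = (1 - x) * (1 + x)" unfolding plus minus ..
  also have "\<dots> = 1 - x\<^sup>2" by (simp add: algebra_simps power2_eq_square)
  finally show ?thesis .
qed

text \<open>The one-variable weight and the interaction factor of \<open>Delta_plus\<close>, with the common factors of numerator and
  denominator cancelled (see \<open>om_eq\<close>); unlike the original quotients they are continuous on the whole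
  torus.\<close>

definition om :: "complex \<Rightarrow> complex" where "om x = pol x * qpoch_inf (q * x\<^sup>2) q / dens x"
definition ka :: "complex \<Rightarrow> complex" where "ka y = qpoch_inf y q / qpoch_inf (t * y) q"

lemma om_eq:
  assumes "x\<^sup>2 \<noteq> 1"
  shows "om x = qpoch_inf (x\<^sup>2) q / (qpoch_inf (b1 * x) q * qpoch_inf (b2 * x) q * qpoch_inf (b3 * x) q * qpoch_inf (b4 * x) q)"
proof -
  have h: "heads x \<noteq> 0" using heads_pol[of x] assms by auto
  have "qpoch_inf (x\<^sup>2) q = heads x * (pol x * qpoch_inf (q * x\<^sup>2) q)"
    using qpoch_inf_rec[OF q_less, of "x\<^sup>2"] heads_pol[of x] by (simp add: mult_ac)
  moreover have "qpoch_inf (b1 * x) q * qpoch_inf (b2 * x) q * qpoch_inf (b3 * x) q * qpoch_inf (b4 * x) q = heads x * dens x"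
    unfolding qpoch_inf_head heads_def dens_def by (simp only: ac_simps)
  ultimately show ?thesis using h by (simp add: om_def)
qed

lemma om_shift:
  assumes x: "norm x = 1" "x \<noteq> 1" "x \<noteq> - 1"
  shows "om (q * x) = wfun x * om x"
proof -
  have x2: "x\<^sup>2 \<noteq> 1" using x by (simp add: power2_eq_1_iff)
  have "norm ((q * x)\<^sup>2) < 1" "norm (q * x\<^sup>2) < 1"
    using x q_less by (simp_all add: norm_mult norm_power power_less_one_iff)
  then have qx: "(q * x)\<^sup>2 \<noteq> 1" "q * x\<^sup>2 \<noteq> 1" by auto
  have b: "1 - b * x \<noteq> 0" if "b \<in> {b1, b2, b3, b4}" for b
  proof
    assume "1 - b * x = 0"
    then have bx: "b * x = 1" by simp
    then have "norm b = 1" using x(1) by (metis mult.right_neutral norm_mult norm_one)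
    then have "b = 1 \<or> b = - 1" using unit[OF that] by blast
    then show False using bx x by (auto simp: minus_equation_iff)
  qed
  have r: "qpoch_inf (b * x) q = (1 - b * x) * qpoch_inf (b * (q * x)) q" for b
    using qpoch_inf_rec[OF q_less, of "b * x"] by (simp add: mult_ac)
  have s: "qpoch_inf (x\<^sup>2) q = (1 - x\<^sup>2) * (1 - q * x\<^sup>2) * qpoch_inf ((q * x)\<^sup>2) q"
    using qpoch_inf_rec[OF q_less, of "x\<^sup>2"] qpoch_inf_rec[OF q_less, of "x\<^sup>2 * q"]
    by (simp add: power_mult_distrib mult_ac power2_eq_square)
  show ?thesis
    unfolding om_eq[OF x2] om_eq[OF qx(1)] wfun_def cubic_eq r s
    using b x2 qx by simp
qed

lemma ka_shift: "z \<noteq> 1 \<Longrightarrow> t * z \<noteq> 1 \<Longrightarrow> ka (q * z) = (1 - t * z) / (1 - z) * ka z"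
  using qpoch_inf_rec[OF q_less, of z] qpoch_inf_rec[OF q_less, of "t * z"]
  by (simp add: ka_def mult_ac)

definition De :: "complex \<Rightarrow> complex \<Rightarrow> complex" where
  "De x y = om x * om (1 / x) * om y * om (1 / y) * ka (x * y) * ka (x / y) * ka (1 / (x * y)) * ka (y / x)"

text \<open>The weight with \<open>x\<close> replaced by \<open>q x\<close> in the factors that are positive in \<open>x\<close>. It is
  holomorphic in \<open>x\<close> near the annulus \<open>1 \<le> |x| \<le> 1 / |q|\<close> and invariant under \<open>x \<mapsto> 1 / (q x)\<close>.\<close>

definition Th :: "complex \<Rightarrow> complex \<Rightarrow> complex" where
  "Th x y = om (q * x) * om (1 / x) * om y * om (1 / y) * ka (q * x * y) * ka (q * x / y) * ka (1 / (x * y)) * ka (y / x)"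

lemma De_inverse: "x \<noteq> 0 \<Longrightarrow> y \<noteq> 0 \<Longrightarrow> De (1 / x) y = De x y"
  by (simp add: De_def mult_ac)

lemma De_commute: "De x y = De y x"
  by (simp add: De_def mult_ac)

lemma Phi_De:
  assumes x: "norm x = 1" "x \<noteq> 1" "x \<noteq> - 1" and y: "norm y = 1" "x * y \<noteq> 1" "x \<noteq> y"
  shows "Phi x y * De x y = Th x y"
proof -
  have y0: "y \<noteq> 0" using y by auto
  have z: "x * y \<noteq> 1" "x / y \<noteq> 1" using y by auto
  have tz: "t * (x * y) \<noteq> 1" "t * (x / y) \<noteq> 1"
  proof -
    have "norm (t * (x * y)) < 1" "norm (t * (x / y)) < 1"
      using x y t_less by (simp_all add: norm_mult norm_divide)
    then show "t * (x * y) \<noteq> 1" "t * (x / y) \<noteq> 1" by auto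
  qed
  have k1: "ka (q * x * y) = (1 - t * x * y) / (1 - x * y) * ka (x * y)"
    using ka_shift[OF z(1) tz(1)] by (simp add: mult.assoc)
  have k2: "ka (q * x / y) = (1 - t * x / y) / (1 - x / y) * ka (x / y)"
    using ka_shift[OF z(2) tz(2)] by simp
  show ?thesis
    unfolding Th_def De_def Phi_def om_shift[OF x] k1 k2 by (simp add: mult_ac)
qed

lemma Delta_De:
  assumes "norm x = 1" "norm y = 1" "x \<noteq> 1" "x \<noteq> - 1" "y \<noteq> 1" "y \<noteq> - 1"
    and a: "a 1 = b1" "a 2 = b2" "a 3 = b3" "a 4 = b4"
  shows "Delta q t a x y = De x y"
proof -
  have nz: "x \<noteq> 0" "y \<noteq> 0" using assms by auto
  have sq: "x\<^sup>2 \<noteq> 1" "y\<^sup>2 \<noteq> 1" "(1 / x)\<^sup>2 \<noteq> 1" "(1 / y)\<^sup>2 \<noteq> 1"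
    using assms nz by (auto simp: power2_eq_1_iff field_simps)
  have "Delta_plus q t a u v = om u * om v * (ka (u * v) * ka (u / v))" if "u\<^sup>2 \<noteq> 1" "v\<^sup>2 \<noteq> 1" for u v
    unfolding Delta_plus_def om_eq[OF that(1)] om_eq[OF that(2)] ka_def a
    by (simp add: qpochs_inf_def inverse_eq_divide mult.assoc)
  note dp = this
  show ?thesis
  proof -
    have 1: "Delta_plus q t a x y = om x * om y * (ka (x * y) * ka (x / y))"
      by (rule dp[OF sq(1,2)])
    have 2: "Delta_plus q t a (inverse x) (inverse y) = om (1 / x) * om (1 / y) * (ka (1 / (x * y)) * ka (y / x))"
      using dp[OF sq(3,4)]
      by (simp add: inverse_eq_divide)
    show ?thesis unfolding Delta_def 1 2 De_def by (simp only: ac_simps)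
  qed
qed

definition "rho = (SOME \<rho>. 1 < \<rho> \<and> (\<forall>c\<in>{dc b1, dc b2, dc b3, dc b4, t}. \<forall>x :: complex. norm x < \<rho> \<longrightarrow> norm (c * x) < 1))"

lemma rho: "1 < rho" "\<And>c x. c \<in> {dc b1, dc b2, dc b3, dc b4, t} \<Longrightarrow> norm x < rho \<Longrightarrow> norm (c * x) < 1"
proof -
  have "\<exists>\<rho>>1. \<forall>c\<in>{dc b1, dc b2, dc b3, dc b4, t}. \<forall>x :: complex. norm x < \<rho> \<longrightarrow> norm (c * x) < 1"
    by (rule radius_exists) (use norm_dc norm_b1 norm_b2 norm_b3 norm_b4 t_less in auto)
  from someI_ex[OF this] show "1 < rho" "\<And>c x. c \<in> {dc b1, dc b2, dc b3, dc b4, t} \<Longrightarrow> norm x < rho \<Longrightarrow> norm (c * x) < 1"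
    unfolding rho_def by blast+
qed

lemma dens_nz: "norm x < rho \<Longrightarrow> dens x \<noteq> 0"
  using rho(2) q_less by (simp add: dens_def den_def qpoch_inf_nonzero)

lemma ka_den_nz: "norm x < rho \<Longrightarrow> qpoch_inf (t * x) q \<noteq> 0"
  using rho(2) q_less by (simp add: qpoch_inf_nonzero)

lemma holomorphic_pol [holomorphic_intros]: "f holomorphic_on S \<Longrightarrow> (\<lambda>x. pol (f x)) holomorphic_on S"
  unfolding pol_def
  by (cases "1 \<in> {b1, b2, b3, b4}"; cases "- 1 \<in> {b1, b2, b3, b4}"; simp only: if_True if_False; intro holomorphic_intros)

lemma continuous_pol [continuous_intros]: "continuous_on S f \<Longrightarrow> continuous_on S (\<lambda>x. pol (f x))"
  unfolding pol_def
  by (cases "1 \<in> {b1, b2, b3, b4}"; cases "- 1 \<in> {b1, b2, b3, b4}"; simp only: if_True if_False; intro continuous_intros)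

lemma holomorphic_om [holomorphic_intros]:
  assumes "f holomorphic_on S" "\<And>x. x \<in> S \<Longrightarrow> norm (f x) < rho"
  shows "(\<lambda>x. om (f x)) holomorphic_on S"
  unfolding om_def using dens_nz[OF assms(2)] unfolding dens_def den_def
  by (auto intro!: holomorphic_intros assms(1) q_less)

lemma holomorphic_ka [holomorphic_intros]:
  assumes "f holomorphic_on S" "\<And>x. x \<in> S \<Longrightarrow> norm (f x) < rho"
  shows "(\<lambda>x. ka (f x)) holomorphic_on S"
  unfolding ka_def using ka_den_nz[OF assms(2)]
  by (auto intro!: holomorphic_intros assms(1) q_less)

lemma continuous_om [continuous_intros]:
  assumes "continuous_on S f" "\<And>x. x \<in> S \<Longrightarrow> norm (f x) < rho"
  shows "continuous_on S (\<lambda>x. om (f x))"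
  unfolding om_def using dens_nz[OF assms(2)] unfolding dens_def den_def
  by (auto intro!: continuous_intros assms(1) q_less)

lemma continuous_ka [continuous_intros]:
  assumes "continuous_on S f" "\<And>x. x \<in> S \<Longrightarrow> norm (f x) < rho"
  shows "continuous_on S (\<lambda>x. ka (f x))"
  unfolding ka_def using ka_den_nz[OF assms(2)]
  by (auto intro!: continuous_intros assms(1) q_less)

text \<open>The properties of symmetric Laurent polynomials that the integral arguments use.\<close>

definition test_function :: "(complex \<Rightarrow> complex \<Rightarrow> complex) \<Rightarrow> bool" where
  "test_function f \<longleftrightarrow> continuous_on {p. fst p \<noteq> 0 \<and> snd p \<noteq> 0} (\<lambda>p. f (fst p) (snd p)) \<and>
     (\<forall>y. y \<noteq> 0 \<longrightarrow> (\<lambda>x. f x y) holomorphic_on - {0}) \<and>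
     (\<forall>x y. f (1 / x) y = f x y) \<and> (\<forall>x y. f x y = f y x)"

lemma test_function_continuous:
  assumes "test_function f" "continuous_on S g" "continuous_on S h" "\<And>p. p \<in> S \<Longrightarrow> g p \<noteq> 0 \<and> h p \<noteq> 0"
  shows "continuous_on S (\<lambda>p. f (g p) (h p))"
proof -
  have "continuous_on {p. fst p \<noteq> 0 \<and> snd p \<noteq> 0} (\<lambda>p. f (fst p) (snd p))"
    using assms(1) by (simp add: test_function_def)
  moreover have "continuous_on S (\<lambda>p. (g p, h p))" by (intro continuous_intros assms)
  moreover have "(\<lambda>p. (g p, h p)) ` S \<subseteq> {p. fst p \<noteq> 0 \<and> snd p \<noteq> 0}" using assms(4) by auto
  ultimately show ?thesis using continuous_on_compose2 by fastforce
qed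

lemma norm_lt_rho: "norm x \<le> 1 \<Longrightarrow> norm x < rho"
  using rho(1) by linarith

lemma norm_q_le: "norm q \<le> 1" using q_less by simp

lemma continuous_weights:
  shows "torus_continuous De" "torus_continuous Th"
  unfolding torus_continuous_def De_def Th_def
  by (intro continuous_intros norm_lt_rho; simp add: norm_mult norm_divide norm_q_le)+

lemma torus_continuous_mult:
  "torus_continuous F \<Longrightarrow> torus_continuous G \<Longrightarrow> torus_continuous (\<lambda>x y. F x y * G x y)"
  unfolding torus_continuous_def by (rule continuous_on_mult)

lemma torus_continuous_test:
  assumes "test_function f"
  shows "torus_continuous f" "torus_continuous (\<lambda>x y. f (q * x) y)"
  unfolding torus_continuous_def
  by (intro test_function_continuous[OF assms] continuous_intros; simp add: q_nz)+

definition shift_form :: "(complex \<Rightarrow> complex \<Rightarrow> complex) \<Rightarrow> (complex \<Rightarrow> complex \<Rightarrow> complex) \<Rightarrow> complex" where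
  "shift_form f g = torus_mean (\<lambda>x y. Th x y * f (q * x) y * g x y)"

text \<open>Symmetry of the operator. For fixed \<open>y\<close> the integrand is holomorphic in \<open>x\<close> on a neighbourhood of the annulus
  between \<open>|x| = 1\<close> and \<open>|x| = 1 / q\<close>, so the circle can be enlarged to radius \<open>1 / q\<close>. There the substitution
  \<open>x \<mapsto> 1 / (q x)\<close> returns to the unit circle, fixes \<open>Th\<close>, and exchanges the shifted and unshifted arguments
  of \<open>f\<close> and \<open>g\<close>.\<close>

theorem shift_form_commute:
  assumes f: "test_function f" and g: "test_function g"
  shows "shift_form f g = shift_form g f"
proof -
  have tc: "torus_continuous (\<lambda>x y. Th x y * f (q * x) y * g x y)" if "test_function f" "test_function g" for f g
    by (intro torus_continuous_mult continuous_weights torus_continuous_test that)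
  have sw: "shift_form f g = integral {0..1} (\<lambda>r. integral {0..1} (\<lambda>s. Th (ep s) (ep r) * f (q * ep s) (ep r) * g (ep s) (ep r)))"
    if "test_function f" "test_function g" for f g
    unfolding shift_form_def torus_mean_swap[OF tc[OF that], symmetric] by (simp add: torus_mean_def)
  have "integral {0..1} (\<lambda>s. Th (ep s) (ep r) * f (q * ep s) (ep r) * g (ep s) (ep r)) =
     integral {0..1} (\<lambda>s. Th (ep s) (ep r) * g (q * ep s) (ep r) * f (ep s) (ep r))" for r
  proof -
    define y where "y = ep r"
    have y: "norm y = 1" "y \<noteq> 0" by (simp_all add: y_def)
    define h where "h x = Th x y * f (q * x) y * g x y" for x
    \<comment> \<open>An open annulus containing the closed annulus between the two circles.\<close>
    define S where "S = {x :: complex. 1 / rho < norm x} \<inter> {x. norm (q * x) < rho}"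
    have S0: "x \<noteq> 0" "norm (1 / x) < rho" "norm (q * x) < rho" if "x \<in> S" for x
    proof -
      show x: "x \<noteq> 0" using that rho(1) by (auto simp: S_def)
      show "norm (q * x) < rho" using that by (simp add: S_def)
      have "1 / rho < norm x" using that by (simp add: S_def)
      then show "norm (1 / x) < rho" using x rho(1) by (simp add: norm_divide divide_less_eq mult.commute)
    qed
    have "open S"
      unfolding S_def by (intro open_Int open_Collect_less continuous_intros)
    have hf: "(\<lambda>x. f x y) holomorphic_on - {0}" "(\<lambda>x. g x y) holomorphic_on - {0}"
      using f g y by (auto simp: test_function_def)
    have "(\<lambda>x. f (q * x) y) holomorphic_on S"
    proof -
      have "(\<lambda>x. q * x) ` S \<subseteq> - {0}" using S0(1) q_nz by (metis (no_types, lifting) ComplI empty_iff image_subsetI insertE mult_eq_0_iff)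
      moreover have "(\<lambda>x. q * x) holomorphic_on S" by (intro holomorphic_intros)
      ultimately show ?thesis using holomorphic_on_compose_gen[OF _ hf(1), of "\<lambda>x. q * x" S] by (simp only: o_def)
    qed
    moreover have "(\<lambda>x. g x y) holomorphic_on S"
      using holomorphic_on_subset[OF hf(2)] S0(1) by auto
    moreover have "(\<lambda>x. Th x y) holomorphic_on S"
      unfolding Th_def using S0 y
      by (intro holomorphic_intros) (auto simp: norm_mult norm_divide intro: norm_lt_rho)
    ultimately have hol: "h holomorphic_on S" unfolding h_def by (intro holomorphic_intros)
    have q0': "0 < 1 / q0" "q0 < 1" using q0 q_less by auto
    have inS: "x \<in> S" if "min 1 (1 / q0) \<le> norm x" "norm x \<le> max 1 (1 / q0)" for x
    proof -
      have "1 \<le> 1 / q0" using q0 q0' by (simp add: field_simps)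
      then have x: "1 \<le> norm x" "norm x \<le> 1 / q0" using that by auto
      have "1 / rho < 1" using rho(1) by simp
      then have "1 / rho < norm x" using x by linarith
      moreover have "norm (q * x) \<le> 1" using x q0 by (simp add: norm_mult field_simps)
      ultimately show ?thesis using norm_lt_rho by (auto simp: S_def)
    qed
    have "integral {0..1} (\<lambda>s. h (ep s)) = integral {0..1} (\<lambda>s. h (of_real (1 / q0) * ep s))"
      using circle_mean_radius[OF zero_less_one q0'(1) \<open>open S\<close> hol inS] S0(1) by auto
    also have "\<dots> = integral {0..1} (\<lambda>s. h (of_real (1 / q0) * ep (1 - s)))"
      using integral_reflect_unit[of "\<lambda>s. h (of_real (1 / q0) * ep s)"] by simp
    also have "\<dots> = integral {0..1} (\<lambda>s. Th (ep s) y * g (q * ep s) y * f (ep s) y)"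
    proof (rule integral_cong)
      fix s :: real
      define x where "x = ep s"
      have x: "x \<noteq> 0" by (simp add: x_def)
      have e: "of_real (1 / q0) * ep (1 - s) = 1 / (q * x)"
        by (simp add: ep_reflect x_def q0(1))
      have i: "f (1 / x) y = f x y" "g (1 / (q * x)) y = g (q * x) y"
        using f g by (auto simp: test_function_def)
      have "Th (1 / (q * x)) y = Th x y"
        unfolding Th_def using x y(2) q_nz by (simp add: mult_ac)
      then show "h (of_real (1 / q0) * ep (1 - s)) = Th (ep s) y * g (q * ep s) y * f (ep s) y"
        unfolding e h_def using i q_nz by (simp add: x_def)
    qed
    finally show ?thesis by (simp add: h_def y_def)
  qed
  then show ?thesis unfolding sw[OF f g] sw[OF g f] by simp
qed

text \<open>Away from these points the coefficients of the operator are finite, and the weight is nonzero.\<close>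

definition generic :: "complex \<Rightarrow> complex \<Rightarrow> bool" where
  "generic x y \<longleftrightarrow> norm x = 1 \<and> norm y = 1 \<and> x \<notin> {1, - 1} \<and> y \<notin> {1, - 1, x, 1 / x}"

lemma torus_mean_generic:
  "(\<And>x y. generic x y \<Longrightarrow> F x y = G x y) \<Longrightarrow> torus_mean F = torus_mean G"
  by (rule torus_mean_cong[of "{1, - 1}" "\<lambda>x. {1, - 1, x, 1 / x}"]) (auto simp: generic_def)

lemma generic_regular:
  assumes "generic x y"
  shows "regular x" "regular y" "csum x \<noteq> csum y"
proof -
  have r: "regular z" if "norm z = 1" "z \<notin> {1, - 1}" for z
  proof -
    have n: "norm (z\<^sup>2) = 1" using that by (simp add: norm_power)
    then have "norm (q * z\<^sup>2) < 1" using q_less by (simp add: norm_mult)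
    then have "q * z\<^sup>2 \<noteq> 1" "z\<^sup>2 \<noteq> q" using n q_less by auto
    then show ?thesis using that by (auto simp: regular_def power2_eq_1_iff)
  qed
  show "regular x" "regular y" using assms by (auto simp: generic_def intro!: r)
  show "csum x \<noteq> csum y"
  proof
    assume eq: "csum x = csum y"
    have nz: "x \<noteq> 0" "y \<noteq> 0" using assms by (auto simp: generic_def)
    have "(x - y) * (x * y - 1) = 0"
      using eq nz by (simp add: csum_def divide_simps) algebra
    then have "x - y = 0 \<or> x * y - 1 = 0" by (simp only: mult_eq_0_iff)
    then have "y = x \<or> y = 1 / x"
    proof
      assume "x * y - 1 = 0"
      then show ?thesis using nz by (simp add: eq_divide_eq mult.commute)
    qed simp
    then show False using assms by (auto simp: generic_def)
  qed
qed

definition pairing :: "(complex \<Rightarrow> complex \<Rightarrow> complex) \<Rightarrow> (complex \<Rightarrow> complex \<Rightarrow> complex) \<Rightarrow> complex" where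
  "pairing f g = torus_mean (\<lambda>x y. f x y * g x y * De x y)"

text \<open>By the symmetries of the weight, all four shifts in \<open>kop\<close> contribute the same integral.\<close>

lemma pairing_eigen:
  assumes f: "test_function f" and g: "test_function g"
    and eigen: "\<And>x y. generic x y \<Longrightarrow> kop f x y = e * f x y"
  shows "e * pairing f g = 4 * (shift_form f g - torus_mean (\<lambda>x y. Th x y * (f x y * g x y)))"
proof -
  \<comment> \<open>The contribution of the shift \<open>x \<mapsto> q x\<close>; the others are its images under the symmetries.\<close>
  define Ps where "Ps x y = Th x y * f (q * x) y * g x y - Th x y * (f x y * g x y)" for x y
  have c1: "torus_continuous (\<lambda>x y. Th x y * f (q * x) y * g x y)"
    by (intro torus_continuous_mult continuous_weights torus_continuous_test f g)
  have c2: "torus_continuous (\<lambda>x y. Th x y * (f x y * g x y))"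
    by (intro torus_continuous_mult continuous_weights torus_continuous_test f g)
  have cP: "torus_continuous Ps"
    using c1 c2 unfolding Ps_def torus_continuous_def by (rule continuous_on_diff)
  have cfg: "torus_continuous (\<lambda>x y. f x y * g x y * De x y)"
    by (intro torus_continuous_mult continuous_weights torus_continuous_test f g)
  have ci: "torus_continuous (\<lambda>x y. F (1 / x) y)" if "torus_continuous F" for F
  proof -
    have m: "continuous_on (cbox (0, 0) (1, 1)) (\<lambda>p :: real \<times> real. (1 - fst p, snd p))"
      by (intro continuous_intros)
    have "continuous_on (cbox (0, 0) (1, 1)) (\<lambda>p. F (ep (1 - fst p)) (ep (snd p)))"
      using continuous_on_compose2[OF that[unfolded torus_continuous_def] m]
      by (force simp: cbox_Pair_eq image_subset_iff)
    then show ?thesis by (simp add: torus_continuous_def ep_reflect)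
  qed
  have cs: "torus_continuous (\<lambda>x y. F y x)" if "torus_continuous F" for F
  proof -
    have m: "continuous_on (cbox (0, 0) (1, 1)) (\<lambda>p :: real \<times> real. (snd p, fst p))"
      by (intro continuous_intros)
    show ?thesis
      using continuous_on_compose2[OF that[unfolded torus_continuous_def] m] by (force simp: torus_continuous_def cbox_Pair_eq image_subset_iff)
  qed
  note c = cP ci[OF cP] cs[OF cP] cs[OF ci[OF cP]]
  have cadd: "torus_continuous (\<lambda>x y. F x y + G x y)" if "torus_continuous F" "torus_continuous G" for F G
    using that unfolding torus_continuous_def by (rule continuous_on_add)
  have "e * pairing f g = torus_mean (\<lambda>x y. e * (f x y * g x y * De x y))"
    unfolding pairing_def torus_mean_linear(3)[OF cfg cfg] ..
  also have "\<dots> = torus_mean (\<lambda>x y. Ps x y + Ps (1 / x) y + Ps y x + Ps (1 / y) x)"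
  proof (rule torus_mean_generic)
    fix x y assume xy: "generic x y"
    have nz: "x \<noteq> 0" "y \<noteq> 0" and n: "norm x = 1" "norm y = 1" using xy by (auto simp: generic_def)
    have fi: "f (1 / x) y = f x y" "f (1 / y) x = f x y" "f (q * (1 / y)) x = f x (q / y)" "f (q * y) x = f x (q * y)" "f y x = f x y"
      using f by (simp_all add: test_function_def) metis+
    have gi: "g (1 / x) y = g x y" "g (1 / y) x = g x y" "g y x = g x y"
      using g by (simp_all add: test_function_def) metis+
    have P1: "Phi x y * De x y = Th x y"
      by (rule Phi_De) (use xy nz in \<open>auto simp: minus_equation_iff[of x 1] minus_equation_iff[of y 1] generic_def field_simps\<close>)
    have P2: "Phi (1 / x) y * De x y = Th (1 / x) y"
      unfolding De_inverse[OF nz, symmetric]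
      by (rule Phi_De) (use xy nz in \<open>auto simp: minus_equation_iff[of x 1] minus_equation_iff[of y 1] generic_def field_simps norm_divide\<close>)
    have P3: "Phi y x * De x y = Th y x"
      unfolding De_commute[of x y]
      by (rule Phi_De) (use xy nz in \<open>auto simp: minus_equation_iff[of x 1] minus_equation_iff[of y 1] generic_def field_simps\<close>)
    have P4: "Phi (1 / y) x * De x y = Th (1 / y) x"
      unfolding De_commute[of x y] De_inverse[OF nz(2,1), symmetric]
      by (rule Phi_De) (use xy nz in \<open>auto simp: minus_equation_iff[of x 1] minus_equation_iff[of y 1] generic_def field_simps norm_divide\<close>)
    have "e * (f x y * g x y * De x y) = kop f x y * De x y * g x y"
      unfolding eigen[OF xy] by (simp only: ac_simps)
    also have "\<dots> = (Phi x y * De x y * (f (q * x) y - f x y) + Phi (1 / x) y * De x y * (f (q / x) y - f x y)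
     + Phi y x * De x y * (f x (q * y) - f x y) + Phi (1 / y) x * De x y * (f x (q / y) - f x y)) * g x y"
      unfolding kop_def by (simp add: algebra_simps)
    also have "\<dots> = Ps x y + Ps (1 / x) y + Ps y x + Ps (1 / y) x"
      unfolding P1 P2 P3 P4 Ps_def fi gi by (simp add: algebra_simps)
    finally show "e * (f x y * g x y * De x y) = Ps x y + Ps (1 / x) y + Ps y x + Ps (1 / y) x" .
  qed
  also have "\<dots> = torus_mean Ps + torus_mean (\<lambda>x y. Ps (1 / x) y) + torus_mean (\<lambda>x y. Ps y x) + torus_mean (\<lambda>x y. Ps (1 / y) x)"
    by (simp only: torus_mean_linear(1) cadd c)
  also have "torus_mean (\<lambda>x y. Ps (1 / x) y) = torus_mean Ps" by (rule torus_mean_inverse)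
  also have "torus_mean (\<lambda>x y. Ps y x) = torus_mean Ps" by (rule torus_mean_swap[OF cP])
  also have "torus_mean (\<lambda>x y. Ps (1 / y) x) = torus_mean Ps"
    using torus_mean_swap[OF ci[OF cP]] torus_mean_inverse[of Ps] by simp
  also have "torus_mean Ps = shift_form f g - torus_mean (\<lambda>x y. Th x y * (f x y * g x y))"
    unfolding Ps_def shift_form_def by (rule torus_mean_linear(2)[OF c1 c2])
  finally show ?thesis by simp
qed

text \<open>The right-hand side of \<open>pairing_eigen\<close> is symmetric in \<open>f\<close> and \<open>g\<close>, hence
  \<open>e * pairing f g = e' * pairing f g\<close>.\<close>

theorem pairing_orthogonal:
  assumes f: "test_function f" and g: "test_function g"
    and "\<And>x y. generic x y \<Longrightarrow> kop f x y = e * f x y" "\<And>x y. generic x y \<Longrightarrow> kop g x y = e' * g x y" "e \<noteq> e'"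
  shows "pairing f g = 0"
proof -
  have "e * pairing f g = 4 * (shift_form f g - torus_mean (\<lambda>x y. Th x y * (f x y * g x y)))"
    by (rule pairing_eigen[OF f g assms(3)])
  moreover have "e' * pairing g f = 4 * (shift_form g f - torus_mean (\<lambda>x y. Th x y * (g x y * f x y)))"
    by (rule pairing_eigen[OF g f assms(4)])
  moreover have "(\<lambda>x y. Th x y * (g x y * f x y)) = (\<lambda>x y. Th x y * (f x y * g x y))"
    by (simp only: mult.commute)
  ultimately have "e * pairing f g = e' * pairing g f"
    using shift_form_commute[OF f g] by simp
  moreover have "pairing g f = pairing f g" by (simp add: pairing_def mult.commute[of "f _ _"])
  ultimately show ?thesis using assms(5) by simp
qed

lemma cnj_q: "cnj q = q" and cnj_t: "cnj t = t"
  by (simp_all add: q0 t0)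

lemma cnj_dens: "cnj (dens x) = dens (cnj x)"
proof -
  have m: "dens z = prod_mset (image_mset (\<lambda>b. den b z) {#b1, b2, b3, b4#})" for z
    by (simp add: dens_def mult_ac)
  have d: "cnj (den b x) = den (cnj b) (cnj x)" for b
    by (simp add: den_def dc_def qpoch_inf_cnj[OF q_less cnj_q] cnj_q)
  have "cnj (dens x) = prod_mset (image_mset (\<lambda>b. den b (cnj x)) (image_mset cnj {#b1, b2, b3, b4#}))"
    by (simp add: dens_def d mult_ac)
  then show ?thesis unfolding cnj_b by (simp only: m)
qed

lemma cnj_om: "cnj (om x) = om (cnj x)"
  by (simp add: om_def cnj_dens qpoch_inf_cnj[OF q_less cnj_q] cnj_q pol_def)

lemma cnj_ka: "cnj (ka x) = ka (cnj x)"
  by (simp add: ka_def qpoch_inf_cnj[OF q_less cnj_q] cnj_t)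

text \<open>On the torus \<open>x \<mapsto> 1 / x\<close> is complex conjugation, and the multiset of parameters is closed under
  conjugation; so the second half of the weight is the conjugate of the first.\<close>

lemma De_positive:
  assumes "norm x = 1" "norm y = 1"
  shows "De x y = of_real ((norm (om x * om y * ka (x * y) * ka (x / y)))\<^sup>2)"
proof -
  have c: "cnj z = 1 / z" if "norm z = 1" for z
  proof -
    have "z * cnj z = 1" using complex_norm_square[of z] that by simp
    moreover have "z \<noteq> 0" using that by auto
    ultimately show ?thesis by (simp add: field_simps)
  qed
  define w where "w = om x * om y * ka (x * y) * ka (x / y)"
  have "De x y = w * cnj w"
    using assms by (simp add: w_def De_def cnj_om cnj_ka c mult_ac)
  then have "De x y = of_real ((norm w)\<^sup>2)" by (simp only: complex_norm_square)
  then show ?thesis by (simp only: w_def)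
qed

lemma De_nz:
  assumes "generic x y"
  shows "De x y \<noteq> 0"
proof -
  have n: "norm x = 1" "norm y = 1" "x \<noteq> 0" "y \<noteq> 0" using assms by (auto simp: generic_def)
  have o: "om z \<noteq> 0" if "norm z = 1" "z \<noteq> 1" "z \<noteq> - 1" for z
  proof -
    have "pol z \<noteq> 0" using that by (auto simp: pol_def add_eq_0_iff)
    moreover have "qpoch_inf (q * z\<^sup>2) q \<noteq> 0"
      using that q_less by (intro qpoch_inf_nonzero) (auto simp: norm_mult norm_power)
    ultimately show ?thesis using dens_nz[OF norm_lt_rho[of z]] that by (simp add: om_def)
  qed
  have k: "ka z \<noteq> 0" if "norm z = 1" "z \<noteq> 1" for z
  proof -
    have "qpoch_inf (z * q) q \<noteq> 0"
      using that q_less by (intro qpoch_inf_nonzero) (auto simp: norm_mult)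
    then have "qpoch_inf z q \<noteq> 0" using qpoch_inf_rec[OF q_less, of z] that by simp
    then show ?thesis using ka_den_nz[OF norm_lt_rho[of z]] that by (simp add: ka_def)
  qed
  have "om x \<noteq> 0" "om y \<noteq> 0" using o assms by (auto simp: generic_def)
  moreover have "x * y \<noteq> 1" "x / y \<noteq> 1" using n assms by (auto simp: generic_def field_simps)
  then have "ka (x * y) \<noteq> 0" "ka (x / y) \<noteq> 0"
    using k[of "x * y"] k[of "x / y"] n by (simp_all add: norm_mult norm_divide)
  ultimately show ?thesis unfolding De_positive[OF n(1,2)] by simp
qed

lemma pairing_definite:
  assumes "torus_continuous f" "torus_mean (\<lambda>x y. f x y * cnj (f x y) * De x y) = 0" "generic x y"
  shows "f x y = 0"
proof -
  define F where "F x y = (norm (f x y))\<^sup>2 * (norm (om x * om y * ka (x * y) * ka (x / y)))\<^sup>2" for x y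
  have eq: "of_real (F x y) = f x y * cnj (f x y) * De x y" if "norm x = 1" "norm y = 1" for x y
    unfolding De_positive[OF that] F_def of_real_mult complex_norm_square[symmetric] ..
  have c: "torus_continuous (\<lambda>x y. f x y * cnj (f x y) * De x y)"
    using assms(1) continuous_weights(1) unfolding torus_continuous_def
    by (intro continuous_on_mult continuous_on_cnj)
  have "torus_continuous (\<lambda>x y. of_real (F x y))"
    using c unfolding torus_continuous_def by (simp add: eq)
  moreover have "torus_mean (\<lambda>x y. of_real (F x y)) = 0"
    using assms(2) unfolding torus_mean_def by (simp add: eq)
  ultimately have "F x y = 0"
    using torus_mean_eq_0_imp[of F x y] assms(3) by (auto simp: F_def generic_def)
  then have "f x y * cnj (f x y) * De x y = 0"
    using eq[of x y] assms(3) by (auto simp: generic_def)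
  then show ?thesis using De_nz[OF assms(3)] by simp
qed

lemma test_function_binom_sum: "test_function (binom_sum m1 m2)"
proof -
  have "continuous_on {p. fst p \<noteq> 0 \<and> snd p \<noteq> 0} (\<lambda>p. Npol k1 k2 (fst p) (snd p))" for k1 k2
    unfolding Npol_def interp_def facs_def linfac_def csum_def
    by (cases "k2 \<le> k1") (auto intro!: continuous_intros)
  moreover have "(\<lambda>x. Npol k1 k2 x y) holomorphic_on - {0}" for k1 k2 y
    unfolding Npol_def interp_def facs_def linfac_def csum_def
    by (cases "k2 \<le> k1") (auto intro!: holomorphic_intros)
  ultimately show ?thesis
    unfolding test_function_def binom_sum_def case_prod_beta
    by (auto intro!: continuous_intros holomorphic_intros simp: Npol_inverse intro: sum.cong arg_cong2[where f = "(*)"] Npol_commute)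
qed

end

section \<open>Orbit sums\<close>

definition chb_exps :: "nat \<Rightarrow> int set" where "chb_exps l = {int l, - int l}"

text \<open>The one-variable orbit sums \<open>x\<^sup>l + x\<^sup>-\<^sup>l\<close>, and 1 for \<open>l = 0\<close>; they are rescaled Chebyshev polynomials in
  \<open>x + 1 / x\<close>. Summation over the exponent set covers \<open>l = 0\<close> uniformly.\<close>

definition chb :: "nat \<Rightarrow> complex \<Rightarrow> complex" where
  "chb l x = (\<Sum>u\<in>chb_exps l. x powi u)"

definition dec_pair :: "nat \<times> nat \<Rightarrow> nat \<times> nat" where
  "dec_pair p = (max (fst p) (snd p), min (fst p) (snd p))"

lemma chb_0 [simp]: "chb 0 x = 1"
  by (simp add: chb_def chb_exps_def)

lemma chb_pos: "0 < l \<Longrightarrow> chb l x = x ^ l + inverse x ^ l"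
  by (simp add: chb_def chb_exps_def power_int_minus power_inverse)

lemma chb_inverse: "chb l (1 / x) = chb l x"
  by (cases "l = 0") (auto simp: chb_pos inverse_eq_divide)

lemma cnj_chb:
  assumes "norm x = 1"
  shows "cnj (chb l x) = chb l x"
proof -
  have "x * cnj x = 1" using complex_norm_square[of x] assms by simp
  then have "cnj x = inverse x" "inverse (cnj x) = x" by (auto simp: inverse_unique mult.commute)
  then show ?thesis by (cases "l = 0") (auto simp: chb_pos)
qed

lemma continuous_on_chb: "continuous_on S f \<Longrightarrow> (\<And>x. x \<in> S \<Longrightarrow> f x \<noteq> 0) \<Longrightarrow> continuous_on S (\<lambda>x. chb l (f x))"
  by (cases "l = 0") (auto simp: chb_pos intro!: continuous_intros)

lemma holomorphic_on_chb: "chb l holomorphic_on - {0}"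
proof (cases "l = 0")
  case True
  then have "chb l = (\<lambda>x. 1)" by auto
  then show ?thesis by simp
next
  case False
  then have "chb l = (\<lambda>x. x ^ l + inverse x ^ l)" by (auto simp: chb_pos)
  then show ?thesis by (auto intro!: holomorphic_intros)
qed

lemma orbit_sum_chb:
  "orbit_sum (i, j) x y = (if i = j then chb i x * chb j y else chb i x * chb j y + chb j x * chb i y)"
proof -
  have o: "W2_orbit (i, j) = chb_exps i \<times> chb_exps j \<union> chb_exps j \<times> chb_exps i"
  proof -
    have m: "u \<in> chb_exps l \<longleftrightarrow> (\<exists>s\<in>{1, - 1}. u = s * int l)" for u l
      by (simp add: chb_exps_def)
    have "(u, v) \<in> W2_orbit (i, j) \<longleftrightarrow> (\<exists>s1\<in>{1, - 1}. \<exists>s2\<in>{1, - 1}.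
        (u = s1 * int i \<and> v = s2 * int j) \<or> (u = s1 * int j \<and> v = s2 * int i))" for u v
      unfolding W2_orbit_def fst_conv snd_conv mem_Collect_eq prod.inject insert_iff empty_iff simp_thms by blast
    then show ?thesis by (simp only: set_eq_iff split_paired_All mem_Times_iff Un_iff fst_conv snd_conv m) blast
  qed
  have f: "finite (chb_exps l)" for l by (simp add: chb_exps_def)
  have p: "(\<Sum>(u, v)\<in>chb_exps k \<times> chb_exps l. x powi u * y powi v) = chb k x * chb l y" for k l
    unfolding chb_def sum_product sum.cartesian_product ..
  show ?thesis
  proof (cases "i = j")
    case True
    then show ?thesis using p[of j j] by (simp add: orbit_sum_def o[unfolded True])
  next
    case False
    then have "(chb_exps i \<times> chb_exps j) \<inter> (chb_exps j \<times> chb_exps i) = {}" by (auto simp: chb_exps_def)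
    then have "orbit_sum (i, j) x y = (\<Sum>(u, v)\<in>chb_exps i \<times> chb_exps j. x powi u * y powi v)
       + (\<Sum>(u, v)\<in>chb_exps j \<times> chb_exps i. x powi u * y powi v)"
      unfolding orbit_sum_def o using f by (intro sum.union_disjoint finite_cartesian_product) auto
    then show ?thesis using False by (simp add: p)
  qed
qed

lemma orbit_sum_symmetrized:
  "chb i x * chb j y + chb j x * chb i y = (if i = j then 2 else 1) * orbit_sum (dec_pair (i, j)) x y"
  unfolding dec_pair_def orbit_sum_chb by (auto simp: max_def min_def)

text \<open>The three-term recurrence; the coefficient 2 reflects that \<open>chb 0\<close> is 1 and not 2.\<close>

lemma csum_chb:
  assumes "x \<noteq> 0"
  shows "(x + 1 / x) * chb l x = chb (Suc l) x + (if l = 0 then 0 else (if l = 1 then 2 else 1) * chb (l - 1) x)"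
proof (cases l)
  case (Suc m)
  show ?thesis
  proof (cases "m = 0")
    case False
    then show ?thesis using assms by (simp add: Suc chb_pos field_simps)
  qed (use assms in \<open>simp add: Suc chb_pos field_simps\<close>)
qed (simp add: chb_pos inverse_eq_divide)

lemma chb_expansion:
  fixes \<alpha> \<beta> :: "nat \<Rightarrow> complex"
  shows "\<exists>g. (\<forall>l>d. g l = 0) \<and> g d = (\<Prod>r<d. \<beta> r) \<and>
     (\<forall>x. x \<noteq> 0 \<longrightarrow> (\<Prod>r<d. \<alpha> r + \<beta> r * (x + 1 / x)) = (\<Sum>l\<le>d. g l * chb l x))"
proof (induction d)
  case 0
  show ?case by (rule exI[of _ "\<lambda>l. if l = 0 then 1 else 0"]) auto
next
  case (Suc d)
  then obtain g where g: "\<And>l. d < l \<Longrightarrow> g l = 0" "g d = (\<Prod>r<d. \<beta> r)"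
    and e: "\<And>x. x \<noteq> 0 \<Longrightarrow> (\<Prod>r<d. \<alpha> r + \<beta> r * (x + 1 / x)) = (\<Sum>l\<le>d. g l * chb l x)" by blast
  define up where "up l = (if l = 0 then 0 else g (l - 1))" for l
  define down where "down l = (if l = 0 then 2 else 1) * g (Suc l)" for l :: nat
  show ?case
  proof (intro exI[of _ "\<lambda>l. \<alpha> d * g l + \<beta> d * (up l + down l)"] conjI allI impI)
    fix x :: complex assume x: "x \<noteq> 0"
    have 1: "(\<Sum>l\<le>d. g l * chb l x) = (\<Sum>l\<le>Suc d. g l * chb l x)" by (simp add: g)
    have 2: "(\<Sum>l\<le>d. g l * chb (Suc l) x) = (\<Sum>l\<le>Suc d. up l * chb l x)"
      by (subst sum.atMost_Suc_shift) (simp add: up_def)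
    define h where "h l = g l * (if l = 0 then 0 else (if l = 1 then 2 else 1) * chb (l - 1) x)" for l
    have "(\<Sum>l\<le>d. h l) = (\<Sum>l\<le>Suc (Suc d). h l)" by (simp add: g h_def)
    also have "\<dots> = h 0 + (\<Sum>l\<le>Suc d. h (Suc l))" by (rule sum.atMost_Suc_shift)
    also have "\<dots> = (\<Sum>l\<le>Suc d. down l * chb l x)"
      by (simp add: h_def down_def del: sum.atMost_Suc) (intro sum.cong refl, auto)
    finally have 3: "(\<Sum>l\<le>d. h l) = (\<Sum>l\<le>Suc d. down l * chb l x)" .
    have "(x + 1 / x) * (\<Sum>l\<le>d. g l * chb l x) = (\<Sum>l\<le>d. g l * ((x + 1 / x) * chb l x))"
      by (simp add: sum_distrib_left mult_ac)
    also have "\<dots> = (\<Sum>l\<le>d. g l * chb (Suc l) x) + (\<Sum>l\<le>d. h l)"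
      unfolding csum_chb[OF x] h_def by (simp only: distrib_left sum.distrib)
    finally have 4: "(x + 1 / x) * (\<Sum>l\<le>d. g l * chb l x) = (\<Sum>l\<le>Suc d. up l * chb l x) + (\<Sum>l\<le>Suc d. down l * chb l x)"
      unfolding 2 3 .
    have "(\<Prod>r<Suc d. \<alpha> r + \<beta> r * (x + 1 / x)) =
        \<alpha> d * (\<Sum>l\<le>d. g l * chb l x) + \<beta> d * ((x + 1 / x) * (\<Sum>l\<le>d. g l * chb l x))"
      by (simp add: e[OF x]) (simp add: algebra_simps)
    also have "\<dots> = (\<Sum>l\<le>Suc d. (\<alpha> d * g l + \<beta> d * (up l + down l)) * chb l x)"
      unfolding 4 unfolding 1 by (simp add: sum_distrib_left sum.distrib algebra_simps del: sum.atMost_Suc)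
    finally show "(\<Prod>r<Suc d. \<alpha> r + \<beta> r * (x + 1 / x)) =
        (\<Sum>l\<le>Suc d. (\<alpha> d * g l + \<beta> d * (up l + down l)) * chb l x)" .
  qed (use g in \<open>auto simp: up_def down_def\<close>)
qed

text \<open>After multiplication by \<open>x\<^sup>d\<close> the combination is a polynomial with infinitely many roots, and its
  coefficient at degree \<open>d + k\<close> is \<open>g k\<close>.\<close>

lemma chb_independent:
  assumes "infinite X" "\<And>x. x \<in> X \<Longrightarrow> x \<noteq> 0 \<and> (\<Sum>l\<le>d. g l * chb l x) = 0" "k \<le> d"
  shows "g k = 0"
proof -
  define p where "p = (\<Sum>l\<le>d. monom (g l) (d + l) + (if l = 0 then 0 else monom (g l) (d - l)))"
  have ev: "poly p x = x ^ d * (\<Sum>l\<le>d. g l * chb l x)" if "x \<noteq> 0" for x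
    unfolding p_def poly_sum sum_distrib_left
  proof (rule sum.cong[OF refl])
    fix l assume l: "l \<in> {..d}"
    then have "x ^ d = x ^ l * x ^ (d - l)" by (simp flip: power_add)
    then show "poly (monom (g l) (d + l) + (if l = 0 then 0 else monom (g l) (d - l))) x = x ^ d * (g l * chb l x)"
      using that by (cases "l = 0") (auto simp: poly_monom chb_pos power_add field_simps)
  qed
  have "X \<subseteq> {x. poly p x = 0}" using assms(2) ev by auto
  then have "p = 0" using assms(1) poly_roots_finite[of p] finite_subset by blast
  have "coeff p (d + k) = (\<Sum>l\<le>d. if l = k then g l else 0)"
    unfolding p_def coeff_sum by (intro sum.cong refl) auto
  then show ?thesis using assms(3) \<open>p = 0\<close> by (simp add: sum.delta)
qed

lemma finite_strictly_below [simp]: "finite (strictly_below l)"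
  by (rule finite_subset[of _ "{..fst l} \<times> {..fst l + snd l}"]) (auto simp: strictly_below_def dom_le_def)

lemma dec_pair_eq_iff: "l2 \<le> l1 \<Longrightarrow> dec_pair (i, j) = (l1, l2) \<longleftrightarrow> (i, j) = (l1, l2) \<or> (i, j) = (l2, l1)"
  by (auto simp: dec_pair_def)

text \<open>In terms of the products \<open>chb i x * chb j y\<close> the coefficients are those of the orbit sums, repeated
  symmetrically; so independence can be shown in one variable after the other. The set for \<open>y\<close> may depend on
  \<open>x\<close>, because genericity does.\<close>

lemma orbit_sums_independent:
  assumes S: "finite S" "S \<subseteq> partitions2"
    and X: "infinite X" "0 \<notin> X" and Y: "\<And>x. x \<in> X \<Longrightarrow> infinite (Y x)" "\<And>x. x \<in> X \<Longrightarrow> 0 \<notin> Y x"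
    and zero: "\<And>x y. x \<in> X \<Longrightarrow> y \<in> Y x \<Longrightarrow> (\<Sum>m\<in>S. d m * orbit_sum m x y) = 0"
    and "m \<in> S"
  shows "d m = 0"
proof -
  define M where "M = (\<Sum>m\<in>S. fst m)"
  have M: "fst m \<le> M" if "m \<in> S" for m unfolding M_def using that S(1) by (intro member_le_sum) auto
  define e where "e i j = (if dec_pair (i, j) \<in> S then d (dec_pair (i, j)) else 0)" for i j
  have exp: "(\<Sum>m\<in>S. d m * orbit_sum m x y) = (\<Sum>j\<le>M. (\<Sum>i\<le>M. e i j * chb i x) * chb j y)" for x y
  proof -
    define T where "T = {p \<in> {..M} \<times> {..M}. dec_pair p \<in> S}"
    define h where "h p = e (fst p) (snd p) * (chb (fst p) x * chb (snd p) y)" for p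
    have inner: "(\<Sum>p\<in>{p \<in> T. dec_pair p = m}. h p) = d m * orbit_sum m x y" if mS: "m \<in> S" for m
    proof -
      obtain m1 m2 where m: "m = (m1, m2)" "m2 \<le> m1" using mS S(2) unfolding partitions2_def by (cases m) auto
      have "{p \<in> T. dec_pair p = m} = {(m1, m2), (m2, m1)}"
        using M[OF mS] mS m unfolding T_def by (auto simp: dec_pair_def)
      moreover have "dec_pair (m1, m2) = m" "dec_pair (m2, m1) = m" using m by (auto simp: dec_pair_def)
      ultimately show ?thesis
        using mS by (cases "m1 = m2") (auto simp: h_def e_def m(1) orbit_sum_chb algebra_simps)
    qed
    have "(\<Sum>m\<in>S. d m * orbit_sum m x y) = (\<Sum>m\<in>S. \<Sum>p\<in>{p \<in> T. dec_pair p = m}. h p)"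
      by (simp add: inner)
    also have "\<dots> = (\<Sum>p\<in>T. h p)"
      using S(1) by (intro sum.group) (auto simp: T_def)
    also have "\<dots> = (\<Sum>p\<in>{..M} \<times> {..M}. h p)"
      by (rule sum.mono_neutral_left) (auto simp: T_def h_def e_def)
    also have "\<dots> = (\<Sum>i\<le>M. \<Sum>j\<le>M. h (i, j))" by (simp add: sum.cartesian_product)
    also have "\<dots> = (\<Sum>j\<le>M. \<Sum>i\<le>M. h (i, j))" by (rule sum.swap)
    finally show ?thesis by (simp add: h_def sum_distrib_right mult.assoc)
  qed
  have x: "(\<Sum>i\<le>M. e i j * chb i x) = 0" if "x \<in> X" "j \<le> M" for x j
    by (rule chb_independent[OF Y(1)[OF that(1)], where g = "\<lambda>j. \<Sum>i\<le>M. e i j * chb i x" and d = M])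
      (use zero that Y(2) in \<open>auto simp: exp\<close>)
  have e: "e i j = 0" if "i \<le> M" "j \<le> M" for i j
    by (rule chb_independent[OF X(1), where g = "\<lambda>i. e i j" and d = M]) (use x X(2) that in auto)
  obtain m1 m2 where m: "m = (m1, m2)" "m2 \<le> m1" using assms(8) S(2) unfolding partitions2_def by (cases m) auto
  then show ?thesis using e[of m1 m2] M[OF assms(8)] assms(8) by (simp add: e_def dec_pair_def max_absorb1 min_absorb2)
qed

context koornwinder_coeffs
begin

lemma prod_leading: "(\<Prod>r<k. - (q ^ r * c)) = (- c) ^ k * q ^ tri k"
  by (induction k) (auto simp: tri_def[of 0] tri_Suc power_add)

lemma facs_expansion:
  fixes al al' u v :: complex
  assumes "k \<le> l"
  shows "\<exists>g. (\<forall>x. x \<noteq> 0 \<longrightarrow> facs al 0 i (b * csum x) * facs al' k l (s * (b * csum x)) = (\<Sum>m\<le>i + (l - k). g m * chb m x)) \<and>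
     g (i + (l - k)) = (\<Prod>r<i. - (q ^ r * b)) * (\<Prod>r\<in>{k..<l}. - (q ^ r * (s * b)))"
proof -
  define \<alpha> where "\<alpha> r = (if r < i then 1 + al * (q ^ r)\<^sup>2 else 1 + al' * (q ^ (r - i + k))\<^sup>2)" for r
  define \<beta> where "\<beta> r = (if r < i then - (q ^ r * b) else - (q ^ (r - i + k) * (s * b)))" for r
  have split: "(\<Prod>r<i. f r) * (\<Prod>r\<in>{k..<l}. g r) = (\<Prod>r<i + (l - k). if r < i then f r else g (r - i + k))"
    for f g :: "nat \<Rightarrow> complex"
  proof -
    have "(\<Prod>r<i + (l - k). if r < i then f r else g (r - i + k)) =
      (\<Prod>r\<in>{0..<i}. if r < i then f r else g (r - i + k)) * (\<Prod>r\<in>{i..<i + (l - k)}. if r < i then f r else g (r - i + k))"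
      by (subst prod.atLeastLessThan_concat) (auto simp: atLeast0LessThan)
    also have "(\<Prod>r\<in>{0..<i}. if r < i then f r else g (r - i + k)) = (\<Prod>r<i. f r)"
      by (simp add: atLeast0LessThan)
    also have "(\<Prod>r\<in>{i..<i + (l - k)}. if r < i then f r else g (r - i + k)) = (\<Prod>r\<in>{i..<i + (l - k)}. g (r - i + k))"
      by (intro prod.cong) auto
    also have "\<dots> = (\<Prod>r\<in>{k..<l}. g r)"
      by (rule prod.reindex_bij_witness[of _ "\<lambda>r. r - k + i" "\<lambda>r. r - i + k"]) (use assms in auto)
    finally show ?thesis by simp
  qed
  have "facs al 0 i (b * csum x) * facs al' k l (s * (b * csum x)) = (\<Prod>r<i + (l - k). \<alpha> r + \<beta> r * (x + 1 / x))" for x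
    unfolding facs_def atLeast0LessThan split
    by (intro prod.cong refl) (simp add: \<alpha>_def \<beta>_def linfac_def csum_def algebra_simps)
  moreover have "(\<Prod>r<i + (l - k). \<beta> r) = (\<Prod>r<i. - (q ^ r * b)) * (\<Prod>r\<in>{k..<l}. - (q ^ r * (s * b)))"
    unfolding split \<beta>_def ..
  ultimately show ?thesis using chb_expansion[of "i + (l - k)" \<beta> \<alpha>] by auto
qed

end

section \<open>Triangularity\<close>

definition below :: "nat \<times> nat \<Rightarrow> (nat \<times> nat) set" where
  "below l = insert l (strictly_below l)"

lemma finite_below [simp]: "finite (below l)" by (simp add: below_def)

lemma below_iff: "l \<in> partitions2 \<Longrightarrow> m \<in> below l \<longleftrightarrow> m \<in> partitions2 \<and> dom_le m l"
  by (auto simp: below_def strictly_below_def dom_le_def)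

context koornwinder_coeffs
begin

text \<open>Each term of \<open>interp\<close> is a product of \<open>k1 - j\<close> linear factors in \<open>x + 1 / x\<close> and \<open>k2 + j\<close> linear
  factors in \<open>y + 1 / y\<close>, so it only involves \<open>chb i x * chb l y\<close> with \<open>i \<le> k1 - j\<close> and \<open>l \<le> k2 + j\<close>.
  Averaging over the exchange of \<open>x\<close> and \<open>y\<close>, which \<open>Npol_commute\<close> permits, turns these products into orbit
  sums. The pair \<open>(k1, k2)\<close> comes from \<open>j = 0\<close>, the pair \<open>(k2, k1)\<close> from \<open>j = k1 - k2\<close>, and both top
  coefficients are the same.\<close>

lemma Npol_orbit_sums:
  assumes k: "k2 \<le> k1"
  shows "\<exists>v. v (k1, k2) = qV (k1 - k2) * ((- t) ^ (k1 - k2) * a ^ (k1 + k2) * (q ^ tri k1 * q ^ tri k2)) \<and>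
    (\<forall>m. m \<notin> below (k1, k2) \<longrightarrow> v m = 0) \<and>
    (\<forall>x y. x \<noteq> 0 \<longrightarrow> y \<noteq> 0 \<longrightarrow> Npol k1 k2 x y = (\<Sum>m\<in>below (k1, k2). v m * orbit_sum m x y))"
proof -
  define n where "n = k1 - k2"
  have k1: "k1 = k2 + n" using k by (simp add: n_def)
  \<comment> \<open>\<open>g j\<close> and \<open>h j\<close> expand the factors in \<open>x\<close> and in \<open>y\<close> of the \<open>j\<close>-th term.\<close>
  have "\<forall>j. \<exists>g. j \<le> n \<longrightarrow> (\<forall>x. x \<noteq> 0 \<longrightarrow> facs (a\<^sup>2) 0 k2 (a * csum x) * facs (t\<^sup>2 * a\<^sup>2) (k2 + j) k1 (t * (a * csum x)) = (\<Sum>m\<le>k1 - j. g m * chb m x)) \<and>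
     g (k1 - j) = (\<Prod>r<k2. - (q ^ r * a)) * (\<Prod>r\<in>{k2 + j..<k1}. - (q ^ r * (t * a)))"
  proof
    fix j
    show "\<exists>g. j \<le> n \<longrightarrow> (\<forall>x. x \<noteq> 0 \<longrightarrow> facs (a\<^sup>2) 0 k2 (a * csum x) * facs (t\<^sup>2 * a\<^sup>2) (k2 + j) k1 (t * (a * csum x)) = (\<Sum>m\<le>k1 - j. g m * chb m x)) \<and>
     g (k1 - j) = (\<Prod>r<k2. - (q ^ r * a)) * (\<Prod>r\<in>{k2 + j..<k1}. - (q ^ r * (t * a)))"
    proof (cases "j \<le> n")
      case True
      then have "k2 + j \<le> k1" "k2 + (k1 - (k2 + j)) = k1 - j" by (auto simp: k1)
      then show ?thesis using facs_expansion[of "k2 + j" k1 "a\<^sup>2" k2 a "t\<^sup>2 * a\<^sup>2" t] by simp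
    qed simp
  qed
  then obtain g where g: "\<And>j x. j \<le> n \<Longrightarrow> x \<noteq> 0 \<Longrightarrow>
      facs (a\<^sup>2) 0 k2 (a * csum x) * facs (t\<^sup>2 * a\<^sup>2) (k2 + j) k1 (t * (a * csum x)) = (\<Sum>m\<le>k1 - j. g j m * chb m x)"
    and g_top: "\<And>j. j \<le> n \<Longrightarrow> g j (k1 - j) = (\<Prod>r<k2. - (q ^ r * a)) * (\<Prod>r\<in>{k2 + j..<k1}. - (q ^ r * (t * a)))"
    unfolding choice_iff by blast
  have "\<forall>j. \<exists>h. (\<forall>y. y \<noteq> 0 \<longrightarrow> facs (a\<^sup>2) 0 (k2 + j) (a * csum y) = (\<Sum>m\<le>k2 + j. h m * chb m y)) \<and>
     h (k2 + j) = (\<Prod>r<k2 + j. - (q ^ r * a))"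
    using facs_expansion[of 0 0 "a\<^sup>2" _ a "a\<^sup>2" 1] by simp
  then obtain h where h: "\<And>j y. y \<noteq> 0 \<Longrightarrow> facs (a\<^sup>2) 0 (k2 + j) (a * csum y) = (\<Sum>m\<le>k2 + j. h j m * chb m y)"
    and h_top: "\<And>j. h j (k2 + j) = (\<Prod>r<k2 + j. - (q ^ r * a))"
    unfolding choice_iff by blast
  define J where "J = Sigma {..n} (\<lambda>j. {..k1 - j} \<times> {..k2 + j})"
  define H where "H p = (case p of (j, i, l) \<Rightarrow> qV j * qV (n - j) * t ^ j * g j i * h j l)" for p
  define \<kappa> :: "nat \<times> nat \<times> nat \<Rightarrow> complex" where "\<kappa> p = (if fst (snd p) = snd (snd p) then 2 else 1)" for p
  define v where "v m = (\<Sum>p\<in>{p \<in> J. dec_pair (snd p) = m}. H p * \<kappa> p) / 2" for m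
  have J: "finite J" unfolding J_def by (intro finite_SigmaI) auto
  have exp: "Npol k1 k2 x y = (\<Sum>p\<in>J. H p * (chb (fst (snd p)) x * chb (snd (snd p)) y))" if "x \<noteq> 0" "y \<noteq> 0" for x y
  proof -
    have "Npol k1 k2 x y = (\<Sum>j\<le>n. qV j * qV (n - j) * t ^ j * (facs (a\<^sup>2) 0 k2 (a * csum x) * facs (t\<^sup>2 * a\<^sup>2) (k2 + j) k1 (t * (a * csum x)))
        * facs (a\<^sup>2) 0 (k2 + j) (a * csum y))"
      unfolding Npol_def interp_expand[OF k] n_def[symmetric] sum_distrib_left by (simp only: ac_simps)
    also have "\<dots> = (\<Sum>j\<le>n. \<Sum>p\<in>{..k1 - j} \<times> {..k2 + j}. H (j, p) * (chb (fst p) x * chb (snd p) y))"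
    proof (rule sum.cong[OF refl])
      fix j assume "j \<in> {..n}"
      then have j: "j \<le> n" by simp
      have "qV j * qV (n - j) * t ^ j * (\<Sum>m\<le>k1 - j. g j m * chb m x) * (\<Sum>m\<le>k2 + j. h j m * chb m y) =
         (\<Sum>i\<le>k1 - j. \<Sum>l\<le>k2 + j. H (j, i, l) * (chb i x * chb l y))"
        unfolding mult.assoc sum_product unfolding sum_distrib_left H_def by (simp add: mult_ac)
      then show "qV j * qV (n - j) * t ^ j * (facs (a\<^sup>2) 0 k2 (a * csum x) * facs (t\<^sup>2 * a\<^sup>2) (k2 + j) k1 (t * (a * csum x)))
        * facs (a\<^sup>2) 0 (k2 + j) (a * csum y) = (\<Sum>p\<in>{..k1 - j} \<times> {..k2 + j}. H (j, p) * (chb (fst p) x * chb (snd p) y))"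
        unfolding g[OF j that(1)] h[OF that(2)] by (simp add: sum.cartesian_product case_prod_beta)
    qed
    also have "\<dots> = (\<Sum>p\<in>J. H p * (chb (fst (snd p)) x * chb (snd (snd p)) y))"
      unfolding J_def by (subst sum.Sigma) (auto intro!: sum.cong)
    finally show ?thesis .
  qed
  have B: "(\<lambda>p. dec_pair (snd p)) ` J \<subseteq> below (k1, k2)"
  proof -
    have "(k1, k2) \<in> partitions2" using k by (simp add: partitions2_def)
    then show ?thesis
      by (auto simp: below_iff J_def dec_pair_def partitions2_def dom_le_def k1)
  qed
  have v0: "v m = 0" if "m \<notin> below (k1, k2)" for m
  proof -
    have "{p \<in> J. dec_pair (snd p) = m} = {}" using B that by auto
    then show ?thesis by (simp only: v_def sum.empty) simp
  qed
  have main: "Npol k1 k2 x y = (\<Sum>m\<in>below (k1, k2). v m * orbit_sum m x y)" if "x \<noteq> 0" "y \<noteq> 0" for x y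
  proof -
    have "2 * Npol k1 k2 x y = Npol k1 k2 x y + Npol k1 k2 y x" by (simp add: Npol_commute[of _ _ y])
    also have "\<dots> = (\<Sum>p\<in>J. H p * (chb (fst (snd p)) x * chb (snd (snd p)) y + chb (snd (snd p)) x * chb (fst (snd p)) y))"
      unfolding exp[OF that] exp[OF that(2,1)] by (simp add: sum.distrib distrib_left mult_ac)
    also have "\<dots> = (\<Sum>p\<in>J. H p * \<kappa> p * orbit_sum (dec_pair (snd p)) x y)"
      unfolding orbit_sum_symmetrized \<kappa>_def by (simp add: mult.assoc)
    also have "\<dots> = (\<Sum>m\<in>below (k1, k2). \<Sum>p\<in>{p \<in> J. dec_pair (snd p) = m}. H p * \<kappa> p * orbit_sum (dec_pair (snd p)) x y)"
      using sum.group[OF J finite_below B, of "\<lambda>p. H p * \<kappa> p * orbit_sum (dec_pair (snd p)) x y"] by simp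
    also have "\<dots> = (\<Sum>m\<in>below (k1, k2). 2 * (v m * orbit_sum m x y))"
      by (intro sum.cong refl) (simp add: v_def sum_distrib_right)
    finally show ?thesis by (simp flip: sum_distrib_left)
  qed
  define L where "L = qV n * ((- t) ^ n * a ^ (k1 + k2) * (q ^ tri k1 * q ^ tri k2))"
  have sq: "(- a) ^ k2 * (- a) ^ k2 = a ^ k2 * a ^ k2" by (simp flip: power_mult_distrib)
  have H0: "H (0, k1, k2) = L"
  proof -
    have "(\<Prod>r<k2. - (q ^ r * (t * a))) * (\<Prod>r\<in>{k2..<k1}. - (q ^ r * (t * a))) = (\<Prod>r<k1. - (q ^ r * (t * a)))"
      using prod.atLeastLessThan_concat[of 0 k2 k1] k by (simp add: atLeast0LessThan)
    then have "(\<Prod>r\<in>{k2..<k1}. - (q ^ r * (t * a))) * q ^ tri k2 = (- (t * a)) ^ n * q ^ tri k1"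
      unfolding prod_leading using t_nz a_nz by (simp add: k1 power_add mult_ac)
    moreover have "(- (t * a)) ^ n = (- t) ^ n * a ^ n" by (simp flip: power_mult_distrib)
    ultimately have z: "(\<Prod>r\<in>{k2..<k1}. - (q ^ r * (t * a))) * q ^ tri k2 = (- t) ^ n * a ^ n * q ^ tri k1"
      by (simp only:)
    have "(- a) ^ k2 * q ^ tri k2 * (\<Prod>r\<in>{k2..<k1}. - (q ^ r * (t * a))) * ((- a) ^ k2 * q ^ tri k2)
        = (- a) ^ k2 * (- a) ^ k2 * ((\<Prod>r\<in>{k2..<k1}. - (q ^ r * (t * a))) * q ^ tri k2) * q ^ tri k2"
      by (simp only: ac_simps)
    also have "\<dots> = (- t) ^ n * a ^ (k1 + k2) * (q ^ tri k1 * q ^ tri k2)"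
      unfolding z sq by (simp add: k1 power_add mult_ac)
    finally have "(- a) ^ k2 * q ^ tri k2 * (\<Prod>r\<in>{k2..<k1}. - (q ^ r * (t * a))) * ((- a) ^ k2 * q ^ tri k2)
        = (- t) ^ n * a ^ (k1 + k2) * (q ^ tri k1 * q ^ tri k2)" .
    then show ?thesis using g_top[of 0] h_top[of 0]
      by (simp add: H_def L_def prod_leading qV_0 mult.assoc)
  qed
  have Hn: "H (n, k2, k1) = L"
  proof -
    have e: "k1 - n = k2" "k2 + n = k1" by (auto simp: k1)
    have "t ^ n * (- a) ^ n = (- t) ^ n * a ^ n" by (simp flip: power_mult_distrib)
    then have e1: "t ^ n * (- a) ^ n * ((- a) ^ k2 * (- a) ^ k2) = (- t) ^ n * a ^ (k1 + k2)"
      unfolding sq by (simp add: k1 power_add mult_ac)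
    have "t ^ n * ((- a) ^ k2 * q ^ tri k2) * ((- a) ^ k1 * q ^ tri k1)
       = t ^ n * (- a) ^ n * ((- a) ^ k2 * (- a) ^ k2) * (q ^ tri k1 * q ^ tri k2)"
      unfolding k1 power_add by (simp only: ac_simps)
    then have "t ^ n * ((- a) ^ k2 * q ^ tri k2) * ((- a) ^ k1 * q ^ tri k1) = (- t) ^ n * a ^ (k1 + k2) * (q ^ tri k1 * q ^ tri k2)"
      unfolding e1 .
    then show ?thesis using g_top[of n] h_top[of n]
      unfolding e by (simp add: H_def L_def prod_leading mult.assoc)
  qed
  have "v (k1, k2) = L"
  proof (cases "n = 0")
    case True
    have "{p \<in> J. dec_pair (snd p) = (k1, k2)} = {(0, k1, k2)}"
      using True unfolding J_def by (auto simp: k1 dec_pair_eq_iff)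
    then have "v (k1, k2) = H (0, k1, k2) * \<kappa> (0, k1, k2) / 2" by (simp add: v_def)
    moreover have "\<kappa> (0, k1, k2) = 2" using True by (simp add: \<kappa>_def k1)
    ultimately show ?thesis by (simp only: H0) simp
  next
    case False
    have "{p \<in> J. dec_pair (snd p) = (k1, k2)} = {(0, k1, k2), (n, k2, k1)}"
      using False unfolding J_def by (auto simp: k1 dec_pair_eq_iff)
    then show ?thesis using False by (simp add: v_def H0 Hn \<kappa>_def) (simp add: k1)
  qed
  then show ?thesis using v0 main unfolding L_def n_def by blast
qed

end

context koornwinder_product
begin

text \<open>On the diagonal \<open>Qcoeff\<close> is 1: the parameter \<open>q\<^sup>0\<close> kills all terms of its series but the first. Hence the
  coefficient of \<open>N\<close> with index \<open>m\<close> in the formula is \<open>1 / E\<^sub>m\<close>, and \<open>N\<close> is monic.\<close>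

lemma wt_dual_diagonal:
  assumes k: "k2 \<le> k1" and A: "Apar q a = A" and a: "a 1 = b1" "a 2 = b2" "a 3 = b3" "a 4 = b4"
  shows "Evalue q t a k1 k2 * (wt k1 k2 * dual k1 k2 k1 k2 *
     (qV (k1 - k2) * ((- t) ^ (k1 - k2) * b1 ^ (k1 + k2) * (q ^ tri k1 * q ^ tri k2)))) = 1"
proof -
  have "wt k1 k2 \<noteq> 0" unfolding wt_def using wt_core_nz pairs_nz q_nz t_nz by simp
  then have Qd: "Qden k1 k2 \<noteq> 0" unfolding Evalue_Qden(2)[OF assms] by auto
  have "phi43 q n t B (q powi 0) c1 c2 c3 = 1" for n B c1 c2 c3
  proof -
    have z: "qpoch 1 q j = 0" if "0 < j" for j using that by (auto simp: qpoch_def intro!: bexI[of _ 0])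
    have "phi43 q n t B (q powi 0) c1 c2 c3 = (\<Sum>j\<le>n. if j = 0 then 1 else 0)"
      unfolding phi43_def by (intro sum.cong refl) (auto simp: qpochs_def z)
    then show ?thesis by simp
  qed
  then have "Qcoeff q t a k1 k2 k1 k2 = 1"
    using Qd unfolding Qcoeff_def Let_def A Qden_def by simp
  then have d: "dual k1 k2 k1 k2 = qV (k1 - k2) * Qden k1 k2"
    using Qcoeff_dual[OF k order_refl order_refl A] Qd qV_nz by (simp add: divide_eq_1_iff)
  have nz: "q ^ tri k1 * q ^ tri k2 * ((- t) ^ (k1 - k2) * b1 ^ (k1 + k2)) \<noteq> 0"
    using q_nz t_nz a_nz by simp
  show ?thesis
    unfolding Evalue_Qden(2)[OF assms] d
    using nz Qd qV_nz[of "k1 - k2"] Evalue_Qden(1)[OF assms]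
    by (simp add: divide_simps)
qed

text \<open>Only the term with \<open>k = (m1, m2)\<close> reaches the top orbit sum, since every other \<open>k\<close> in the range is
  strictly below it.\<close>

theorem binom_sum_triangular:
  assumes m: "m2 \<le> m1" and A: "Apar q a = A" and a: "a 1 = b1" "a 2 = b2" "a 3 = b3" "a 4 = b4"
  shows "\<exists>u. \<forall>x y. x \<noteq> 0 \<longrightarrow> y \<noteq> 0 \<longrightarrow> Evalue q t a m1 m2 * binom_sum m1 m2 x y
     = orbit_sum (m1, m2) x y + (\<Sum>m\<in>strictly_below (m1, m2). u m * orbit_sum m x y)"
proof -
  define E where "E = Evalue q t a m1 m2"
  define K where "K = {k \<in> {..m1} \<times> {..m2}. snd k \<le> fst k}"
  define B where "B = below (m1, m2)"
  define w where "w k = wt (fst k) (snd k) * dual (fst k) (snd k) m1 m2" for k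
  define L where "L k = qV (fst k - snd k) * ((- t) ^ (fst k - snd k) * b1 ^ (fst k + snd k) * (q ^ tri (fst k) * q ^ tri (snd k)))" for k
  have P: "(m1, m2) \<in> partitions2" using m by (simp add: partitions2_def)
  have KP: "k \<in> partitions2" if "k \<in> K" for k using that by (auto simp: K_def partitions2_def)
  have "\<forall>k. \<exists>v. snd k \<le> fst k \<longrightarrow> v k = L k \<and> (\<forall>m. m \<notin> below k \<longrightarrow> v m = 0) \<and>
    (\<forall>x y. x \<noteq> 0 \<longrightarrow> y \<noteq> 0 \<longrightarrow> Npol (fst k) (snd k) x y = (\<Sum>m\<in>below k. v m * orbit_sum m x y))"
    proof
    fix k :: "nat \<times> nat"
    show "\<exists>v. snd k \<le> fst k \<longrightarrow> v k = L k \<and> (\<forall>m. m \<notin> below k \<longrightarrow> v m = 0) \<and>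
      (\<forall>x y. x \<noteq> 0 \<longrightarrow> y \<noteq> 0 \<longrightarrow> Npol (fst k) (snd k) x y = (\<Sum>m\<in>below k. v m * orbit_sum m x y))"
      using Npol_orbit_sums[of "snd k" "fst k"] unfolding L_def prod.collapse by blast
  qed
  then obtain v where v: "\<And>k. snd k \<le> fst k \<Longrightarrow> v k k = L k" "\<And>k m. snd k \<le> fst k \<Longrightarrow> m \<notin> below k \<Longrightarrow> v k m = 0"
    "\<And>k x y. snd k \<le> fst k \<Longrightarrow> x \<noteq> 0 \<Longrightarrow> y \<noteq> 0 \<Longrightarrow> Npol (fst k) (snd k) x y = (\<Sum>m\<in>below k. v k m * orbit_sum m x y)"
    unfolding choice_iff by blast
  have sub: "below k \<subseteq> B" if "k \<in> K" for k
    using that unfolding B_def subset_iff below_iff[OF P] below_iff[OF KP[OF that]] by (auto simp: dom_le_def K_def)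
  have lam: "v k (m1, m2) = 0" if "k \<in> K" "k \<noteq> (m1, m2)" for k
  proof (rule v(2))
    show "(m1, m2) \<notin> below k"
      using that unfolding below_iff[OF KP[OF that(1)]] by (auto simp: dom_le_def K_def)
  qed (use that in \<open>auto simp: K_def\<close>)
  define c where "c m = E * (\<Sum>k\<in>K. w k * v k m)" for m
  have "c (m1, m2) = E * (\<Sum>k\<in>K. if k = (m1, m2) then w k * v k (m1, m2) else 0)"
    unfolding c_def by (intro arg_cong2[where f = "(*)"] sum.cong refl) (auto simp: lam)
  also have "\<dots> = E * (w (m1, m2) * v (m1, m2) (m1, m2))"
    using m by (simp add: sum.delta K_def)
  also have "\<dots> = 1"
    using wt_dual_diagonal[OF assms] m by (simp add: w_def v(1) L_def E_def mult.assoc)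
  finally have c1: "c (m1, m2) = 1" .
  have "E * binom_sum m1 m2 x y = orbit_sum (m1, m2) x y + (\<Sum>m\<in>strictly_below (m1, m2). c m * orbit_sum m x y)"
    if xy: "x \<noteq> 0" "y \<noteq> 0" for x y
  proof -
    have "binom_sum m1 m2 x y = (\<Sum>k\<in>K. w k * Npol (fst k) (snd k) x y)"
      unfolding binom_sum_def case_prod_beta w_def
    proof (rule sum.mono_neutral_right)
      show "\<forall>k\<in>{..m1} \<times> {..m2} - K. wt (fst k) (snd k) * dual (fst k) (snd k) m1 m2 * Npol (fst k) (snd k) x y = 0"
      proof
        fix k assume "k \<in> {..m1} \<times> {..m2} - K"
        then have "fst k < snd k" by (auto simp: K_def mem_Times_iff not_le)
        then show "wt (fst k) (snd k) * dual (fst k) (snd k) m1 m2 * Npol (fst k) (snd k) x y = 0" by (simp add: Npol_eq_0)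
      qed
    qed (auto simp: K_def)
    also have "\<dots> = (\<Sum>k\<in>K. w k * (\<Sum>m\<in>B. v k m * orbit_sum m x y))"
    proof (intro sum.cong arg_cong2[where f = "(*)"] refl)
      fix k assume k: "k \<in> K"
      then have "snd k \<le> fst k" by (simp add: K_def)
      then show "Npol (fst k) (snd k) x y = (\<Sum>m\<in>B. v k m * orbit_sum m x y)"
        unfolding v(3)[OF \<open>snd k \<le> fst k\<close> xy]
        by (intro sum.mono_neutral_left sub[OF k]) (auto simp: B_def v(2))
    qed
    also have "\<dots> = (\<Sum>m\<in>B. (\<Sum>k\<in>K. w k * v k m) * orbit_sum m x y)"
      unfolding sum_distrib_left sum_distrib_right by (subst sum.swap) (simp only: mult.assoc)
    finally have b: "binom_sum m1 m2 x y = (\<Sum>m\<in>B. (\<Sum>k\<in>K. w k * v k m) * orbit_sum m x y)" .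
    have "E * binom_sum m1 m2 x y = (\<Sum>m\<in>B. c m * orbit_sum m x y)"
      unfolding b c_def mult.assoc by (rule sum_distrib_left)
    also have "\<dots> = orbit_sum (m1, m2) x y + (\<Sum>m\<in>strictly_below (m1, m2). c m * orbit_sum m x y)"
    proof -
      have "(m1, m2) \<notin> strictly_below (m1, m2)" by (simp add: strictly_below_def)
      then show ?thesis by (simp add: B_def below_def c1)
    qed
    finally show ?thesis .
  qed
  then show ?thesis unfolding E_def by blast
qed

end

section \<open>Identification of the Koornwinder polynomial\<close>

lemma infinite_circle: "infinite {x :: complex. norm x = 1}"
proof
  assume "finite {x :: complex. norm x = 1}"
  then have "finite {s \<in> {0..1}. ep s \<in> {x. norm x = 1}}" by (rule finite_ep_vimage)
  moreover have "{s \<in> {0..1}. ep s \<in> {x. norm x = 1}} = {0..1}" by auto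
  ultimately have "finite {0..1 :: real}" by (simp only:)
  then show False using infinite_Icc[of 0 "1 :: real"] zero_less_one by blast
qed

lemma strictly_below_trans: "k \<in> strictly_below m \<Longrightarrow> m \<in> strictly_below l \<Longrightarrow> k \<in> strictly_below l"
  by (auto simp: strictly_below_def dom_le_def prod_eq_iff)

lemma strictly_below_less: "m \<in> strictly_below l \<Longrightarrow> 2 * fst m + snd m < 2 * fst l + snd l"
  by (auto simp: strictly_below_def dom_le_def prod_eq_iff)

lemma cnj_orbit_sum: "norm x = 1 \<Longrightarrow> norm y = 1 \<Longrightarrow> cnj (orbit_sum m x y) = orbit_sum m x y"
  by (cases m) (simp add: orbit_sum_chb cnj_chb)

text \<open>The two lemmas compare eigenvalues along the two kinds of steps in the dominance order: enlarging one
  part, and moving \<open>d\<close> boxes from the second part to the first. Only \<open>|A| q < 1\<close> is available: \<open>A\<close> itself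
  may have either sign and absolute value above 1.\<close>

lemma real_node_increment:
  fixes q A s :: real
  assumes q: "0 < q" "q < 1" and A: "\<bar>A\<bar> * q < 1" and s: "0 < s" "s \<le> 1" and d: "0 < d"
  shows "s * A * q ^ x + 1 / (s * q ^ x) < s * A * q ^ (x + d) + 1 / (s * q ^ (x + d))"
proof -
  define X D where "X = q ^ x" "D = q ^ d"
  have X: "0 < X" "X \<le> 1" and D: "0 < D" "D \<le> q" "D < 1"
    using q d power_decreasing[of 1 d q] by (auto simp: X_D_def power_le_one power_less_one_iff)
  have "A * D * (s * X)\<^sup>2 \<le> \<bar>A\<bar> * q * 1"
    using D q s X by (intro mult_mono) (auto intro!: mult_mono power_le_one mult_le_one)
  then have "0 < 1 - A * D * (s * X)\<^sup>2" using A by simp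
  then have "0 < (1 - D) * (1 - A * D * (s * X)\<^sup>2) / (s * X * D)" using X D s by simp
  also have "\<dots> = s * A * (X * D) + 1 / (s * (X * D)) - (s * A * X + 1 / (s * X))"
    using X D s by (simp add: divide_simps) algebra
  finally show ?thesis by (simp add: X_D_def power_add)
qed

lemma real_node_exchange:
  fixes q A t :: real
  assumes q: "0 < q" "q < 1" and A: "\<bar>A\<bar> * q < 1" and t: "0 < t" "t < 1" and d: "0 < d" and y: "y \<le> x"
  shows "(A * q ^ (y + d) + 1 / q ^ (y + d)) - (A * q ^ y + 1 / q ^ y)
    < (t * A * q ^ (x + d) + 1 / (t * q ^ (x + d))) - (t * A * q ^ x + 1 / (t * q ^ x))"
proof -
  define X Y D where "X = q ^ x" "Y = q ^ y" "D = q ^ d"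
  have X: "0 < X" "X \<le> Y" "Y \<le> 1" and D: "0 < D" "D \<le> q" "D < 1"
    using q d y power_decreasing[of 1 d q] power_decreasing[of y x q]
    by (auto simp: X_Y_D_def power_le_one power_less_one_iff)
  have "t * X < 1 * X" by (rule mult_strict_right_mono) (use t X in auto)
  then have tX: "t * X < Y" using X by linarith
  have "- (\<bar>A\<bar> * q) * 1 \<le> - (\<bar>A\<bar> * D) * (t * X * Y)"
  proof -
    have "\<bar>A\<bar> * D * (t * X * Y) \<le> \<bar>A\<bar> * q * 1"
      using D q t X by (intro mult_mono) (auto intro!: mult_mono mult_le_one)
    then show ?thesis by simp
  qed
  also have "\<dots> \<le> A * D * (t * X * Y)"
  proof -
    have "0 \<le> D * (t * X * Y)" using D t X by simp
    then have "- \<bar>A\<bar> * (D * (t * X * Y)) \<le> A * (D * (t * X * Y))" by (intro mult_right_mono) auto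
    then show ?thesis by (simp add: mult.assoc)
  qed
  finally have "0 < 1 + A * D * (t * X * Y)" using A by simp
  then have "0 < (1 - D) * (Y - t * X) * (1 + A * D * (t * X * Y)) / (t * X * Y * D)" using X D t tX by simp
  also have "\<dots> = (t * A * (X * D) + 1 / (t * (X * D))) - (t * A * X + 1 / (t * X)) - ((A * (Y * D) + 1 / (Y * D)) - (A * Y + 1 / Y))"
    using X D t by (simp add: divide_simps) algebra
  finally show ?thesis by (simp add: X_Y_D_def power_add)
qed

context koornwinder_weight
begin

lemma A_real: "A = of_real (Re A)" "\<bar>Re A\<bar> * q0 < 1"
proof -
  have "prod_mset (image_mset cnj {#b1, b2, b3, b4#}) = prod_mset {#b1, b2, b3, b4#}"
    by (simp only: cnj_b)
  then have "cnj (b1 * b2 * b3 * b4) = b1 * b2 * b3 * b4" by (simp add: mult.assoc)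
  then have "cnj A = A" unfolding A_def complex_cnj_divide cnj_q by (simp only:)
  then show A: "A = of_real (Re A)" by (metis Reals_cnj_iff of_real_Re)
  have "q * A = b1 * b2 * b3 * b4" using q_nz by (simp add: A_def)
  then have "norm (q * A) < 1" using norm_b by simp
  then have "\<bar>q0\<bar> * \<bar>Re A\<bar> < 1" by (subst (asm) A) (simp add: norm_mult q0)
  then show "\<bar>Re A\<bar> * q0 < 1" using q0 by (simp add: mult.commute)
qed

lemma q0_less: "q0 < 1" using q_less q0 by simp

context
  assumes t0_pos: "0 < t0"
begin

text \<open>The node is strictly increasing with respect to the dominance order: either both parts grow, or
  \<open>d\<close> boxes are moved up and the first part is enlarged further.\<close>

lemma eigenvalue_distinct:
  assumes "m \<in> strictly_below l" "l \<in> partitions2"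
  shows "eigenvalue (fst m) (snd m) \<noteq> eigenvalue (fst l) (snd l)"
proof -
  define R where "R = Re A"
  have R: "A = of_real R" "\<bar>R\<bar> * q0 < 1" using A_real by (simp_all add: R_def)
  define f where "f s x = s * R * q0 ^ x + 1 / (s * q0 ^ x)" for s x
  have t0_less: "t0 < 1" using t_less t0 t0_pos by simp
  have node: "node A x y = of_real (f t0 x + f 1 y)" for x y
    unfolding f_def node_def R(1) unfolding q0(1) t0 by simp
  have inc: "f s x < f s (x + d)" if "s = t0 \<or> s = 1" "0 < d" for s x d
    unfolding f_def using real_node_increment[OF q0(2) q0_less R(2), of s d x] that t0_pos t0_less by auto
  have mono: "f s x \<le> f s y" if "s = t0 \<or> s = 1" "x \<le> y" for s x y
    using inc[OF that(1), of "y - x" x] that(2) by (cases "x = y") auto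
  have smono: "f s x < f s y" if "s = t0 \<or> s = 1" "x < y" for s x y
    using inc[OF that(1), of "y - x" x] that(2) by auto
  have m: "snd m \<le> fst m" "fst m \<le> fst l" "fst m + snd m \<le> fst l + snd l" "fst m \<noteq> fst l \<or> snd m \<noteq> snd l" "snd l \<le> fst l"
    using assms by (auto simp: strictly_below_def partitions2_def dom_le_def prod_eq_iff)
  have "f t0 (fst m) + f 1 (snd m) < f t0 (fst l) + f 1 (snd l)"
  proof (cases "snd m \<le> snd l")
    case True
    then show ?thesis
      using m(2,4) mono[of t0 "fst m" "fst l"] mono[of 1 "snd m" "snd l"] smono[of t0 "fst m" "fst l"] smono[of 1 "snd m" "snd l"]
      by (cases "fst m = fst l") force+
  next
    case False
    define d where "d = snd m - snd l"
    have d: "0 < d" "snd m = snd l + d" "fst m + d \<le> fst l" using False m by (auto simp: d_def)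
    have "f 1 (snd l + d) - f 1 (snd l) < f t0 (fst m + d) - f t0 (fst m)"
      using real_node_exchange[OF q0(2) q0_less R(2) t0_pos t0_less d(1), of "snd l" "fst m"] m False
      by (simp add: f_def)
    moreover have "f t0 (fst m + d) \<le> f t0 (fst l)" using mono d(3) by simp
    ultimately show ?thesis unfolding d(2) by simp
  qed
  then have "node A (fst m) (snd m) \<noteq> node A (fst l) (snd l)"
    unfolding node of_real_eq_iff by simp
  then show ?thesis using eigenvalue_node[OF m(5,1)] t_nz by auto
qed

lemma test_function_orbit_sum: "test_function (orbit_sum m)"
proof -
  obtain i j where m: "m = (i, j)" by (cases m)
  have "continuous_on {p. fst p \<noteq> 0 \<and> snd p \<noteq> 0} (\<lambda>p. chb i (fst p) * chb j (snd p))" for i j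
    by (intro continuous_on_mult continuous_on_chb continuous_intros) auto
  moreover have "(\<lambda>x. chb i x * chb j y) holomorphic_on - {0}" for i j y
    by (intro holomorphic_on_mult holomorphic_on_chb[unfolded eta_contract_eq] holomorphic_on_const)
  ultimately show ?thesis
    unfolding test_function_def m orbit_sum_chb
    by (cases "i = j") (auto simp: chb_inverse intro!: continuous_on_add holomorphic_on_add)
qed

lemma orbit_combination_continuous: "torus_continuous (\<lambda>x y. \<Sum>m\<in>S. u m * orbit_sum m x y)"
  using torus_continuous_test(1)[OF test_function_orbit_sum] unfolding torus_continuous_def
  by (intro continuous_on_sum continuous_on_mult continuous_on_const)

lemma pairing_sum:
  assumes f: "torus_continuous f" and S: "finite S"
  shows "pairing f (\<lambda>x y. \<Sum>m\<in>S. u m * orbit_sum m x y) = (\<Sum>m\<in>S. u m * pairing f (orbit_sum m))"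
  using S
proof (induction S rule: finite_induct)
  case empty
  then show ?case by (simp add: pairing_def torus_mean_def)
next
  case (insert k S)
  have c: "torus_continuous (\<lambda>x y. f x y * orbit_sum k x y * De x y)"
    "torus_continuous (\<lambda>x y. f x y * (\<Sum>m\<in>S. u m * orbit_sum m x y) * De x y)"
    by (intro torus_continuous_mult f continuous_weights orbit_combination_continuous torus_continuous_test test_function_orbit_sum)+
  have c1: "torus_continuous (\<lambda>x y. u k * (f x y * orbit_sum k x y * De x y))"
    by (rule torus_continuous_mult[OF _ c(1)]) (simp add: torus_continuous_def)
  have "pairing f (\<lambda>x y. \<Sum>m\<in>insert k S. u m * orbit_sum m x y) =
     torus_mean (\<lambda>x y. u k * (f x y * orbit_sum k x y * De x y) + f x y * (\<Sum>m\<in>S. u m * orbit_sum m x y) * De x y)"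
    unfolding pairing_def using insert.hyps by (simp add: distrib_left distrib_right mult_ac)
  also have "\<dots> = u k * pairing f (orbit_sum k) + pairing f (\<lambda>x y. \<Sum>m\<in>S. u m * orbit_sum m x y)"
    unfolding torus_mean_linear(1)[OF c1 c(2)] torus_mean_linear(3)[OF c(1) c(1)] pairing_def ..
  finally show ?case using insert by simp
qed

lemma kop_binom_sum_generic:
  assumes "m2 \<le> m1" "generic x y"
  shows "kop (binom_sum m1 m2) x y = eigenvalue m1 m2 * binom_sum m1 m2 x y"
  by (rule kop_binom_sum[OF assms(1) generic_regular[OF assms(2)]])

lemma generic_nz: "generic x y \<Longrightarrow> x \<noteq> 0" "generic x y \<Longrightarrow> y \<noteq> 0"
  by (auto simp: generic_def)

context
  fixes a :: "nat \<Rightarrow> complex"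
  assumes Apar: "Apar q a = A" and a: "a 1 = b1" "a 2 = b2" "a 3 = b3" "a 4 = b4"
begin

text \<open>Eigenfunctions for different partitions are orthogonal; the orbit sums are reached from the
  eigenfunctions by triangularity, by induction along the dominance order (with respect to which \<open>2 m\<^sub>1 + m\<^sub>2\<close> is strictly increasing).\<close>

lemma pairing_orbit_sum:
  assumes l: "l2 \<le> l1" and "m \<in> strictly_below (l1, l2)"
  shows "pairing (binom_sum l1 l2) (orbit_sum m) = 0"
  using assms(2)
proof (induction "2 * fst m + snd m" arbitrary: m rule: less_induct)
  case less
  obtain m1 m2 where m: "m = (m1, m2)" "m2 \<le> m1"
    using less.prems unfolding strictly_below_def partitions2_def by (cases m) auto
  define f where "f = binom_sum l1 l2"
  have f: "test_function f" unfolding f_def by (rule test_function_binom_sum)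
  define E where "E = Evalue q t a m1 m2"
  obtain u where u: "\<And>x y. x \<noteq> 0 \<Longrightarrow> y \<noteq> 0 \<Longrightarrow> E * binom_sum m1 m2 x y
     = orbit_sum (m1, m2) x y + (\<Sum>m\<in>strictly_below (m1, m2). u m * orbit_sum m x y)"
    using binom_sum_triangular[OF m(2) Apar a] unfolding E_def by blast
  \<comment> \<open>The expansion over \<open>below m\<close>, with the top coefficient 1 included.\<close>
  define u' where "u' = u(m := 1)"
  have m_notin: "m \<notin> strictly_below m" by (simp add: strictly_below_def)
  have B: "(\<Sum>k\<in>below m. u' k * h k) = h m + (\<Sum>k\<in>strictly_below m. u k * h k)" for h
  proof -
    have "(\<Sum>k\<in>strictly_below m. u' k * h k) = (\<Sum>k\<in>strictly_below m. u k * h k)"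
      using m_notin by (intro sum.cong refl) (auto simp: u'_def)
    then show ?thesis using m_notin by (simp add: below_def u'_def)
  qed
  have "l1 = fst (l1, l2)" "l2 = snd (l1, l2)" by simp_all
  have ne: "eigenvalue l1 l2 \<noteq> eigenvalue m1 m2"
    using eigenvalue_distinct[OF less.prems] l by (auto simp: partitions2_def m)
  have z: "pairing f (binom_sum m1 m2) = 0"
    unfolding f_def
    by (rule pairing_orthogonal[OF test_function_binom_sum test_function_binom_sum
        kop_binom_sum_generic[OF l] kop_binom_sum_generic[OF m(2)] ne])
  have c: "torus_continuous (\<lambda>x y. f x y * binom_sum m1 m2 x y * De x y)"
    by (intro torus_continuous_mult continuous_weights torus_continuous_test f test_function_binom_sum)
  have "0 = E * torus_mean (\<lambda>x y. f x y * binom_sum m1 m2 x y * De x y)"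
    using z by (simp add: pairing_def)
  also have "\<dots> = torus_mean (\<lambda>x y. E * (f x y * binom_sum m1 m2 x y * De x y))"
    unfolding torus_mean_linear(3)[OF c c] ..
  also have "\<dots> = pairing f (\<lambda>x y. \<Sum>k\<in>below m. u' k * orbit_sum k x y)"
    unfolding pairing_def
  proof (rule torus_mean_generic)
    fix x y assume "generic x y"
    then have e: "E * binom_sum m1 m2 x y = (\<Sum>k\<in>below m. u' k * orbit_sum k x y)"
      unfolding B using u[OF generic_nz] by (simp add: m)
    show "E * (f x y * binom_sum m1 m2 x y * De x y) = f x y * (\<Sum>k\<in>below m. u' k * orbit_sum k x y) * De x y"
      unfolding e[symmetric] by (simp only: ac_simps)
  qed
  also have "\<dots> = (\<Sum>k\<in>below m. u' k * pairing f (orbit_sum k))"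
    by (rule pairing_sum[OF torus_continuous_test(1)[OF f] finite_below])
  also have "\<dots> = pairing f (orbit_sum m) + (\<Sum>k\<in>strictly_below m. u k * pairing f (orbit_sum k))"
    by (rule B)
  also have "(\<Sum>k\<in>strictly_below m. u k * pairing f (orbit_sum k)) = 0"
    using less.hyps[OF strictly_below_less strictly_below_trans[OF _ less.prems]] by (simp add: f_def)
  finally show ?case by (simp add: f_def)
qed

lemma torus_integral_Delta:
  "torus_integral (\<lambda>x y. f x y * g x y * Delta q t a x y) = (2 * of_real pi * \<i>)\<^sup>2 * pairing f g"
proof -
  have "torus_mean (\<lambda>x y. f x y * g x y * Delta q t a x y) = pairing f g"
    unfolding pairing_def
    by (rule torus_mean_generic) (simp add: generic_def Delta_De[OF _ _ _ _ _ _ a])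
  then show ?thesis by (simp add: torus_integral_mean)
qed

text \<open>Uniqueness: the difference of two candidates is a combination of lower orbit sums, hence orthogonal to its own
  complex conjugate, and therefore zero at generic points; by linear independence all its coefficients vanish, so the
  two functions agree everywhere, including arguments 0.\<close>

theorem koornwinder_binom_sum:
  assumes l: "l2 \<le> l1" and xy: "x \<noteq> 0" "y \<noteq> 0"
  shows "koornwinder q t a (l1, l2) x y = Evalue q t a l1 l2 * binom_sum l1 l2 x y"
proof -
  define E where "E = Evalue q t a l1 l2"
  define S where "S = strictly_below (l1, l2)"
  obtain u where u: "\<And>x y. x \<noteq> 0 \<Longrightarrow> y \<noteq> 0 \<Longrightarrow> E * binom_sum l1 l2 x y
     = orbit_sum (l1, l2) x y + (\<Sum>m\<in>S. u m * orbit_sum m x y)"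
    using binom_sum_triangular[OF l Apar a] unfolding E_def S_def by blast
  define P where "P x y = orbit_sum (l1, l2) x y + (\<Sum>m\<in>S. u m * orbit_sum m x y)" for x y
  have fin: "finite S" by (simp add: S_def)
  have ortho: "pairing P (orbit_sum m) = 0" if "m \<in> S" for m
  proof -
    have c: "torus_continuous (\<lambda>x y. binom_sum l1 l2 x y * orbit_sum m x y * De x y)"
      by (intro torus_continuous_mult continuous_weights torus_continuous_test test_function_binom_sum test_function_orbit_sum)
    have "pairing P (orbit_sum m) = torus_mean (\<lambda>x y. E * (binom_sum l1 l2 x y * orbit_sum m x y * De x y))"
      unfolding pairing_def
      by (rule torus_mean_generic) (simp add: P_def u[OF generic_nz, symmetric] mult.assoc)
    also have "\<dots> = E * pairing (binom_sum l1 l2) (orbit_sum m)"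
      unfolding torus_mean_linear(3)[OF c c] pairing_def ..
    finally show ?thesis using pairing_orbit_sum[OF l] that by (simp add: S_def)
  qed
  have "koornwinder q t a (l1, l2) = P"
    unfolding koornwinder_def
  proof (rule the_equality)
    show "is_koornwinder q t a (l1, l2) P"
      unfolding is_koornwinder_def torus_integral_Delta S_def[symmetric]
    proof (intro conjI ballI)
      show "\<exists>u. \<forall>x y. P x y = orbit_sum (l1, l2) x y + (\<Sum>m\<in>S. u m * orbit_sum m x y)"
        by (rule exI[of _ u]) (simp add: P_def)
    qed (simp add: ortho)
  next
    fix P' assume "is_koornwinder q t a (l1, l2) P'"
    then obtain u' where P': "\<And>x y. P' x y = orbit_sum (l1, l2) x y + (\<Sum>m\<in>S. u' m * orbit_sum m x y)"
      and ortho': "\<And>m. m \<in> S \<Longrightarrow> pairing P' (orbit_sum m) = 0"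
      unfolding is_koornwinder_def torus_integral_Delta S_def[symmetric] by auto
    define d where "d m = u' m - u m" for m
    define D where "D x y = (\<Sum>m\<in>S. d m * orbit_sum m x y)" for x y
    have D: "D x y = P' x y - P x y" for x y
      by (simp add: D_def P' P_def d_def left_diff_distrib sum_subtractf)
    have cD: "torus_continuous D" unfolding D_def by (rule orbit_combination_continuous)
    have cP: "torus_continuous P" "torus_continuous P'"
      unfolding P_def P' torus_continuous_def
      by (intro continuous_on_add orbit_combination_continuous[unfolded torus_continuous_def]
          torus_continuous_test(1)[OF test_function_orbit_sum, unfolded torus_continuous_def])+
    have "pairing D (orbit_sum m) = 0" if "m \<in> S" for m
    proof -
      have c: "torus_continuous (\<lambda>x y. P' x y * orbit_sum m x y * De x y)" "torus_continuous (\<lambda>x y. P x y * orbit_sum m x y * De x y)"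
        by (intro torus_continuous_mult cP continuous_weights torus_continuous_test test_function_orbit_sum)+
      have "pairing D (orbit_sum m) = pairing P' (orbit_sum m) - pairing P (orbit_sum m)"
        unfolding pairing_def torus_mean_linear(2)[OF c, symmetric] by (simp add: D left_diff_distrib)
      then show ?thesis using ortho ortho' that by simp
    qed
    then have "pairing D (\<lambda>x y. \<Sum>m\<in>S. cnj (d m) * orbit_sum m x y) = 0"
      unfolding pairing_sum[OF cD fin] by simp
    moreover have "torus_mean (\<lambda>x y. D x y * cnj (D x y) * De x y) = pairing D (\<lambda>x y. \<Sum>m\<in>S. cnj (d m) * orbit_sum m x y)"
      unfolding pairing_def by (rule torus_mean_generic) (simp add: D_def generic_def cnj_orbit_sum)
    ultimately have zero: "D x y = 0" if "generic x y" for x y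
      using pairing_definite[OF cD _ that] by simp
    have "d m = 0" if "m \<in> S" for m
    proof (rule orbit_sums_independent[OF fin, where X = "{x. norm x = 1} - {1, - 1}" and Y = "\<lambda>x. {y. norm y = 1} - {1, - 1, x, 1 / x}"])
      show "infinite ({x :: complex. norm x = 1} - {1, - 1})" "\<And>x. infinite ({y :: complex. norm y = 1} - {1, - 1, x, 1 / x})"
        using infinite_circle by (auto simp del: Diff_insert intro!: Diff_infinite_finite)
      show "(\<Sum>m\<in>S. d m * orbit_sum m x y) = 0"
        if "x \<in> {x. norm x = 1} - {1, - 1}" "y \<in> {y. norm y = 1} - {1, - 1, x, 1 / x}" for x y
        using zero[of x y] that by (simp add: generic_def D_def)
    qed (use that in \<open>auto simp: S_def strictly_below_def\<close>)
    then have "D x y = 0" for x y by (simp add: D_def)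
    then show "P' = P" using D by (intro ext) simp
  qed
  then show ?thesis using u[OF xy] by (simp add: P_def E_def)
qed

end
end
end

lemma norm_prod4_less_1:
  fixes b1 b2 b3 b4 :: complex
  assumes "norm b1 \<le> 1" "norm b2 \<le> 1" "norm b3 \<le> 1" "norm b4 \<le> 1"
    and "norm b1 < 1 \<or> norm b2 < 1 \<or> norm b3 < 1"
  shows "norm (b1 * b2 * b3 * b4) < 1"
proof -
  have l: "x * y < 1" if "x < 1 \<or> y < 1" "0 \<le> x" "x \<le> 1" "0 \<le> y" "y \<le> 1" for x y :: real
    using that mult_le_one[of x y] mult_left_le[of y x] mult_right_le_one_le[of y x] mult_left_le_one_le[of y x] by linarith
  have "norm b1 * norm b2 < 1 \<or> norm b3 < 1"
    using l[of "norm b1" "norm b2"] assms by auto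
  then have "norm b1 * norm b2 * norm b3 < 1"
    using assms by (intro l) (auto intro: mult_le_one)
  then show ?thesis
    unfolding norm_mult using assms by (intro l) auto
qed

text \<open>At most two of the parameters have absolute value 1, because these are \<open>1\<close> or \<open>-1\<close> and each occurs only once;
  so the product of all four is strictly inside the disc.\<close>

lemma koornwinder_weightI:
  fixes q t :: real and b1 b2 b3 b4 :: complex
  assumes q: "0 < q" "q < 1" and t: "0 < t" "t < 1"
    and n: "norm b1 \<le> 1" "norm b2 \<le> 1" "norm b3 \<le> 1" "norm b4 \<le> 1" and "b1 \<noteq> 0"
    and d: "b1 * b2 \<noteq> 1" "b1 * b3 \<noteq> 1" "b1 * b4 \<noteq> 1" "b2 * b3 \<noteq> 1" "b2 * b4 \<noteq> 1" "b3 * b4 \<noteq> 1"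
    and c: "image_mset cnj {#b1, b2, b3, b4#} = {#b1, b2, b3, b4#}"
  shows "koornwinder_weight (of_real q) (of_real t) b1 (- (b2 + b3 + b4)) (b2 * b3 + b2 * b4 + b3 * b4) (- (b2 * b3 * b4)) b2 b3 b4 q t"
proof -
  have "set_mset (image_mset cnj {#b1, b2, b3, b4#}) = set_mset {#b1, b2, b3, b4#}" by (simp only: c)
  then have conj: "cnj ` {b1, b2, b3, b4} = {b1, b2, b3, b4}" by simp
  have unit: "b = 1 \<or> b = - 1" if "b \<in> {b1, b2, b3, b4}" "norm b = 1" for b
  proof -
    have e: "b * cnj b = 1" using complex_norm_square[of b] that by simp
    have "cnj b \<in> {b1, b2, b3, b4}" using conj that(1) by blast
    then have "cnj b = b" using that(1) e d by (auto simp: mult.commute)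
    then have "b\<^sup>2 = 1" using e by (simp add: power2_eq_square)
    then show ?thesis by (simp add: power2_eq_1_iff)
  qed
  have "norm b1 < 1 \<or> norm b2 < 1 \<or> norm b3 < 1"
  proof (rule ccontr)
    assume "\<not> ?thesis"
    then have "norm b1 = 1" "norm b2 = 1" "norm b3 = 1" using n by auto
    then have "b1 = 1 \<or> b1 = - 1" "b2 = 1 \<or> b2 = - 1" "b3 = 1 \<or> b3 = - 1" using unit by auto
    then show False using d by auto
  qed
  then have prod: "norm (b1 * b2 * b3 * b4) < 1" using norm_prod4_less_1 n by blast
  have pw: "norm (of_real q ^ k :: complex) \<le> 1" "0 < k \<Longrightarrow> norm (of_real q ^ k :: complex) < 1" for k
    using q by (auto simp: norm_power power_le_one power_less_one_iff)
  have one: "1 - z \<noteq> 0" if "norm z < 1" for z :: complex using that by auto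
  have tp: "1 - of_real t * b1 * b * of_real q ^ k \<noteq> 0" if "norm b \<le> 1" for b k
  proof (rule one)
    have "norm (b1 * b * of_real q ^ k) \<le> 1"
      unfolding norm_mult using n(1) that pw(1)[of k] by (intro mult_le_one) auto
    then have "t * norm (b1 * b * of_real q ^ k) \<le> t * 1" using t by (intro mult_left_mono) auto
    moreover have "norm (of_real t * b1 * b * of_real q ^ k) = t * norm (b1 * b * of_real q ^ k)"
      using t by (simp add: norm_mult)
    ultimately show "norm (of_real t * b1 * b * of_real q ^ k) < 1" using t by linarith
  qed
  have pp: "1 - b1 * b * of_real q ^ k \<noteq> 0" if "norm b \<le> 1" "b1 * b \<noteq> 1" for b k
  proof (cases "k = 0")
    case False
    have "norm (b1 * b) \<le> 1" unfolding norm_mult using n(1) that by (intro mult_le_one) auto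
    then have "norm (b1 * b) * norm (of_real q ^ k :: complex) \<le> 1 * norm (of_real q ^ k :: complex)"
      by (rule mult_right_mono) simp
    then show ?thesis using pw(2)[of k] False by (intro one) (simp add: norm_mult)
  qed (use that in simp)
  show ?thesis
    by unfold_locales (use q t n d c \<open>b1 \<noteq> 0\<close> unit prod tp pp in auto)
qed

theorem mainTheorem5:
  fixes q t :: real and a :: "nat \<Rightarrow> complex" and m1 m2 :: nat
  assumes "0 < q" "q < 1" "0 < t" "t < 1"
    and "\<forall>j\<in>{1..4}. norm (a j) \<le> 1"
    and "a 1 \<noteq> 0"
    and "\<forall>i\<in>{1..4}. \<forall>j\<in>{1..4}. i \<noteq> j \<longrightarrow> a i * a j \<noteq> 1"
    and "image_mset cnj {#a 1, a 2, a 3, a 4#} = {#a 1, a 2, a 3, a 4#}"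
    and "m2 \<le> m1"
  shows "(\<forall>k1 k2. k2 \<le> k1 \<longrightarrow>
            koornwinder (of_real q) (of_real t) a (k1, k2) (of_real t * a 1) (a 1) =
              Evalue (of_real q) (of_real t) a k1 k2) \<and>
         koornwinder (of_real q) (of_real t) a (m1, m2) (of_real t * a 1) (a 1) \<noteq> 0 \<and>
         (\<forall>x1 x2. x1 \<noteq> 0 \<longrightarrow> x2 \<noteq> 0 \<longrightarrow>
            koornwinder (of_real q) (of_real t) a (m1, m2) x1 x2 /
              koornwinder (of_real q) (of_real t) a (m1, m2) (of_real t * a 1) (a 1) =
            (\<Sum>k2 = 0..m2. \<Sum>k1 = k2..m1.
               Qcoeff (of_real q) (of_real t) a m1 m2 k1 k2 *
               (Npoly (of_real q) (of_real t) a k1 k2 x1 x2 /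
                Evalue (of_real q) (of_real t) a k1 k2)))"
proof -
  define b1 b2 b3 b4 where "b1 = a 1" "b2 = a 2" "b3 = a 3" "b4 = a 4"
  note b = this
  have n: "norm b1 \<le> 1" "norm b2 \<le> 1" "norm b3 \<le> 1" "norm b4 \<le> 1"
    unfolding b using assms(5) by (auto dest: bspec)
  have d: "b1 * b2 \<noteq> 1" "b1 * b3 \<noteq> 1" "b1 * b4 \<noteq> 1" "b2 * b3 \<noteq> 1" "b2 * b4 \<noteq> 1" "b3 * b4 \<noteq> 1"
    using assms(7)[rule_format, of 1 2] assms(7)[rule_format, of 1 3] assms(7)[rule_format, of 1 4]
      assms(7)[rule_format, of 2 3] assms(7)[rule_format, of 2 4] assms(7)[rule_format, of 3 4]
    unfolding b by simp_all
  have nz: "b1 \<noteq> 0" unfolding b by (rule assms(6))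
  interpret koornwinder_weight "of_real q" "of_real t" b1 "- (b2 + b3 + b4)" "b2 * b3 + b2 * b4 + b3 * b4"
    "- (b2 * b3 * b4)" b2 b3 b4 q t
    by (rule koornwinder_weightI[OF assms(1-4) n nz d assms(8)[folded b]])
  have A: "Apar (of_real q) a = A"
    unfolding Apar_def A_def b[symmetric] by (simp add: field_simps)
  note a = b[symmetric]
  have poly: "koornwinder (of_real q) (of_real t) a (k1, k2) x y = Evalue (of_real q) (of_real t) a k1 k2 * binom_sum k1 k2 x y"
    if "k2 \<le> k1" "x \<noteq> 0" "y \<noteq> 0" for k1 k2 x y
    by (rule koornwinder_binom_sum[OF assms(3) A a that])
  have base: "koornwinder (of_real q) (of_real t) a (k1, k2) (of_real t * a 1) (a 1) = Evalue (of_real q) (of_real t) a k1 k2"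
    if "k2 \<le> k1" for k1 k2
    unfolding a using poly[OF that, of "of_real t * b1" b1] binom_sum_base[of k1 k2] nz t_nz by simp
  have E: "Evalue (of_real q) (of_real t) a m1 m2 \<noteq> 0"
    by (rule Evalue_Qden(1)[OF assms(9) A a])
  show ?thesis
  proof (intro conjI allI impI)
    fix x1 x2 :: complex assume x: "x1 \<noteq> 0" "x2 \<noteq> 0"
    show "koornwinder (of_real q) (of_real t) a (m1, m2) x1 x2 /
              koornwinder (of_real q) (of_real t) a (m1, m2) (of_real t * a 1) (a 1) =
            (\<Sum>k2 = 0..m2. \<Sum>k1 = k2..m1.
               Qcoeff (of_real q) (of_real t) a m1 m2 k1 k2 *
               (Npoly (of_real q) (of_real t) a k1 k2 x1 x2 /
                Evalue (of_real q) (of_real t) a k1 k2))"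
      unfolding base[OF assms(9)] poly[OF assms(9) x] binomial_formula[OF assms(9) A a x]
      using E by simp
  qed (use base E assms(9) in simp_all)
qed

end
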